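(* Let $f:[0,1]\to[0,1]$ be continuous, let $I$ be an $n$-periodic interval, $M=\mathrm{orb}\,I$, and let $B=B(M,f)$ be a basic set. Then there exist a transitive non-strictly $n$-periodic map $g:M'\to M'$ and a monotone map $\phi:M\to M'$ such that $\phi$ almost conjugates $f|B$ to $g$. Furthermore, $B$ has the following properties: a) $B$ is a perfect set; b) $f|B$ is transitive; c) if $\omega(z)\supset B$ then $\omega(z)=B$ (i.e. $B$ is a maximal limit set); d) $h(f|B)\ge \ln 2\cdot(2n)^{-1}$; e) $B\subset\overline{\mathrm{Per}\,f}$; f) there exist an interval $J\subset I$, an integer $k=n$ or $k=2n$, and a set $\widetilde B=\overline{\mathrm{int}\,J\cap B}$ such that $f^kJ=J$, $f^k\widetilde B=\widetilde B$, $f^i\widetilde B\cap f^j\widetilde B$ contains no more than one point for $0\le i<j<k$, $\bigcup_{i=0}^{k-1}f^i\widetilde B=B$, and $f^k|\widetilde B$ is almost conjugate to a mixing interval map (one can assume that if $k=n$ then $I=J$).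
   Context: A closed interval $I\subset[0,1]$ is $n$-periodic if $I,fI,\dots,f^{n-1}I$ are pairwise disjoint and $f^nI=I$; $\mathrm{orb}\,I=\bigcup_{i=0}^{n-1}f^iI$. For a set $U$, $\mathrm{orb}\,U=\bigcup_{i\ge0}f^iU$. For $M=\mathrm{orb}\,I$ consider $\{x\in M:\ \overline{\mathrm{orb}\,U}=M$ for every relative neighborhood $U$ of $x$ in $M\}$; if this set is infinite it is called a basic set and denoted $B(M,f)$. A map $T:X\to X$ of a compact metric space is transitive if $\omega(x)=X$ for some $x$ (where $\omega(x)$ is the set of limit points of the orbit of $x$), and mixing if for any nonempty open $U,V$ there is $N$ with $T^nU\cap V\ne\emptyset$ for all $n>N$. $h$ is topological entropy; $\mathrm{Per}\,f$ is the set of periodic points. Non-strictly $l$-periodic map: if $K=\bigcup_{i=1}^lJ_i$ is a union of pairwise disjoint intervals $J_1<\dots<J_l$ of the line, a continuous map $\psi:K\to K$ that permutes the intervals $J_i$ cyclically (each $J_i$ is mapped into the next one in a cyclic permutation) is called non-strictly $l$-periodic. Almost conjugation: let $\psi:K\to K$, $\psi':K'\to K'$ be non-strictly $l$-periodic, let $\phi:K\to K'$ be a monotone (not necessarily strictly) semiconjugation (surjective, continuous, $\phi\circ\psi=\psi'\circ\phi$), and let $F\subset K$ be a $\psi$-invariant closed set such that $\phi(F)=K'$ and, for any $x\in K'$, $\mathrm{int}\,\phi^{-1}(x)\cap F=\emptyset$, so that $\phi^{-1}(x)\cap F\subset\partial\phi^{-1}(x)$ and $1\le\mathrm{card}(\phi^{-1}(x)\cap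 F)\le2$. Then $\phi$ is said to almost conjugate $\psi|F$ to $\psi'$. (In the theorem, $\psi=f|M$, $F=B$; in f), $\psi=f^k|J$ and $F=\widetilde B$.) *)

theory Defs
  imports "HOL-Analysis.Analysis" "HOL-Combinatorics.Orbits"
begin

definition periodic_interval :: "(real \<Rightarrow> real) \<Rightarrow> nat \<Rightarrow> real set \<Rightarrow> bool" where
  "periodic_interval f n I \<longleftrightarrow>
     n \<ge> 1 \<and> (\<exists>a b. a \<le> b \<and> I = {a..b}) \<and> I \<subseteq> {0..1} \<and>
     (\<forall>i<n. \<forall>j<n. i \<noteq> j \<longrightarrow> (f ^^ i) ` I \<inter> (f ^^ j) ` I = {}) \<and>
     (f ^^ n) ` I = I"

definition orb :: "('a \<Rightarrow> 'a) \<Rightarrow> 'a set \<Rightarrow> 'a set" where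
  "orb f U = (\<Union>i. (f ^^ i) ` U)"

definition cycle :: "('a \<Rightarrow> 'a) \<Rightarrow> nat \<Rightarrow> 'a set \<Rightarrow> 'a set" where
  "cycle f n I = (\<Union>i<n. (f ^^ i) ` I)"

definition rel_neighborhood :: "'a::topological_space set \<Rightarrow> 'a \<Rightarrow> 'a set \<Rightarrow> bool" where
  "rel_neighborhood M x U \<longleftrightarrow> U \<subseteq> M \<and> (\<exists>W. openin (top_of_set M) W \<and> x \<in> W \<and> W \<subseteq> U)"

definition basic_set :: "(real \<Rightarrow> real) \<Rightarrow> real set \<Rightarrow> real set \<Rightarrow> bool" where
  "basic_set f M B \<longleftrightarrow>
     B = {x \<in> M. \<forall>U. rel_neighborhood M x U \<longrightarrow> closure (orb f U) = M} \<and> infinite B"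

text \<open>Throughout, a self-map of a set \<open>X\<close> is a total function; its values outside \<open>X\<close> are irrelevant.\<close>

definition Per :: "(real \<Rightarrow> real) \<Rightarrow> real set" where
  "Per f = {x \<in> {0..1}. \<exists>p\<ge>1. (f ^^ p) x = x}"

text \<open>Limit points of the orbit as a sequence, so that the limit set of a periodic point is its orbit.\<close>

definition omega_limit :: "('a::topological_space \<Rightarrow> 'a) \<Rightarrow> 'a \<Rightarrow> 'a set" where
  "omega_limit T x = {y. \<exists>r. strict_mono r \<and> (\<lambda>m. (T ^^ r m) x) \<longlonglongrightarrow> y}"

definition compact_system :: "'a::metric_space set \<Rightarrow> ('a \<Rightarrow> 'a) \<Rightarrow> bool" where
  "compact_system X T \<longleftrightarrow> compact X \<and> continuous_on X T \<and> T ` X \<subseteq> X"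

definition transitive_on :: "'a::metric_space set \<Rightarrow> ('a \<Rightarrow> 'a) \<Rightarrow> bool" where
  "transitive_on X T \<longleftrightarrow> compact_system X T \<and> (\<exists>x\<in>X. omega_limit T x = X)"

definition mixing_on :: "'a::metric_space set \<Rightarrow> ('a \<Rightarrow> 'a) \<Rightarrow> bool" where
  "mixing_on X T \<longleftrightarrow> compact_system X T \<and>
     (\<forall>U V. openin (top_of_set X) U \<and> openin (top_of_set X) V \<and> U \<noteq> {} \<and> V \<noteq> {} \<longrightarrow>
        (\<exists>N. \<forall>m>N. (T ^^ m) ` U \<inter> V \<noteq> {}))"

definition perfect_set :: "'a::topological_space set \<Rightarrow> bool" where
  "perfect_set B \<longleftrightarrow> closed B \<and> (\<forall>x\<in>B. x islimpt B)"

text \<open>Topological entropy in Bowen's form: the exponential growth rate of the maximal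
  cardinality of \<open>(m, \<epsilon>)\<close>-separated subsets, in the limit \<open>\<epsilon> \<rightarrow> 0\<close>.  The growth rate is
  monotone in \<open>\<epsilon>\<close>, so this limit is a supremum; it may be infinite.\<close>

definition separated_subsets :: "'a::metric_space set \<Rightarrow> ('a \<Rightarrow> 'a) \<Rightarrow> nat \<Rightarrow> real \<Rightarrow> 'a set set" where
  "separated_subsets X T m \<epsilon> =
     {E. E \<subseteq> X \<and> finite E \<and> E \<noteq> {} \<and>
         (\<forall>x\<in>E. \<forall>y\<in>E. x \<noteq> y \<longrightarrow> (\<exists>i<m. dist ((T ^^ i) x) ((T ^^ i) y) > \<epsilon>))}"

definition top_entropy :: "'a::metric_space set \<Rightarrow> ('a \<Rightarrow> 'a) \<Rightarrow> ereal" where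
  "top_entropy X T =
     (SUP \<epsilon>\<in>{0<..}. limsup (\<lambda>m. (SUP E\<in>separated_subsets X T m \<epsilon>. ereal (ln (real (card E)))) / ereal (real m)))"

text \<open>The components \<open>J 1 < \<dots> < J l\<close> are compact and nondegenerate; \<open>\<sigma>\<close> is the cyclic
  permutation describing how they are mapped into each other.\<close>

definition nonstrictly_periodic :: "nat \<Rightarrow> real set \<Rightarrow> (real \<Rightarrow> real) \<Rightarrow> bool" where
  "nonstrictly_periodic l K \<psi> \<longleftrightarrow>
     l \<ge> 1 \<and> continuous_on K \<psi> \<and>
     (\<exists>J \<sigma>. (\<forall>i\<in>{1..l}. \<exists>a b. a < b \<and> J i = {a..b}) \<and>
        (\<forall>i\<in>{1..l}. \<forall>j\<in>{1..l}. i < j \<longrightarrow> (\<forall>x\<in>J i. \<forall>y\<in>J j. x < y)) \<and>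
        K = (\<Union>i\<in>{1..l}. J i) \<and>
        cyclic_on \<sigma> {1..l} \<and> (\<forall>i\<in>{1..l}. \<psi> ` J i \<subseteq> J (\<sigma> i)))"

text \<open>\<open>almost_conjugates l \<phi> K \<psi> F K' \<psi>'\<close>: the map \<open>\<phi>\<close> almost conjugates \<open>\<psi>|F\<close> to \<open>\<psi>'\<close>.
  The ambient domain \<open>K\<close> of \<open>\<psi>\<close> is part of the data.  ``Monotone'' is meant on all of \<open>K\<close>,
  in either direction.  Interiors of fibres are taken in the line, so the end points of a fibre
  are always admitted in \<open>F\<close>.\<close>

definition almost_conjugates ::
  "nat \<Rightarrow> (real \<Rightarrow> real) \<Rightarrow> real set \<Rightarrow> (real \<Rightarrow> real) \<Rightarrow> real set \<Rightarrow> real set \<Rightarrow> (real \<Rightarrow> real) \<Rightarrow> bool" where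
  "almost_conjugates l \<phi> K \<psi> F K' \<psi>' \<longleftrightarrow>
     nonstrictly_periodic l K \<psi> \<and> nonstrictly_periodic l K' \<psi>' \<and>
     (mono_on K \<phi> \<or> antimono_on K \<phi>) \<and> continuous_on K \<phi> \<and> \<phi> ` K = K' \<and>
     (\<forall>y\<in>K. \<phi> (\<psi> y) = \<psi>' (\<phi> y)) \<and>
     F \<subseteq> K \<and> closed F \<and> \<psi> ` F \<subseteq> F \<and> \<phi> ` F = K' \<and>
     (\<forall>x\<in>K'. interior {y \<in> K. \<phi> y = x} \<inter> F = {})"

text \<open>Consequently, fibres meet \<open>F\<close> in one or two boundary points.\<close>

lemma almost_conjugates_fibre_frontier:
  assumes "almost_conjugates l \<phi> K \<psi> F K' \<psi>'" and "x \<in> K'"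
  shows "{y \<in> K. \<phi> y = x} \<inter> F \<subseteq> frontier {y \<in> K. \<phi> y = x}"
  using assms closure_subset[of "{y \<in> K. \<phi> y = x}"]
  unfolding almost_conjugates_def frontier_def by blast

lemma disjoint_connected_cover_index:
  fixes J' :: "nat \<Rightarrow> real set"
  assumes S: "connected S" "S \<noteq> {}" "S \<subseteq> (\<Union>i\<in>{1..l}. J' i)"
    and cl: "\<forall>i\<in>{1..l}. closed (J' i)"
    and dj: "\<forall>i\<in>{1..l}. \<forall>j\<in>{1..l}. i \<noteq> j \<longrightarrow> J' i \<inter> J' j = {}"
  shows "\<exists>i\<in>{1..l}. S \<subseteq> J' i"
proof -
  obtain s where s: "s \<in> S" using S by blast
  then obtain i where i: "i \<in> {1..l}" "s \<in> J' i" using S by blast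
  let ?R = "\<Union>j\<in>{1..l} - {i}. J' j"
  have "closed ?R" using cl by (intro closed_UN) auto
  moreover have "closed (J' i)" using cl i by blast
  moreover have "S \<subseteq> J' i \<union> ?R" using S(3) by blast
  moreover have "J' i \<inter> ?R \<inter> S = {}" using dj i by blast
  ultimately have "J' i \<inter> S = {} \<or> ?R \<inter> S = {}"
    using S(1) connected_closedD by blast
  then have "S \<subseteq> J' i" using i s S(3) by blast
  then show ?thesis using i by blast
qed

lemma almost_conjugates_fibre_card:
  assumes ac: "almost_conjugates l \<phi> K \<psi> F K' \<psi>'" and x: "x \<in> K'"
  shows "finite ({y \<in> K. \<phi> y = x} \<inter> F)"
    and "card ({y \<in> K. \<phi> y = x} \<inter> F) \<in> {1, 2}"
proof -
  let ?P = "{y \<in> K. \<phi> y = x}"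
  have nK: "nonstrictly_periodic l K \<psi>" and nK': "nonstrictly_periodic l K' \<psi>'"
    and mon: "mono_on K \<phi> \<or> antimono_on K \<phi>" and cont: "continuous_on K \<phi>"
    and img: "\<phi> ` K = K'" and FK: "F \<subseteq> K" and Fimg: "\<phi> ` F = K'"
    and int0: "\<forall>x\<in>K'. interior {y \<in> K. \<phi> y = x} \<inter> F = {}"
    using ac unfolding almost_conjugates_def by - (elim conjE, assumption)+
  obtain J where J: "\<forall>i\<in>{1..l}. \<exists>a b. a < b \<and> J i = {a..b}" "K = (\<Union>i\<in>{1..l}. J i)"
    using nK unfolding nonstrictly_periodic_def by (elim conjE exE)
  obtain J' where J': "\<forall>i\<in>{1..l}. \<exists>a b. a < b \<and> J' i = {a..b}"
      "\<forall>i\<in>{1..l}. \<forall>j\<in>{1..l}. i < j \<longrightarrow> (\<forall>x\<in>J' i. \<forall>y\<in>J' j. x < y)"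
      "K' = (\<Union>i\<in>{1..l}. J' i)"
    using nK' unfolding nonstrictly_periodic_def by (elim conjE exE)
  have dj: "\<forall>i\<in>{1..l}. \<forall>j\<in>{1..l}. i \<noteq> j \<longrightarrow> J' i \<inter> J' j = {}"
  proof (intro ballI impI)
    fix i j assume "i \<in> {1..l}" "j \<in> {1..l}" "i \<noteq> j"
    then have "(\<forall>x\<in>J' i. \<forall>y\<in>J' j. x < y) \<or> (\<forall>x\<in>J' j. \<forall>y\<in>J' i. x < y)"
      using J'(2) by (metis linorder_neqE_nat)
    then show "J' i \<inter> J' j = {}" by (metis disjoint_iff less_irrefl)
  qed
  have cl: "\<forall>i\<in>{1..l}. closed (J' i)"
  proof
    fix i assume "i \<in> {1..l}"
    then obtain a b where "J' i = {a..b}" using J'(1) by blast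
    then show "closed (J' i)" by simp
  qed
  have "\<exists>j\<in>{1..l}. \<phi> ` J i \<subseteq> J' j" if i: "i \<in> {1..l}" for i
  proof (rule disjoint_connected_cover_index[OF _ _ _ cl dj])
    obtain a b where ab: "a < b" "J i = {a..b}" using J(1) i by blast
    have "continuous_on (J i) \<phi>" using cont J(2) i by (blast intro: continuous_on_subset)
    then show "connected (\<phi> ` J i)" using ab by (simp add: connected_continuous_image)
    show "\<phi> ` J i \<noteq> {}" using ab by auto
    show "\<phi> ` J i \<subseteq> (\<Union>i\<in>{1..l}. J' i)" using img J(2) J'(3) i by blast
  qed
  then have "\<forall>i\<in>{1..l}. \<exists>j. j \<in> {1..l} \<and> \<phi> ` J i \<subseteq> J' j" by blast
  then obtain \<tau> where "\<forall>i\<in>{1..l}. \<tau> i \<in> {1..l} \<and> \<phi> ` J i \<subseteq> J' (\<tau> i)"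
    by (rule bchoice[THEN exE])
  then have \<tau>: "\<tau> i \<in> {1..l}" "\<phi> ` J i \<subseteq> J' (\<tau> i)" if "i \<in> {1..l}" for i
    using that by blast+
  have "{1..l} \<subseteq> \<tau> ` {1..l}"
  proof
    fix j assume j: "j \<in> {1..l}"
    then obtain a b where "a < b" "J' j = {a..b}" using J'(1) by blast
    then have y: "a \<in> J' j" by simp
    then have "a \<in> \<phi> ` K" using img J'(3) j by blast
    then obtain i where i: "i \<in> {1..l}" "a \<in> \<phi> ` J i" using J(2) by blast
    then have "a \<in> J' (\<tau> i)" using \<tau>(2)[OF i(1)] by blast
    then have "J' (\<tau> i) \<inter> J' j \<noteq> {}" using y by blast
    then have "\<tau> i = j" using dj \<tau>(1)[OF i(1)] j by blast
    then show "j \<in> \<tau> ` {1..l}" using i by blast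
  qed
  then have inj: "inj_on \<tau> {1..l}"
    using \<tau>(1) by (intro finite_surj_inj) auto
  have same: "\<exists>i\<in>{1..l}. u \<in> J i \<and> w \<in> J i" if uw: "u \<in> ?P" "w \<in> ?P" for u w
  proof -
    obtain i j where ij: "i \<in> {1..l}" "u \<in> J i" "j \<in> {1..l}" "w \<in> J j" using uw J(2) by blast
    then have "\<phi> u \<in> J' (\<tau> i)" "\<phi> w \<in> J' (\<tau> j)" using \<tau>(2) by blast+
    then have "J' (\<tau> i) \<inter> J' (\<tau> j) \<noteq> {}" using uw by auto
    then have "\<tau> i = \<tau> j" using dj \<tau>(1)[OF ij(1)] \<tau>(1)[OF ij(3)] by blast
    then have "i = j" using inj ij by (meson inj_onD)
    then show ?thesis using ij by blast
  qed
  have no3: False if uvw: "u \<in> ?P \<inter> F" "v \<in> ?P \<inter> F" "w \<in> ?P \<inter> F" "u < v" "v < w" for u v w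
  proof -
    obtain i where i: "i \<in> {1..l}" "u \<in> J i" "w \<in> J i" using same[of u w] uvw by blast
    obtain a b where "J i = {a..b}" using i(1) J(1) by blast
    then have "{u..w} \<subseteq> J i" using i by auto
    then have sub: "{u..w} \<subseteq> K" using i J(2) by blast
    have "\<phi> y = x" if y: "y \<in> {u..w}" for y
    proof -
      have "u \<in> K" "y \<in> K" "w \<in> K" "u \<le> y" "y \<le> w" using sub y uvw by auto
      then have "\<phi> u \<le> \<phi> y \<and> \<phi> y \<le> \<phi> w \<or> \<phi> w \<le> \<phi> y \<and> \<phi> y \<le> \<phi> u"
        using mon by (meson monotone_onD)
      then show ?thesis using uvw by auto
    qed
    then have "{u..w} \<subseteq> ?P" using sub by blast
    then have "{u<..<w} \<subseteq> ?P"
      using greaterThanLessThan_subseteq_atLeastAtMost_iff[of u w u w] by (meson order_refl subset_trans)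
    then have "{u<..<w} \<subseteq> interior ?P" by (rule interior_maximal) simp
    then have "v \<in> interior ?P" using uvw by auto
    then show False using int0[rule_format, OF x] uvw(2) by blast
  qed
  have le2: "card A \<le> 2" if A: "finite A" "A \<subseteq> ?P \<inter> F" for A
  proof (rule ccontr)
    assume "\<not> card A \<le> 2"
    then have "card A \<ge> 3" by simp
    then obtain C where "C \<subseteq> A" "card C = 3" by (meson obtain_subset_with_card_n)
    then obtain p q r where pqr: "{p, q, r} \<subseteq> A" "p \<noteq> q" "q \<noteq> r" "p \<noteq> r"
      by (metis card_3_iff)
    then have "p \<in> ?P \<inter> F" "q \<in> ?P \<inter> F" "r \<in> ?P \<inter> F" using A by auto
    then show False using pqr(2-4) no3 by (smt (verit))
  qed
  show fin: "finite (?P \<inter> F)"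
  proof (rule ccontr)
    assume "infinite (?P \<inter> F)"
    then obtain A where "A \<subseteq> ?P \<inter> F" "finite A" "card A = 3"
      by (meson infinite_arbitrarily_large)
    then show False using le2 by fastforce
  qed
  have "?P \<inter> F \<noteq> {}" using Fimg FK x by blast
  then have "card (?P \<inter> F) \<ge> 1" using fin by (simp add: Suc_leI card_gt_0_iff)
  then show "card (?P \<inter> F) \<in> {1, 2}" using le2[OF fin order_refl] by auto
qed

end

(* Call a subset of M full if its orbit is dense in M; B consists of the points all of whose
   neighborhoods are full. If a full interval is cut into two, one of the pieces is full; hence an
   interval is full iff its interior meets B, and B is perfect. Collapsing the gaps of B by a
   Cantor function phi turns f into a map g of M' = phi(M), because an interval whose interior
   misses B is not full and neither is its image. Topological transitivity of g lifts to B, and the Baire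
   category theorem provides a point of B whose limit set is B.

   It remains to study the transitive interval map G = g^n on a component of M'. Either all powers
   of G are transitive, and then G is mixing because periodic points are dense, or G exchanges the
   two halves of its interval at a fixed point and G^2 is mixing on each half. In both cases G^2 has
   a horseshoe: two intervals with at most one common point, each of which is mapped over both. The
   itineraries of the horseshoe, lifted to B, give the entropy bound. *)

theory Submission
  imports Defs
begin

section \<open>Transitive interval maps and periodic points\<close>

text \<open>The delicate claim is that cutting a full interval leaves a full piece. The orbit
  closures of the two pieces are closed invariant sets with union \<open>M\<close>, and in general
  neither of two such sets has to be \<open>M\<close>. What excludes this is that \<open>B\<close>
  is infinite: if an interval returns to itself and its orbit closure contains \<open>B\<close>,
  then this closure consists of finitely many closed intervals, and one of them has a point of
  \<open>B\<close> in its interior. The same count shows that a gap of \<open>B\<close> is not full,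
  since finitely many images of a full gap would cover \<open>M\<close>. The factor map identifies
  the two ends of a gap. Pieces of \<open>B\<close> are therefore taken as closures of the points
  over an open interval, which picks the correct end of each boundary fibre and leaves at most one
  common point. The entropy bound has \<open>2 * n\<close> because the horseshoe belongs to
  \<open>g ^^ (2 * n)\<close>, which doubles the number of itineraries at each step. Its two
  intervals may share a point, so disjoint cylinders are obtained by appending two fixed letters to
  every \<open>m\<close> free ones; the loss disappears as \<open>m\<close> grows.\<close>

lemma funpow_mem: "f ` S \<subseteq> S \<Longrightarrow> x \<in> S \<Longrightarrow> (f ^^ i) x \<in> S"
  by (induction i) auto

lemma funpow_image_subset: "f ` S \<subseteq> S \<Longrightarrow> (f ^^ i) ` S \<subseteq> S"
  by (rule image_subsetI) (rule funpow_mem)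

lemma funpow_image_eq: "f ` S = S \<Longrightarrow> (f ^^ i) ` S = S"
proof (induction i)
  case (Suc i)
  have "(f ^^ Suc i) ` S = f ` ((f ^^ i) ` S)" by (simp add: image_comp)
  then show ?case using Suc by simp
qed simp

lemma continuous_on_funpow:
  assumes "continuous_on S f" "f ` S \<subseteq> S"
  shows "continuous_on S (f ^^ i)"
proof (induction i)
  case (Suc i)
  have "continuous_on ((f ^^ i) ` S) f"
    by (rule continuous_on_subset[OF assms(1) funpow_image_subset[OF assms(2)]])
  from continuous_on_compose[OF Suc this] show ?case by simp
qed (simp add: id_def)

lemma funpow_mult_fixed: "(f ^^ p) x = x \<Longrightarrow> (f ^^ (p * k)) x = x"
  by (induction k) (auto simp: funpow_add)

lemma ivt_segment:
  fixes F :: "real \<Rightarrow> real"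
  assumes "continuous_on (closed_segment p q) F" "F p \<le> v \<and> v \<le> F q \<or> F q \<le> v \<and> v \<le> F p"
  shows "\<exists>t\<in>closed_segment p q. F t = v"
proof -
  have "connected (F ` closed_segment p q)"
    using assms(1) connected_segment connected_continuous_image by blast
  moreover have "F p \<in> F ` closed_segment p q" "F q \<in> F ` closed_segment p q" by auto
  ultimately have "v \<in> F ` closed_segment p q"
    using assms(2) unfolding is_interval_connected_1[symmetric] is_interval_1 by blast
  then show ?thesis by auto
qed

lemma ivt_Icc:
  fixes F :: "real \<Rightarrow> real"
  assumes "continuous_on {p..q} F" "p \<le> q" "F p \<le> v \<and> v \<le> F q \<or> F q \<le> v \<and> v \<le> F p"
  shows "\<exists>t\<in>{p..q}. F t = v"
  using ivt_segment[of p q F v] assms by (simp add: closed_segment_eq_real_ivl)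

lemma local_interval:
  fixes F :: "real \<Rightarrow> real"
  assumes "continuous_on {a..b} F" "a < b" "t \<in> {a..b}" "u < F t" "F t < v" "\<epsilon> > 0"
  obtains p q where "a \<le> p" "p < q" "q \<le> b" "p \<le> t" "t \<le> q" "t - \<epsilon> < p" "q < t + \<epsilon>"
    "F ` {p..q} \<subseteq> {u<..<v}"
proof -
  have "\<exists>d>0. \<forall>s\<in>{a..b}. dist s t < d \<longrightarrow> dist (F s) (F t) < min (F t - u) (v - F t)"
    using assms(1)[unfolded continuous_on_iff, rule_format, OF assms(3), of "min (F t - u) (v - F t)"]
      assms(4,5) by simp
  then obtain d where d: "d > 0" "\<And>s. s \<in> {a..b} \<Longrightarrow> dist s t < d \<Longrightarrow>
      dist (F s) (F t) < min (F t - u) (v - F t)" by blast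
  define e where "e = min d \<epsilon> / 2"
  have e: "e > 0" "e < d" "e < \<epsilon>" using d(1) assms(6) by (auto simp: e_def min_def)
  show ?thesis
  proof (rule that[of "max a (t - e)" "min b (t + e)"])
    show "F ` {max a (t - e)..min b (t + e)} \<subseteq> {u<..<v}"
    proof
      fix y assume "y \<in> F ` {max a (t - e)..min b (t + e)}"
      then obtain s where s: "y = F s" "s \<in> {a..b}" "\<bar>s - t\<bar> \<le> e" by auto
      then have "dist (F s) (F t) < min (F t - u) (v - F t)" using d(2)[of s] e by (simp add: dist_real_def)
      then show "y \<in> {u<..<v}" using s by (auto simp: dist_real_def)
    qed
  qed (use e assms in auto)
qed

definition itrans :: "real \<Rightarrow> real \<Rightarrow> (real \<Rightarrow> real) \<Rightarrow> bool" where
  "itrans a b G \<longleftrightarrow> a < b \<and> continuous_on {a..b} G \<and> G ` {a..b} = {a..b} \<and>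
     (\<forall>x y u v. a \<le> x \<longrightarrow> x < y \<longrightarrow> y \<le> b \<longrightarrow> a \<le> u \<longrightarrow> u < v \<longrightarrow> v \<le> b \<longrightarrow>
       (\<exists>i. \<exists>s\<in>{x<..<y}. (G ^^ i) s \<in> {u<..<v}))"

lemma itransD:
  assumes "itrans a b G"
  shows "a < b" "continuous_on {a..b} G" "G ` {a..b} = {a..b}" "G ` {a..b} \<subseteq> {a..b}"
    "continuous_on {a..b} (G ^^ i)" "(G ^^ i) ` {a..b} = {a..b}"
    "s \<in> {a..b} \<Longrightarrow> (G ^^ i) s \<in> {a..b}" "s \<in> {a..b} \<Longrightarrow> G s \<in> {a..b}"
    "a \<le> x \<Longrightarrow> x < y \<Longrightarrow> y \<le> b \<Longrightarrow> a \<le> u \<Longrightarrow> u < v \<Longrightarrow> v \<le> b \<Longrightarrow>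
       \<exists>i. \<exists>s\<in>{x<..<y}. (G ^^ i) s \<in> {u<..<v}"
proof -
  show *: "a < b" "continuous_on {a..b} G" "G ` {a..b} = {a..b}" "G ` {a..b} \<subseteq> {a..b}"
    using assms unfolding itrans_def by auto
  then show "continuous_on {a..b} (G ^^ i)" "(G ^^ i) ` {a..b} = {a..b}"
    by (simp_all add: continuous_on_funpow funpow_image_eq)
  then show "s \<in> {a..b} \<Longrightarrow> (G ^^ i) s \<in> {a..b}" "s \<in> {a..b} \<Longrightarrow> G s \<in> {a..b}"
    using *(3) by (metis imageI)+
  show "a \<le> x \<Longrightarrow> x < y \<Longrightarrow> y \<le> b \<Longrightarrow> a \<le> u \<Longrightarrow> u < v \<Longrightarrow> v \<le> b \<Longrightarrow>
       \<exists>i. \<exists>s\<in>{x<..<y}. (G ^^ i) s \<in> {u<..<v}"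
    using assms unfolding itrans_def by blast
qed

text \<open>The target is replaced by an interval that \<open>G ^^ N\<close> sends into it; such an
  interval exists because \<open>G ^^ N\<close> is onto.\<close>

lemma itrans_late:
  assumes "itrans a b G" "a \<le> x" "x < y" "y \<le> b" "a \<le> u" "u < v" "v \<le> b"
  obtains i s where "i \<ge> N" "s \<in> {x<..<y}" "(G ^^ i) s \<in> {u<..<v}"
proof -
  note T = itransD[OF assms(1)]
  have "(u + v) / 2 \<in> {a..b}" using assms by auto
  then obtain t where t: "t \<in> {a..b}" "(G ^^ N) t = (u + v) / 2" using T(6)[of N] by (metis imageE)
  have uv: "u < (G ^^ N) t" "(G ^^ N) t < v" using t assms by auto
  obtain p q where pq: "a \<le> p" "p < q" "q \<le> b" "(G ^^ N) ` {p..q} \<subseteq> {u<..<v}"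
    using local_interval[OF T(5)[of N] T(1) t(1) uv zero_less_one] by metis
  obtain i s where s: "s \<in> {x<..<y}" "(G ^^ i) s \<in> {p<..<q}" using T(9)[OF assms(2-4) pq(1-3)] by blast
  then have "(G ^^ i) s \<in> {p..q}" by simp
  then have "(G ^^ (N + i)) s \<in> {u<..<v}" using pq(4) unfolding funpow_add o_apply by blast
  then show ?thesis using s(1) that[of "N + i" s] by simp
qed

lemma itrans_invariant:
  assumes "itrans a b G" "a \<le> p" "p < q" "q \<le> b" "G ` {p..q} \<subseteq> {p..q}"
  shows "p = a" "q = b"
proof -
  note T = itransD[OF assms(1)]
  have *: "(G ^^ i) s \<in> {p..q}" if "s \<in> {p<..<q}" for i s
    using funpow_mem[OF assms(5), of s i] that by auto
  show "p = a"
  proof (rule ccontr)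
    assume "p \<noteq> a"
    then have "a < p" using assms by auto
    then obtain i s where "s \<in> {p<..<q}" "(G ^^ i) s \<in> {a<..<p}"
      using T(9)[of p q a p] assms by auto
    then show False using *[of s i] by auto
  qed
  show "q = b"
  proof (rule ccontr)
    assume "q \<noteq> b"
    then have "q < b" using assms by auto
    then obtain i s where "s \<in> {p<..<q}" "(G ^^ i) s \<in> {q<..<b}"
      using T(9)[of p q q b] assms by auto
    then show False using *[of s i] by auto
  qed
qed

lemma open_interval_avoiding:
  fixes Q :: "real set"
  assumes "finite Q" "a < b"
  obtains u v where "a \<le> u" "u < v" "v \<le> b" "{u<..<v} \<inter> Q = {}"
proof -
  have "infinite {a<..<b}" using assms by (simp add: infinite_Ioo)
  then obtain z where z: "z \<in> {a<..<b}" "z \<notin> Q" using assms(1) by (meson finite_subset subsetI)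
  have "open ({a<..<b} - Q)" using assms(1) by (intro open_Diff finite_imp_closed) auto
  then obtain e where e: "e > 0" "cball z e \<subseteq> {a<..<b} - Q" using z open_contains_cball by (metis DiffI)
  then have "{z-e..z+e} \<subseteq> {a<..<b} - Q" by (simp add: cball_eq_atLeastAtMost)
  moreover have "z - e \<in> {z-e..z+e}" "z + e \<in> {z-e..z+e}" using e by auto
  moreover have "{z-e<..<z+e} \<subseteq> {z-e..z+e}" by auto
  ultimately show ?thesis using that[of "z-e" "z+e"] e(1) by fastforce
qed

text \<open>If \<open>G ^^ i\<close> sent an interval to \<open>w\<close>, a return of the interval
  to itself would make \<open>w\<close> periodic. All late images of the interval would then lie in
  a finite orbit, and an open interval missing that orbit would contradict transitivity.\<close>

lemma itrans_no_collapse: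
  assumes "itrans a b G" "a \<le> x" "x < y" "y \<le> b"
  shows "\<not> (\<exists>w. (G ^^ i) ` {x<..<y} \<subseteq> {w})"
proof
  assume "\<exists>w. (G ^^ i) ` {x<..<y} \<subseteq> {w}"
  then obtain w where "(G ^^ i) ` {x<..<y} \<subseteq> {w}" by blast
  then have w: "\<And>s. s \<in> {x<..<y} \<Longrightarrow> (G ^^ i) s = w" by blast
  obtain m s where m: "m \<ge> Suc i" "s \<in> {x<..<y}" "(G ^^ m) s \<in> {x<..<y}"
    using itrans_late[OF assms assms(2-4), of "Suc i"] by blast
  define p where "p = (G ^^ m) s"
  have late: "(G ^^ (t + i)) r = (G ^^ t) w" if "r \<in> {x<..<y}" for r t
    using w[OF that] by (simp add: funpow_add)
  have pw: "(G ^^ (m - i)) w = p" using late[OF m(2), of "m - i"] m(1) by (simp add: p_def)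
  have "(G ^^ m) w = w"
  proof -
    have "(G ^^ (i + (m - i))) w = (G ^^ i) p" unfolding funpow_add o_def pw ..
    then show ?thesis using w[of p] m(1,3) by (simp add: p_def)
  qed
  then have per: "(G ^^ t) w = (G ^^ (t mod m)) w" for t
    by (metis funpow_mod_eq)
  obtain u v where uv: "a \<le> u" "u < v" "v \<le> b" "{u<..<v} \<inter> (\<lambda>t. (G ^^ t) w) ` {..<m} = {}"
    using open_interval_avoiding[of "(\<lambda>t. (G ^^ t) w) ` {..<m}" a b] itransD(1)[OF assms(1)] by auto
  obtain j r where j: "j \<ge> i" "r \<in> {x<..<y}" "(G ^^ j) r \<in> {u<..<v}"
    using itrans_late[OF assms uv(1-3)] by blast
  have "(G ^^ j) r = (G ^^ ((j - i) mod m)) w" using late[OF j(2), of "j - i"] j(1) per by simp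
  moreover have "(j - i) mod m < m" using m(1) by auto
  ultimately show False using j(3) uv(4) by blast
qed

text \<open>A first crossing would produce a fixed point of an iterate between \<open>z\<close> and its first
  image.\<close>

lemma iterates_stay:
  fixes g :: "real \<Rightarrow> real"
  assumes cont: "continuous_on S g" "g ` S \<subseteq> S" and J: "is_interval J" "J \<subseteq> S"
    and np: "\<And>t k. t \<in> J \<Longrightarrow> k \<ge> 1 \<Longrightarrow> (g ^^ k) t \<noteq> t"
    and z: "z \<in> J" "g z \<in> J" "s = 1 \<or> s = - 1" "s * z < s * g z" and k: "k \<ge> 1"
  shows "s * z < s * (g ^^ k) z"
  using k
proof (induction k rule: dec_induct)
  case base
  show ?case using z by simp
next
  case (step k)
  show ?case
  proof (rule ccontr)
    assume *: "\<not> s * z < s * (g ^^ Suc k) z"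
    define F where "F t = s * ((g ^^ k) t - t)" for t
    have sub: "closed_segment z (g z) \<subseteq> J" using J(1) z(1,2)
      by (metis closed_segment_subset is_interval_convex)
    then have "continuous_on (closed_segment z (g z)) F"
      unfolding F_def using J(2) continuous_on_subset[OF continuous_on_funpow[OF cont, of k]]
      by (intro continuous_intros) blast
    moreover have "F z \<ge> 0" using step by (simp add: F_def right_diff_distrib)
    moreover have "F (g z) \<le> 0"
      using * z(4) by (simp add: F_def right_diff_distrib funpow_swap1)
    ultimately obtain t where "t \<in> closed_segment z (g z)" "F t = 0"
      using ivt_segment[of z "g z" F 0] by blast
    then show False using np[of t k] sub step z(3) by (auto simp: F_def)
  qed
qed

text \<open>Suppose \<open>z\<close> moves in direction \<open>s\<close> under \<open>f ^^ m\<close>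
  while the later iterate falls behind \<open>w = (f ^^ m) z\<close>. Then \<open>f ^^ j\<close>
  with \<open>j = n - m\<close> moves \<open>w\<close> backwards. By \<open>iterates_stay\<close>
  both motions persist under further iteration, the first up to the \<open>j\<close>-th power and
  the second up to the \<open>m\<close>-th. Both powers equal \<open>f ^^ (m * j)\<close>, whose
  displacement thus changes sign between \<open>z\<close> and \<open>w\<close> and produces a
  periodic point.\<close>

lemma no_periodic_monotone:
  fixes f :: "real \<Rightarrow> real"
  assumes cont: "continuous_on S f" "f ` S \<subseteq> S" and J: "is_interval J" "J \<subseteq> S"
    and np: "\<And>t k. t \<in> J \<Longrightarrow> k \<ge> 1 \<Longrightarrow> (f ^^ k) t \<noteq> t"
    and z: "z \<in> J" "(f ^^ m) z \<in> J" "(f ^^ n) z \<in> J" "0 < m" "m < n"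
    and s: "s = 1 \<or> s = - 1" "s * z < s * (f ^^ m) z"
  shows "s * (f ^^ m) z < s * (f ^^ n) z"
proof (rule ccontr)
  assume c: "\<not> ?thesis"
  define j where "j = n - m"
  define w where "w = (f ^^ m) z"
  have fj: "(f ^^ j) w = (f ^^ n) z"
    using z(4,5) by (simp add: w_def j_def flip: funpow_add[THEN fun_cong, unfolded o_apply])
  have npj: "((f ^^ i) ^^ k) t \<noteq> t" if "t \<in> J" "i \<ge> 1" "k \<ge> 1" for i k t
    using np[of t "i * k"] that by (simp add: funpow_mult mult.commute)
  have j1: "j \<ge> 1" using z by (simp add: j_def)
  have "(f ^^ j) w \<noteq> w" using np[of w j] z j1 by (simp add: w_def)
  then have "s * (f ^^ j) w < s * w" using c s(1) fj by (auto simp: w_def)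
  then have wless: "(- s) * w < (- s) * ((f ^^ j) w)" by simp
  note ci = continuous_on_funpow[OF cont] funpow_image_subset[OF cont(2)]
  have A: "s * z < s * ((f ^^ m) ^^ j) z"
    by (rule iterates_stay[OF ci J _ z(1,2) s j1]) (use npj z(4) in auto)
  have B: "(- s) * w < (- s) * ((f ^^ j) ^^ m) w"
    by (rule iterates_stay[OF ci J _ _ _ _ wless]) (use npj j1 z s fj w_def in auto)
  define F where "F t = s * ((f ^^ (m * j)) t - t)" for t
  have sub: "closed_segment z w \<subseteq> J" using J(1) z(1,2)
    by (metis closed_segment_subset is_interval_convex w_def)
  then have "continuous_on (closed_segment z w) F"
    unfolding F_def using J(2) continuous_on_subset[OF ci(1)] by (intro continuous_intros) blast
  moreover have "F z \<ge> 0" using A by (simp add: F_def right_diff_distrib funpow_mult mult.commute)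
  moreover have "F w \<le> 0" using B by (simp add: F_def right_diff_distrib funpow_mult mult.commute)
  ultimately obtain t where "t \<in> closed_segment z w" "F t = 0"
    using ivt_segment[of z w F 0] by blast
  then show False using np[of t "m * j"] sub z j1 s by (auto simp: F_def)
qed

text \<open>Returns to an interval without periodic points move away from the starting point, all on
  one side of it. This is the source of periodic points both for transitive interval maps and for
  \<open>f\<close> near \<open>B\<close>.\<close>

lemma no_periodic_no_recurrence:
  fixes f :: "real \<Rightarrow> real"
  assumes cont: "continuous_on S f" "f ` S \<subseteq> S" and J: "is_interval J" "J \<subseteq> S"
    and np: "\<And>t k. t \<in> J \<Longrightarrow> k \<ge> 1 \<Longrightarrow> (f ^^ k) t \<noteq> t"
    and z: "z \<in> J" "(f ^^ m) z \<in> J" "(f ^^ n) z \<in> J" "0 < m" "m < n"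
  shows "\<bar>(f ^^ n) z - z\<bar> \<ge> \<bar>(f ^^ m) z - z\<bar>"
proof -
  have "(f ^^ m) z \<noteq> z" using np[of z m] z by simp
  then show ?thesis
    using no_periodic_monotone[OF cont J np z, of 1] no_periodic_monotone[OF cont J np z, of "- 1"]
    by (cases "z < (f ^^ m) z") auto
qed

lemma itrans_periodic_dense:
  assumes "itrans a b G" "a \<le> x" "x < y" "y \<le> b"
  shows "\<exists>t\<in>{x<..<y}. \<exists>k\<ge>1. (G ^^ k) t = t"
proof (rule ccontr)
  assume "\<not> ?thesis"
  then have np: "\<And>t k. t \<in> {x<..<y} \<Longrightarrow> k \<ge> 1 \<Longrightarrow> (G ^^ k) t \<noteq> t" by blast
  note T = itransD[OF assms(1)]
  obtain m s where m: "m \<ge> 1" "s \<in> {x<..<y}" "(G ^^ m) s \<in> {x<..<y}"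
    using itrans_late[OF assms assms(2-4), of 1] by blast
  \<comment> \<open>A return of displacement \<open>e\<close> is perturbed by less than
    \<open>e/4\<close> at each end: for \<open>r\<close> near \<open>s\<close> the displacement at
    time \<open>m\<close> exceeds \<open>e/2\<close>, whereas a later return of \<open>r\<close> to
    the neighborhood of \<open>s\<close> has displacement below \<open>e/2\<close>.\<close>
  define e where "e = \<bar>(G ^^ m) s - s\<bar>"
  have e: "e > 0" using np[OF m(2,1)] by (simp add: e_def)
  have sab: "s \<in> {a..b}" using m assms by auto
  have "\<exists>u v. u < (G ^^ m) s \<and> (G ^^ m) s < v \<and> {u<..<v} \<subseteq> {x<..<y} \<inter> {(G ^^ m) s - e/4<..<(G ^^ m) s + e/4}"
    using m e by (intro exI[of _ "max x ((G ^^ m) s - e/4)"] exI[of _ "min y ((G ^^ m) s + e/4)"]) auto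
  then obtain u v where uv: "u < (G ^^ m) s" "(G ^^ m) s < v"
    "{u<..<v} \<subseteq> {x<..<y} \<inter> {(G ^^ m) s - e/4<..<(G ^^ m) s + e/4}" by blast
  have e': "min (e/4) (min (s - x) (y - s)) > 0" using e m(2) by auto
  obtain p q where pq: "a \<le> p" "p < q" "q \<le> b" "p \<le> s" "s \<le> q"
      "s - min (e/4) (min (s - x) (y - s)) < p" "q < s + min (e/4) (min (s - x) (y - s))"
      "(G ^^ m) ` {p..q} \<subseteq> {u<..<v}"
    using local_interval[OF T(5) T(1) sab uv(1,2) e'] by metis
  obtain i r where i: "i \<ge> Suc m" "r \<in> {p<..<q}" "(G ^^ i) r \<in> {p<..<q}"
    using itrans_late[OF assms(1) pq(1-3) pq(1-3), of "Suc m"] by blast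
  have near: "\<And>t. t \<in> {p<..<q} \<Longrightarrow> t \<in> {x<..<y} \<and> \<bar>t - s\<bar> < e/4"
  proof -
    have "s - e/4 < p" "x < p" "q < s + e/4" "q < y" using pq(6,7) by (simp_all add: min_def split: if_splits)
    then show "t \<in> {x<..<y} \<and> \<bar>t - s\<bar> < e/4" if "t \<in> {p<..<q}" for t
      using that unfolding greaterThanLessThan_iff by (intro conjI) linarith+
  qed
  have "r \<in> {p..q}" using i(2) by simp
  then have "(G ^^ m) r \<in> {u<..<v}" using pq(8) by blast
  then have "(G ^^ m) r \<in> {x<..<y} \<inter> {(G ^^ m) s - e/4<..<(G ^^ m) s + e/4}" using uv(3) by blast
  then have rm: "(G ^^ m) r \<in> {x<..<y}" "\<bar>(G ^^ m) r - (G ^^ m) s\<bar> < e/4"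
    unfolding Int_iff greaterThanLessThan_iff by linarith+
  have "\<bar>(G ^^ i) r - r\<bar> \<ge> \<bar>(G ^^ m) r - r\<bar>"
  proof (rule no_periodic_no_recurrence[OF T(2,4) _ _ np])
    show "is_interval {x<..<y}" by (simp add: is_interval_1)
  qed (use i rm near m assms in auto)
  moreover have "\<bar>(G ^^ i) r - r\<bar> < e/2"
    using conjunct2[OF near[OF i(2)]] conjunct2[OF near[OF i(3)]] by linarith
  moreover have "\<bar>(G ^^ m) r - r\<bar> > e/2"
  proof -
    have "e \<le> \<bar>(G ^^ m) r - (G ^^ m) s\<bar> + \<bar>(G ^^ m) r - r\<bar> + \<bar>r - s\<bar>"
      unfolding e_def by linarith
    then show ?thesis using rm(2) conjunct2[OF near[OF i(2)]] by linarith
  qed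
  ultimately show False by linarith
qed

section \<open>Horseshoes\<close>

text \<open>For continuous \<open>F\<close>, the intervals from \<open>u\<close> to \<open>c\<close>
  and from \<open>c\<close> to \<open>d\<close> are each mapped over the interval from
  \<open>u\<close> to \<open>d\<close>. The second alternative is the mirror image, so that the
  notion survives \<open>reflect\<close>.\<close>

definition horseshoe :: "(real \<Rightarrow> real) \<Rightarrow> real \<Rightarrow> real \<Rightarrow> real \<Rightarrow> bool" where
  "horseshoe F u c d \<longleftrightarrow> F u = u \<and> F d = u \<and> (u < c \<and> c < d \<and> d \<le> F c \<or> d < c \<and> c < u \<and> F c \<le> d)"

definition has_horseshoe :: "real \<Rightarrow> real \<Rightarrow> (real \<Rightarrow> real) \<Rightarrow> bool" where
  "has_horseshoe a b F \<longleftrightarrow> (\<exists>u\<in>{a..b}. \<exists>c\<in>{a..b}. \<exists>d\<in>{a..b}. horseshoe F u c d)"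

definition reflect :: "(real \<Rightarrow> real) \<Rightarrow> real \<Rightarrow> real" where
  "reflect G x = - G (- x)"

lemma reflect_funpow: "reflect G ^^ i = reflect (G ^^ i)"
  by (induction i) (auto simp: reflect_def fun_eq_iff)

lemma itrans_reflect:
  assumes "itrans a b G"
  shows "itrans (- b) (- a) (reflect G)"
proof -
  note T = itransD[OF assms]
  have im: "uminus ` {- b..- a} = {a..b}" by simp
  have "continuous_on {- b..- a} (G \<circ> uminus)"
    by (intro continuous_on_compose continuous_intros) (simp add: T(2))
  then have "continuous_on {- b..- a} (reflect G)"
    unfolding reflect_def o_def by (rule continuous_on_minus)
  moreover have "reflect G ` {- b..- a} = {- b..- a}"
  proof -
    have "reflect G ` {- b..- a} = uminus ` (G ` (uminus ` {- b..- a}))"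
      by (simp only: image_image flip: reflect_def)
    also have "\<dots> = uminus ` {a..b}" unfolding im T(3) ..
    finally show ?thesis by simp
  qed
  moreover have "\<exists>i. \<exists>s\<in>{x<..<y}. (reflect G ^^ i) s \<in> {u<..<v}"
    if h: "- b \<le> x" "x < y" "y \<le> - a" "- b \<le> u" "u < v" "v \<le> - a" for x y u v
  proof -
    obtain i s where "s \<in> {- y<..<- x}" "(G ^^ i) s \<in> {- v<..<- u}"
      using T(9)[of "- y" "- x" "- v" "- u"] h by auto
    then show ?thesis unfolding reflect_funpow
      by (intro exI[of _ i] bexI[of _ "- s"]) (auto simp: reflect_def)
  qed
  ultimately show ?thesis using T(1) unfolding itrans_def by simp
qed

lemma has_horseshoe_reflect:
  assumes "has_horseshoe (- b) (- a) (reflect F)"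
  shows "has_horseshoe a b F"
proof -
  obtain u c d where "u \<in> {- b..- a}" "c \<in> {- b..- a}" "d \<in> {- b..- a}" "horseshoe (reflect F) u c d"
    using assms unfolding has_horseshoe_def by blast
  then show ?thesis unfolding has_horseshoe_def
    by (intro bexI[of _ "- u"] bexI[of _ "- c"] bexI[of _ "- d"]) (auto simp: horseshoe_def reflect_def)
qed

text \<open>Keep the base \<open>u\<close> and pull back inside the first leg: \<open>c2\<close>
  goes to \<open>c\<close> and \<open>d2\<close> to \<open>d\<close>. The square then sends
  \<open>d2\<close> to \<open>u\<close>, and \<open>c2\<close> to \<open>G c\<close>, which is at or
  beyond \<open>d\<close> and so beyond \<open>d2\<close>.\<close>

lemma has_horseshoe_square:
  assumes cont: "continuous_on {a..b} G" and "has_horseshoe a b G"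
  shows "has_horseshoe a b (G ^^ 2)"
proof -
  obtain u c d where ucd: "u \<in> {a..b}" "c \<in> {a..b}" "d \<in> {a..b}" "horseshoe G u c d"
    using assms unfolding has_horseshoe_def by blast
  have sub: "closed_segment u c \<subseteq> {a..b}" using ucd by (auto simp: closed_segment_eq_real_ivl)
  obtain c2 where c2: "c2 \<in> closed_segment u c" "G c2 = c"
    using ivt_segment[of u c G c] continuous_on_subset[OF cont sub] ucd(4)
    unfolding horseshoe_def by fastforce
  have sub2: "closed_segment c2 c \<subseteq> closed_segment u c"
    using c2 by (simp add: subset_closed_segment)
  obtain d2 where d2: "d2 \<in> closed_segment c2 c" "G d2 = d"
    using ivt_segment[of c2 c G d] continuous_on_subset[OF cont] sub sub2 ucd(4) c2(2)
    unfolding horseshoe_def by (smt (verit) subset_trans)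
  have "c2 \<noteq> u" "d2 \<noteq> c2" "u \<noteq> c" using c2(2) d2(2) ucd(4) by (auto simp: horseshoe_def)
  then have "horseshoe (G ^^ 2) u c2 d2"
    using ucd(4) c2 d2 unfolding horseshoe_def
    by (auto simp: numeral_2_eq_2 closed_segment_eq_real_ivl split: if_splits)
  then show ?thesis using ucd sub sub2 c2 d2 unfolding has_horseshoe_def by blast
qed

text \<open>The horseshoe is based at the largest fixed point \<open>u\<close> below an upward moving point whose
  orbit later drops below \<open>u\<close>.\<close>

lemma horseshoe_of_down_up:
  assumes G: "itrans a b G" and wy: "w \<in> {a..b}" "y \<in> {a..b}" "w < y" "G w < w" "y < G y"
  shows "has_horseshoe a b G"
proof -
  note T = itransD[OF G]
  have contd: "continuous_on {a..b} (\<lambda>t. G t - t)" using T(2) by (intro continuous_intros)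
  \<comment> \<open>Half the distance keeps the perturbed points in the order
    \<open>w' < y'\<close>; the perturbation puts \<open>w'\<close> on the orbit of
    \<open>y'\<close>.\<close>
  define e where "e = (y - w) / 2"
  have e: "e > 0" using wy by (simp add: e_def)
  have h1: "0 < G y - y" "G y - y < G y - y + 1" "G w - w - 1 < G w - w" "G w - w < 0" using wy by auto
  obtain p q where pq: "a \<le> p" "p < q" "q \<le> b" "p \<le> y" "y \<le> q" "y - e < p" "q < y + e"
    "(\<lambda>t. G t - t) ` {p..q} \<subseteq> {0<..<G y - y + 1}"
    by (rule local_interval[OF contd T(1) wy(2) h1(1,2) e]) blast
  obtain p' q' where pq': "a \<le> p'" "p' < q'" "q' \<le> b" "p' \<le> w" "w \<le> q'" "w - e < p'" "q' < w + e"
    "(\<lambda>t. G t - t) ` {p'..q'} \<subseteq> {G w - w - 1<..<0}"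
    by (rule local_interval[OF contd T(1) wy(1) h1(3,4) e]) blast
  obtain m y' where m: "y' \<in> {p<..<q}" "(G ^^ m) y' \<in> {p'<..<q'}"
    using T(9)[OF pq(1-3) pq'(1-3)] by blast
  define w' where "w' = (G ^^ m) y'"
  have "y' \<in> {p..q}" "w' \<in> {p'..q'}" using m by (auto simp: w'_def)
  then have up: "y' < G y'" and dn: "G w' < w'" using pq(8) pq'(8) by (force simp: image_subset_iff)+
  have wy': "w' < y'" using m pq(6) pq'(7) unfolding e_def w'_def greaterThanLessThan_iff by argo
  have in': "a \<le> w'" "y' \<le> b" using m pq' pq by (auto simp: w'_def)
  define Z where "Z = {t\<in>{w'..y'}. G t - t = 0}"
  have sub: "{w'..y'} \<subseteq> {a..b}" using in' wy' by auto
  have "closed Z" unfolding Z_def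
    by (rule continuous_closed_preimage_constant[OF continuous_on_subset[OF contd sub]]) simp
  moreover have "bounded Z" by (rule bounded_subset[of "{w'..y'}"]) (auto simp: Z_def)
  moreover have "Z \<noteq> {}"
    using ivt_Icc[OF continuous_on_subset[OF contd sub], of 0] up dn wy' by (auto simp: Z_def)
  ultimately obtain u where u: "u \<in> Z" "\<And>t. t \<in> Z \<Longrightarrow> t \<le> u"
    using compact_attains_sup compact_eq_bounded_closed by metis
  have Gu: "G u = u" and uin: "w' \<le> u" "u \<le> y'" using u(1) by (auto simp: Z_def)
  have "u \<noteq> w'" "u \<noteq> y'" using Gu up dn by auto
  then have uin': "w' < u" "u < y'" using uin by auto
  have above: "G t > t" if t: "u < t" "t \<le> y'" for t
  proof (rule ccontr)
    assume "\<not> G t > t"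
    then have "\<exists>r\<in>{t..y'}. G r - r = 0"
      using ivt_Icc[OF continuous_on_subset[OF contd], of t y' 0] up in' t uin' by auto
    then show False using u(2) t uin' by (fastforce simp: Z_def)
  qed
  have orbit_leaves: False if inv: "\<And>t. t \<in> S \<Longrightarrow> G t \<in> S" "y' \<in> S" "w' \<notin> S" for S
  proof -
    have "(G ^^ i) y' \<in> S" for i using inv(1,2) by (induction i) auto
    then show False using inv(3) w'_def by metis
  qed
  define P where "P = {t\<in>{y'..b}. G t = u}"
  have sub2: "{y'..b} \<subseteq> {a..b}" using in' wy' by auto
  have abv: "G t > u" if "y' \<le> t" "t \<le> b" "\<And>r. y' \<le> r \<Longrightarrow> r \<le> t \<Longrightarrow> G r \<noteq> u" for t
  proof (rule ccontr)
    assume "\<not> G t > u"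
    then have "\<exists>r\<in>{y'..t}. G r = u"
      using ivt_Icc[OF continuous_on_subset[OF T(2)], of y' t u] up in' that uin' wy' by auto
    then show False using that by auto
  qed
  \<comment> \<open>Without a preimage of \<open>u\<close> to the right of \<open>y'\<close>, the
    set \<open>{u<..b}\<close> would be invariant, although the orbit of \<open>y'\<close> reaches
    \<open>w' < u\<close>.\<close>
  have "P \<noteq> {}"
  proof
    assume P0: "P = {}"
    have "G t \<in> {u<..b}" if "t \<in> {u<..b}" for t
    proof (cases "t \<le> y'")
      case True
      then show ?thesis using above[of t] T(8)[of t] that in' uin' by auto
    next
      case False
      then show ?thesis using abv[of t] P0 T(8)[of t] that in' uin' by (auto simp: P_def)
    qed
    then show False using orbit_leaves[of "{u<..b}"] uin' in' by auto
  qed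
  moreover have "closed P" unfolding P_def
    by (rule continuous_closed_preimage_constant[OF continuous_on_subset[OF T(2) sub2]]) simp
  moreover have "bounded P" by (rule bounded_subset[of "{y'..b}"]) (auto simp: P_def)
  ultimately obtain d where d: "d \<in> P" "\<And>t. t \<in> P \<Longrightarrow> d \<le> t"
    using compact_attains_inf compact_eq_bounded_closed by metis
  have din: "y' \<le> d" "d \<le> b" "G d = u" using d(1) by (auto simp: P_def)
  have "d \<noteq> y'" using din up uin' by auto
  then have din': "y' < d" using din by auto
  \<comment> \<open>As \<open>d\<close> is the first preimage of \<open>u\<close> beyond
    \<open>y'\<close>, no point of \<open>{u<..<d}\<close> is sent to \<open>u\<close> or below. If
    none were sent to \<open>d\<close> or beyond, this set would be invariant and would trap the
    orbit of \<open>y'\<close>.\<close>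
  have "\<exists>c\<in>{u<..<d}. d \<le> G c"
  proof (rule ccontr)
    assume no: "\<not> ?thesis"
    have "G t \<in> {u<..<d}" if "t \<in> {u<..<d}" for t
    proof (cases "t \<le> y'")
      case True
      moreover have "G t < d" using no that by (meson not_le)
      ultimately show ?thesis using above[of t] that by auto
    next
      case False
      have "G r \<noteq> u" if "y' \<le> r" "r \<le> t" for r
        using d(2)[of r] that \<open>t \<in> {u<..<d}\<close> din by (auto simp: P_def)
      moreover have "G t < d" using no that by (meson not_le)
      ultimately show ?thesis using abv[of t] False that din by auto
    qed
    then show False using orbit_leaves[of "{u<..<d}"] uin' din' by auto
  qed
  then obtain c where "c \<in> {u<..<d}" "d \<le> G c" by blast
  then have "horseshoe G u c d" using Gu din unfolding horseshoe_def by auto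
  then show ?thesis using in' uin' din din' \<open>c \<in> {u<..<d}\<close> unfolding has_horseshoe_def by fastforce
qed

text \<open>Without a horseshoe, no point above \<open>a\<close> is sent to \<open>a\<close>, and
  every point below an upward moving one moves weakly upward. Given an upward moving
  \<open>y\<close>, the values of \<open>G\<close> on \<open>{y..b}\<close> have a minimum above
  \<open>a\<close>, so some \<open>{m..b}\<close> with \<open>m > a\<close> is invariant, against
  transitivity.\<close>

lemma horseshoe_of_fixed_left_end:
  assumes G: "itrans a b G" and fa: "G a = a"
  shows "has_horseshoe a b G"
proof (rule ccontr)
  assume no: "\<not> ?thesis"
  note T = itransD[OF G]
  have mono: "t \<le> G t" if "y \<in> {a..b}" "y < G y" "t \<in> {a..b}" "t < y" for t y
    using horseshoe_of_down_up[OF G that(3,1,4)] that no by force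
  have acc: "G d \<noteq> a" if d: "a < d" "d \<le> b" for d
  proof
    assume Gd: "G d = a"
    \<comment> \<open>For \<open>d = b\<close> this is surjectivity; for \<open>d < b\<close> the
      interval \<open>{a..d}\<close> would otherwise be invariant.\<close>
    have "\<exists>c\<in>{a..d}. d \<le> G c"
    proof (cases "d = b")
      case True
      then show ?thesis using T(1,3) by (metis atLeastAtMost_iff imageE order.refl less_imp_le)
    next
      case False
      show ?thesis
      proof (rule ccontr)
        assume n: "\<not> ?thesis"
        have "G ` {a..d} \<subseteq> {a..d}"
        proof (rule image_subsetI)
          fix t assume t: "t \<in> {a..d}"
          then have "G t < d" using n by (meson not_le)
          then show "G t \<in> {a..d}" using T(8)[of t] t d by simp
        qed
        then show False using itrans_invariant(2)[OF G, of a d] d False by simp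
      qed
    qed
    then obtain c where c: "c \<in> {a..d}" "d \<le> G c" by blast
    then have "c \<noteq> a" "c \<noteq> d" using fa Gd d by auto
    then have "horseshoe G a c d" using c fa Gd d unfolding horseshoe_def by auto
    then show False using no c d T(1) unfolding has_horseshoe_def by fastforce
  qed
  have "\<exists>y\<in>{a<..<b}. y < G y"
  proof (rule ccontr)
    assume n: "\<not> ?thesis"
    define q where "q = (a + b) / 2"
    have q: "a < q" "q < b" using T(1) by (auto simp: q_def)
    have "G ` {a..q} \<subseteq> {a..q}"
    proof (rule image_subsetI)
      fix t assume t: "t \<in> {a..q}"
      have "G t \<le> t"
      proof (cases "t = a")
        case False
        then have "t \<in> {a<..<b}" using t q by simp
        then show ?thesis using n by (meson not_le)
      qed (simp add: fa)
      then show "G t \<in> {a..q}" using t T(8)[of t] q by auto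
    qed
    then show False using itrans_invariant(2)[OF G, of a q] q by simp
  qed
  then obtain y where y: "a < y" "y < b" "y < G y" by auto
  have yb: "{y..b} \<subseteq> {a..b}" "{y..b} \<noteq> {}" using y by auto
  obtain t0 where t0: "t0 \<in> {y..b}" "\<And>t. t \<in> {y..b} \<Longrightarrow> G t0 \<le> G t"
    using continuous_attains_inf[OF compact_Icc yb(2) continuous_on_subset[OF T(2) yb(1)]] by blast
  define m where "m = min (G t0) y"
  have "G t0 > a" using acc[of t0] T(8)[of t0] t0(1) y by fastforce
  then have m: "a < m" "m \<le> y" "m < b" using y by (auto simp: m_def)
  have "G ` {m..b} \<subseteq> {m..b}"
  proof (rule image_subsetI)
    fix t assume t: "t \<in> {m..b}"
    have "m \<le> G t"
    proof (cases "t < y")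
      case True
      then show ?thesis using mono[of y t] y t m by auto
    next
      case False
      then show ?thesis using t0(2)[of t] t by (auto simp: m_def)
    qed
    then show "G t \<in> {m..b}" using t T(8)[of t] m by auto
  qed
  then show False using itrans_invariant(1)[OF G, of m b] m by simp
qed

lemma horseshoe_of_fixed_end:
  assumes G: "itrans a b G" and "G a = a \<or> G b = b"
  shows "has_horseshoe a b G"
  using assms(2)
proof
  assume "G a = a"
  then show ?thesis using horseshoe_of_fixed_left_end[OF G] by blast
next
  assume "G b = b"
  then have "reflect G (- b) = - b" by (simp add: reflect_def)
  then show ?thesis using horseshoe_of_fixed_left_end[OF itrans_reflect[OF G]] has_horseshoe_reflect by blast
qed

text \<open>A preimage \<open>r\<close> of \<open>a\<close> moves down and a preimage
  \<open>r'\<close> of \<open>b\<close> moves up; without a horseshoe \<open>r' < r\<close>, and a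
  fixed point \<open>z\<close> lies between them. Pulling \<open>r\<close> back into
  \<open>{r'..z}\<close> and \<open>r'\<close> back into \<open>{z..r}\<close> reverses the order:
  under the square the left point \<open>x\<close> goes to \<open>a\<close> and the right point
  \<open>x2\<close> to \<open>b\<close>, so \<open>horseshoe_of_down_up\<close> applies to
  \<open>G ^^ 2\<close>.\<close>

lemma horseshoe_of_square:
  assumes G: "itrans a b G" and F: "itrans a b (G ^^ 2)"
  shows "has_horseshoe a b (G ^^ 2)"
proof (rule ccontr)
  assume no: "\<not> ?thesis"
  note T = itransD[OF G]
  have noG: "\<not> has_horseshoe a b G" using has_horseshoe_square[OF T(2)] no by blast
  have ends: "G a \<noteq> a" "G b \<noteq> b" "(G ^^ 2) a \<noteq> a" "(G ^^ 2) b \<noteq> b"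
    using horseshoe_of_fixed_end[OF G] horseshoe_of_fixed_end[OF F] no noG by auto
  have G2: "(G ^^ 2) t = G (G t)" for t by (simp add: numeral_2_eq_2)
  obtain r where r: "r \<in> {a..b}" "G r = a" using T(1,3) by (metis atLeastAtMost_iff imageE order.refl less_imp_le)
  obtain r' where r': "r' \<in> {a..b}" "G r' = b" using T(1,3) by (metis atLeastAtMost_iff imageE order.refl less_imp_le)
  have rr: "G r < r" "r' < G r'" using r r' ends by (auto simp: less_le)
  have lt: "r' < r"
  proof (rule ccontr)
    assume "\<not> r' < r"
    moreover have "r \<noteq> r'" using r r' T(1) by auto
    ultimately have "r < r'" by auto
    then show False using horseshoe_of_down_up[OF G r(1) r'(1) _ rr] noG by blast
  qed
  have sub: "{r'..r} \<subseteq> {a..b}" using r r' by auto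
  have "\<exists>z\<in>{r'..r}. G z - z = 0"
    using continuous_on_subset[OF T(2) sub] rr lt by (intro ivt_Icc continuous_intros) auto
  then obtain z where z: "z \<in> {r'..r}" "G z = z" by auto
  have "\<exists>x\<in>{r'..z}. G x = r"
    using continuous_on_subset[OF T(2), of "{r'..z}"] sub z r r' by (intro ivt_Icc) auto
  then obtain x where x: "x \<in> {r'..z}" "G x = r" by blast
  have "\<exists>x\<in>{z..r}. G x = r'"
    using continuous_on_subset[OF T(2), of "{z..r}"] sub z r r' by (intro ivt_Icc) auto
  then obtain x2 where x2: "x2 \<in> {z..r}" "G x2 = r'" by blast
  have F2: "(G ^^ 2) x = a" "(G ^^ 2) x2 = b" using x x2 r r' G2 by auto
  have "x \<noteq> a" "x2 \<noteq> b" using F2 ends by auto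
  moreover have xin: "x \<in> {a..b}" "x2 \<in> {a..b}" using x x2 z sub by auto
  moreover have "x < x2" using x x2 F2 T(1) by (cases "x = x2") auto
  ultimately show False using horseshoe_of_down_up[OF F xin, of ] F2 no by auto
qed

section \<open>Mixing or splitting\<close>

definition splits_at :: "real \<Rightarrow> real \<Rightarrow> (real \<Rightarrow> real) \<Rightarrow> real \<Rightarrow> bool" where
  "splits_at a b G c \<longleftrightarrow> a < c \<and> c < b \<and> G c = c \<and> G ` {a..c} = {c..b} \<and> G ` {c..b} = {a..c}"

lemma Icc_subset_closed_if_dense:
  fixes S :: "real set"
  assumes "closed S" "a < b"
    and dense: "\<And>u v. a \<le> u \<Longrightarrow> u < v \<Longrightarrow> v \<le> b \<Longrightarrow> \<exists>z\<in>{u<..<v}. z \<in> S"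
  shows "{a..b} \<subseteq> S"
proof (rule ccontr)
  assume "\<not> {a..b} \<subseteq> S"
  then obtain z where z: "z \<in> {a..b}" "z \<in> - S" by blast
  have "open (- S)" using assms(1) by auto
  then obtain e where e: "e > 0" "ball z e \<subseteq> - S" using z open_contains_ball by metis
  have "\<exists>t\<in>{max a (z - e)<..<min b (z + e)}. t \<in> S"
    by (rule dense) (use z e assms(2) in auto)
  then obtain t where "t \<in> S" "\<bar>t - z\<bar> < e" by auto
  then show False using e by (auto simp: ball_def dist_real_def abs_minus_commute)
qed

text \<open>With indices read modulo \<open>Q\<close>, going around the cycle from one index with
  the property reaches every residue.\<close>

lemma periodic_index_all:
  assumes "\<And>r. P r \<Longrightarrow> P (Suc r)" "\<And>r. P (r mod Q) = P r" "Q \<ge> (1::nat)" "P r0"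
  shows "P r"
proof -
  have "P (r0 + i)" for i using assms(1,4) by (induction i) auto
  moreover have "r + Q * r0 = r0 + (r + Q * r0 - r0)" using assms(3) by (cases Q) auto
  ultimately have "P (r + Q * r0)" by metis
  then have "P ((r + Q * r0) mod Q)" using assms(2) by blast
  then show ?thesis using assms(2)[of r] by simp
qed

text \<open>All \<open>E r\<close> contain a fixed point \<open>c\<close>. If what they have in common on one side of \<open>c\<close> were mapped
  to the same side again, it would lie in all of them, and their intersection would be a proper
  invariant interval. So \<open>G\<close> exchanges the two sides.\<close>

lemma splits_at_of_equal_parts:
  assumes G: "itrans a b G" and Q: "Q \<ge> 1"
    and E: "\<And>r. E (r mod Q) = E r" "\<And>r. G ` E r \<subseteq> E (Suc r)" "{a..b} \<subseteq> (\<Union>r. E r)"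
      "\<And>r. E r \<subset> {a..b}" "\<And>r. compact (E r)" "\<And>r. is_interval (E r)" "\<And>r w. \<not> E r \<subseteq> {w}"
  shows "\<exists>c. splits_at a b G c"
proof -
  note T = itransD[OF G]
  have "\<exists>c\<in>{a..b}. G c - c = 0"
    using T(2) T(8)[of a] T(8)[of b] T(1) by (intro ivt_Icc continuous_intros) auto
  then obtain c where c: "c \<in> {a..b}" "G c = c" by auto
  obtain r0 where "c \<in> E r0" using E(3) c by blast
  then have cE: "c \<in> E r" for r
    using periodic_index_all[of "\<lambda>r. c \<in> E r" Q r0 r] E(1,2) Q c(2) by (metis image_subset_iff)
  have between: "t \<in> E r" if "z \<in> E r" "t \<in> closed_segment c z" for t z r
    using E(6)[of r] cE that by (metis closed_segment_subset is_interval_convex subsetD)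
  \<comment> \<open>The sign \<open>s\<close> selects the side of \<open>c\<close>, 1 for the right
    and -1 for the left, so that each argument is made once for both sides.\<close>
  define R where "R s r = (\<exists>z\<in>E r. s * c < s * z)" for s :: real and r
  have R_mod: "R s (r mod Q) = R s r" for s r by (simp add: R_def E(1))
  \<comment> \<open>Choose a point beyond \<open>c\<close> in each part that extends to this side.
    The chosen point nearest to \<open>c\<close> lies in all of these parts, since each is an
    interval containing \<open>c\<close>.\<close>
  have common: "\<exists>z. s * c < s * z \<and> (\<forall>r. R s r \<longrightarrow> z \<in> E r)" if "R s r1" "s = 1 \<or> s = - 1" for s r1
  proof -
    have "\<forall>r\<in>{r. r < Q \<and> R s r}. \<exists>z. z \<in> E r \<and> s * c < s * z" by (auto simp: R_def)
    then obtain f where f: "\<And>r. r < Q \<Longrightarrow> R s r \<Longrightarrow> f r \<in> E r \<and> s * c < s * f r"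
      using bchoice[of "{r. r < Q \<and> R s r}" "\<lambda>r z. z \<in> E r \<and> s * c < s * z"] by blast
    let ?K = "{r. r < Q \<and> R s r}"
    have "r1 mod Q \<in> ?K" using Q that R_mod by auto
    then have ne: "(\<lambda>r. s * f r) ` ?K \<noteq> {}" by blast
    have fin: "finite ((\<lambda>r. s * f r) ` ?K)" by simp
    obtain k where k0: "k \<in> ?K" "s * f k = Min ((\<lambda>r. s * f r) ` ?K)"
      using Min_in[OF fin ne] by (metis (no_types, lifting) imageE)
    have k: "k \<in> ?K" "\<And>r. r \<in> ?K \<Longrightarrow> s * f k \<le> s * f r"
      using k0 Min_le[OF fin imageI] by (auto simp only:)
    have "f k \<in> E r" if "R s r" for r
    proof -
      have rK: "r mod Q \<in> ?K" using Q that R_mod by auto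
      then have "f (r mod Q) \<in> E (r mod Q)" "s * f k \<le> s * f (r mod Q)" "s * c < s * f k"
        using f k by auto
      then show ?thesis using between[of "f (r mod Q)" r "f k"] E(1) \<open>s = 1 \<or> s = - 1\<close>
        by (auto simp: closed_segment_eq_real_ivl)
    qed
    then show ?thesis using k f by blast
  qed
  have not_all: "\<not> (\<forall>r. R s r)" if s: "s = 1 \<or> s = - 1" for s
  proof
    assume all: "\<forall>r. R s r"
    then obtain z where z: "s * c < s * z" "\<And>r. z \<in> E r" using common[of s 0] s by blast
    define N where "N = (\<Inter>r. E r)"
    have "compact N" unfolding N_def using E(5) by (intro compact_Inter) auto
    moreover have "connected N" unfolding N_def
      by (intro convex_connected convex_INT is_interval_convex E(6))
    ultimately obtain p q where pq: "N = {p..q}" using connected_compact_interval_1 by blast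
    have "c \<in> N" "z \<in> N" "c \<noteq> z" using cE z by (auto simp: N_def)
    then have "p < q" using pq by auto
    moreover have "N \<subseteq> {a..b}" using E(4) unfolding N_def by blast
    moreover have "G ` N \<subseteq> N"
    proof (rule image_subsetI)
      fix t assume "t \<in> N"
      then have "G t \<in> E (Suc r)" for r using E(2)[of r] unfolding N_def by blast
      then have "G t \<in> E (r + Q)" for r using Q by (metis Suc_diff_1 add_Suc_right le_zero_eq not_gr_zero zero_neq_one)
      then show "G t \<in> N" unfolding N_def using E(1) by (metis INT_I mod_add_self2)
    qed
    ultimately have "p = a" "q = b" using itrans_invariant[OF G, of p q] pq by auto
    then show False using E(4)[of 0] pq unfolding N_def by blast
  qed
  have not_closed: "\<exists>r. R s r \<and> \<not> R s (Suc r)" if "R s r1" "s = 1 \<or> s = - 1" for s r1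
    using periodic_index_all[of "R s" Q r1] R_mod Q that not_all[of s] by blast
  have swap: "R (- s) (Suc r)" if r: "R s r" and s: "s = 1 \<or> s = - 1" for s r
  proof -
    obtain z where z: "s * c < s * z" "\<And>r. R s r \<Longrightarrow> z \<in> E r" using common r s by blast
    define x y where "x = min c z" "y = max c z"
    have xy: "a \<le> x" "x < y" "y \<le> b" using z(1) c E(4)[of r] z(2)[OF r] s by (auto simp: x_y_def)
    obtain t where t: "t \<in> {x<..<y}" "G t \<noteq> c"
      using itrans_no_collapse[OF G xy, of 1, simplified] by (metis image_subsetI singletonI)
    have "t \<in> closed_segment c z" using t s by (auto simp: x_y_def closed_segment_eq_real_ivl)
    then have tE: "G t \<in> E (Suc r)" if "R s r" for r
      using between z(2)[OF that] E(2)[of r] by blast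
    show ?thesis
    proof (cases "s * c < s * G t")
      case True
      then have "\<forall>r. R s r \<longrightarrow> R s (Suc r)" using tE unfolding R_def by blast
      then show ?thesis using not_closed r s by blast
    next
      case False
      then have "(- s) * c < (- s) * G t" using t(2) s by auto
      then show ?thesis using tE[OF r] unfolding R_def by blast
    qed
  qed
  have swap1: "R 1 r \<Longrightarrow> R (- 1) (Suc r)" "R (- 1) r \<Longrightarrow> R 1 (Suc r)" for r
    using swap[of 1 r] swap[of "- 1" r] by auto
  \<comment> \<open>By \<open>swap1\<close>, extending to both sides would pass from each part to
    the next, so all parts would extend to the right.\<close>
  have excl: "\<not> (R 1 r \<and> R (- 1) r)" for r
  proof
    assume "R 1 r \<and> R (- 1) r"
    then have "R 1 r' \<and> R (- 1) r'" for r'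
      using periodic_index_all[of "\<lambda>r. R 1 r \<and> R (- 1) r" Q r r'] swap1 R_mod Q by blast
    then show False using not_all[of 1] by blast
  qed
  have some: "R 1 r \<or> R (- 1) r" for r
    using E(7)[of r c] unfolding R_def by force
  have both: "\<exists>r. R 1 r" "\<exists>r. R (- 1) r" using not_all[of 1] not_all[of "- 1"] some by blast+
  have right: "G t \<le> c" if "t \<in> {a..b}" "c \<le> t" for t
  proof (cases "t = c")
    case False
    obtain r where r: "t \<in> E r" using E(3) \<open>t \<in> {a..b}\<close> by blast
    then have "R 1 r" using that False unfolding R_def by force
    then have "\<not> R 1 (Suc r)" using swap1 excl by blast
    then show ?thesis using E(2)[of r] r unfolding R_def by force
  qed (simp add: c)
  have left: "c \<le> G t" if "t \<in> {a..b}" "t \<le> c" for t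
  proof (cases "t = c")
    case False
    obtain r where r: "t \<in> E r" using E(3) \<open>t \<in> {a..b}\<close> by blast
    then have "R (- 1) r" using that False unfolding R_def by force
    then have "\<not> R (- 1) (Suc r)" using swap1 excl by blast
    then show ?thesis using E(2)[of r] r unfolding R_def by force
  qed (simp add: c)
  have "a < c" "c < b" using both E(4) unfolding R_def by fastforce+
  moreover have "G ` {a..c} = {c..b}"
  proof
    show "G ` {a..c} \<subseteq> {c..b}" using left T(8) c by fastforce
    show "{c..b} \<subseteq> G ` {a..c}"
    proof
      fix w assume w: "w \<in> {c..b}"
      then have "w \<in> G ` {a..b}" using T(3) c by auto
      then obtain t where t: "t \<in> {a..b}" "w = G t" by blast
      show "w \<in> G ` {a..c}"
      proof (cases "t \<le> c")
        case False
        then have "w = c" using right[of t] t w by auto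
        then show ?thesis using c by force
      qed (use t in auto)
    qed
  qed
  moreover have "G ` {c..b} = {a..c}"
  proof
    show "G ` {c..b} \<subseteq> {a..c}" using right T(8) c by fastforce
    show "{a..c} \<subseteq> G ` {c..b}"
    proof
      fix w assume w: "w \<in> {a..c}"
      then have "w \<in> G ` {a..b}" using T(3) c by auto
      then obtain t where t: "t \<in> {a..b}" "w = G t" by blast
      show "w \<in> G ` {c..b}"
      proof (cases "c \<le> t")
        case False
        then have "w = c" using left[of t] t w by auto
        then show ?thesis using c by force
      qed (use t in auto)
    qed
  qed
  ultimately show ?thesis using c unfolding splits_at_def by blast
qed

lemma funpow_div_mod: "(G ^^ i) s = (G ^^ (i mod Q)) ((G ^^ (Q * (i div Q))) s)"
proof -
  have "(G ^^ (i mod Q + Q * (i div Q))) s = (G ^^ (i mod Q)) ((G ^^ (Q * (i div Q))) s)"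
    by (simp only: funpow_add o_apply)
  then show ?thesis by (simp only: mod_mult_div_eq)
qed

text \<open>If some interval never reaches another one under \<open>G ^^ q\<close>, let
  \<open>Q\<close> be \<open>q\<close> times the period of a periodic point \<open>t\<close> in it.
  Its images at multiples of \<open>Q\<close> share \<open>t\<close>, so their union is connected.
  The closure \<open>D\<close> of this union and its images under fewer than \<open>Q\<close>
  iterations are proper subintervals, mapped cyclically into each other and covering everything by
  transitivity: the situation of \<open>splits_at_of_equal_parts\<close>.\<close>

lemma itrans_powers_or_splits:
  assumes G: "itrans a b G" and nosplit: "\<not> (\<exists>c. splits_at a b G c)" and q: "q \<ge> 1"
  shows "itrans a b (G ^^ q)"
proof (rule ccontr)
  assume no: "\<not> ?thesis"
  note T = itransD[OF G]
  obtain x y u v where xy: "a \<le> x" "x < y" "y \<le> b" "a \<le> u" "u < v" "v \<le> b"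
    and miss: "\<And>j s. s \<in> {x<..<y} \<Longrightarrow> ((G ^^ q) ^^ j) s \<notin> {u<..<v}"
    using no T(1,5,6) unfolding itrans_def by blast
  obtain t k where t: "t \<in> {x<..<y}" "k \<ge> 1" "(G ^^ k) t = t"
    using itrans_periodic_dense[OF G xy(1-3)] by blast
  define Q where "Q = q * k"
  have Q: "Q \<ge> 1" using q t(2) by (simp add: Q_def)
  define U where "U = (\<Union>j. (G ^^ (Q * j)) ` {x<..<y})"
  define D where "D = closure U"
  have Uab: "U \<subseteq> {a..b}" unfolding U_def using T(7) xy by fastforce
  have Dab: "D \<subseteq> {a..b}" unfolding D_def using Uab by (simp add: closure_minimal)
  have "(G ^^ (Q * j)) s \<notin> {u<..<v}" if "s \<in> {x<..<y}" for j s
    using miss[OF that, of "k * j"] by (simp add: funpow_mult Q_def ac_simps)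
  then have "U \<inter> {u<..<v} = {}" unfolding U_def by blast
  then have Dmiss: "D \<inter> {u<..<v} = {}"
    unfolding D_def by (metis inf_commute open_Int_closure_eq_empty open_greaterThanLessThan)
  have "connected U" unfolding U_def
  proof (rule connected_Union)
    show "connected s" if "s \<in> range (\<lambda>j. (G ^^ (Q * j)) ` {x<..<y})" for s
    proof -
      have "continuous_on {x<..<y} (G ^^ i)" for i
        by (rule continuous_on_subset[OF T(5)]) (use xy in auto)
      then show ?thesis using that by (auto intro!: connected_continuous_image)
    qed
    have "(G ^^ (Q * j)) t = t" for j
      using funpow_mult_fixed[of k G t "q * j"] t by (simp add: Q_def ac_simps)
    then have "t \<in> (G ^^ (Q * j)) ` {x<..<y}" for j using t(1) by (metis imageI)
    then show "\<Inter> (range (\<lambda>j. (G ^^ (Q * j)) ` {x<..<y})) \<noteq> {}" by blast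
  qed
  then have D_conn: "connected D" unfolding D_def by (rule connected_imp_connected_closure)
  have D_comp: "compact D"
    unfolding D_def by (rule compact_closure[THEN iffD2]) (rule bounded_subset[OF bounded_closed_interval Uab])
  have contD: "continuous_on D (G ^^ i)" for i using continuous_on_subset[OF T(5) Dab] .
  have xyU: "{x<..<y} \<subseteq> U"
  proof -
    have "(G ^^ (Q * 0)) ` {x<..<y} \<subseteq> U" unfolding U_def by blast
    then show ?thesis by simp
  qed
  then have xyD: "{x<..<y} \<subseteq> D" using closure_subset unfolding D_def by blast
  have DQ: "(G ^^ Q) ` D \<subseteq> D" unfolding D_def
  proof (rule image_closure_subset)
    show "(G ^^ Q) ` U \<subseteq> closure U"
    proof (rule image_subsetI)
      fix s assume "s \<in> U"
      then obtain j r where "r \<in> {x<..<y}" "s = (G ^^ (Q * j)) r" unfolding U_def by blast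
      then have "(G ^^ Q) s \<in> (G ^^ (Q * Suc j)) ` {x<..<y}" by (simp add: funpow_add)
      then have "(G ^^ Q) s \<in> U" unfolding U_def by blast
      then show "(G ^^ Q) s \<in> closure U" using closure_subset by blast
    qed
  qed (use contD D_def in auto)
  define E where "E r = (G ^^ (r mod Q)) ` D" for r
  have E_step: "G ` E r \<subseteq> E (Suc r)" for r
  proof -
    have "G ` E r = (G ^^ Suc (r mod Q)) ` D" by (simp add: E_def image_comp)
    then show ?thesis using DQ by (cases "Suc (r mod Q) = Q") (simp_all add: E_def mod_Suc)
  qed
  have E_ab: "E r \<subseteq> {a..b}" for r unfolding E_def using T(7) Dab by blast
  have E_closed: "compact (E r)" for r unfolding E_def using contD D_comp compact_continuous_image by blast
  have cover: "{a..b} \<subseteq> (\<Union>r\<in>{..<Q}. E r)"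
  proof (rule Icc_subset_closed_if_dense)
    show "closed (\<Union>r\<in>{..<Q}. E r)" using E_closed compact_imp_closed by (intro closed_UN) auto
    fix u' v' assume "a \<le> u'" "u' < v'" "v' \<le> b"
    then obtain i s where s: "s \<in> {x<..<y}" "(G ^^ i) s \<in> {u'<..<v'}" using T(9)[OF xy(1-3)] by blast
    have "(G ^^ (Q * (i div Q))) s \<in> U"
      unfolding U_def by (rule UN_I[OF UNIV_I]) (rule imageI[OF s(1)])
    then have "(G ^^ (Q * (i div Q))) s \<in> D" unfolding D_def by (rule closure_subset[THEN subsetD])
    then have "(G ^^ i) s \<in> E (i mod Q)" unfolding E_def by (subst funpow_div_mod[of i G s Q]) simp
    moreover have "i mod Q < Q" using Q by auto
    ultimately show "\<exists>z\<in>{u'<..<v'}. z \<in> (\<Union>r\<in>{..<Q}. E r)" using s(2) by blast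
  qed (use T(1) in auto)
  \<comment> \<open>Since \<open>G\<close> is onto, a part equal to the whole interval would be
    followed by parts of the same kind, up to \<open>E 0 = D\<close>; but \<open>D\<close> misses
    \<open>{u<..<v}\<close>.\<close>
  have "\<not> {a..b} \<subseteq> E r" for r
  proof
    assume "{a..b} \<subseteq> E r"
    then have "{a..b} \<subseteq> E 0"
      using periodic_index_all[of "\<lambda>r. {a..b} \<subseteq> E r" Q r 0] E_step T(3) Q
      by (metis (no_types, lifting) E_def image_mono mod_mod_trivial subset_trans)
    then have "{a..b} \<subseteq> D" by (simp add: E_def)
    moreover have "(u + v) / 2 \<in> {u<..<v}" "(u + v) / 2 \<in> {a..b}" using xy by auto
    ultimately show False using Dmiss by blast
  qed
  then have E_proper: "E r \<subset> {a..b}" for r using E_ab by blast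
  have "\<not> E r \<subseteq> {w}" for r w
  proof
    assume "E r \<subseteq> {w}"
    then have "(G ^^ (r mod Q)) ` {x<..<y} \<subseteq> {w}" using xyD unfolding E_def by blast
    then show False using itrans_no_collapse[OF G xy(1-3)] by blast
  qed
  moreover have "is_interval (E r)" for r
    unfolding E_def is_interval_connected_1 using connected_continuous_image[OF contD D_conn] .
  moreover have "{a..b} \<subseteq> (\<Union>r. E r)" using cover by blast
  moreover have "E (r mod Q) = E r" for r by (simp add: E_def)
  ultimately have "\<exists>c. splits_at a b G c"
    using splits_at_of_equal_parts[OF G Q, of E] E_step E_proper E_closed by blast
  then show False using nosplit by blast
qed

lemma openin_Icc_contains_interval:
  fixes a b :: real
  assumes "openin (top_of_set {a..b}) U" "U \<noteq> {}" "a < b"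
  obtains x y where "a \<le> x" "x < y" "y \<le> b" "{x<..<y} \<subseteq> U"
proof -
  obtain W where W: "open W" "U = {a..b} \<inter> W" using assms(1) openin_open by blast
  then obtain z where z: "z \<in> {a..b}" "z \<in> W" using assms(2) by blast
  then obtain e where e: "e > 0" "ball z e \<subseteq> W" using W open_contains_ball by metis
  have "{max a (z - e)<..<min b (z + e)} \<subseteq> ball z e" by (auto simp: ball_def dist_real_def)
  then have "{max a (z - e)<..<min b (z + e)} \<subseteq> U" using e W by auto
  then show ?thesis using that[of "max a (z - e)" "min b (z + e)"] z e assms(3) by auto
qed

lemma itrans_hit_through:
  assumes G: "itrans a b G" and H: "continuous_on {a..b} H" "H ` {a..b} = {a..b}"
    and xy: "a \<le> x" "x < y" "y \<le> b" "a \<le> u" "u < v" "v \<le> b"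
  shows "\<exists>j. \<exists>s\<in>{x<..<y}. H ((G ^^ j) s) \<in> {u<..<v}"
proof -
  note T = itransD[OF G]
  have "(u + v) / 2 \<in> {a..b}" using xy by auto
  then obtain t where t: "t \<in> {a..b}" "H t = (u + v) / 2" using H(2) by (metis imageE)
  then have uv: "u < H t" "H t < v" using xy by auto
  obtain p q where pq: "a \<le> p" "p < q" "q \<le> b" "H ` {p..q} \<subseteq> {u<..<v}"
    using local_interval[OF H(1) T(1) t(1) uv zero_less_one] by metis
  obtain i s where s: "s \<in> {x<..<y}" "(G ^^ i) s \<in> {p<..<q}" using T(9)[OF xy(1-3) pq(1-3)] by blast
  then have "(G ^^ i) s \<in> {p..q}" by simp
  then show ?thesis using pq(4) s(1) by blast
qed

text \<open>Let \<open>Q\<close> be a common period of a periodic point \<open>t\<close> in the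
  source and a periodic point \<open>w\<close> in the target. The images of the source at the times
  of one residue class modulo \<open>Q\<close> form a connected set, as they share an iterate of
  \<open>t\<close>. It is dense because \<open>G ^^ Q\<close> is transitive, so it contains
  \<open>w\<close>. Once reached, \<open>w\<close> is reached again every \<open>Q\<close> steps;
  hence all times beyond some \<open>N\<close> are hits.\<close>

lemma itrans_powers_imp_mixing:
  assumes all: "\<And>q. q \<ge> 1 \<Longrightarrow> itrans a b (G ^^ q)"
  shows "mixing_on {a..b} G"
proof -
  have G: "itrans a b G" using all[of 1] by simp
  note T = itransD[OF G]
  have "\<exists>N. \<forall>m>N. (G ^^ m) ` U \<inter> V \<noteq> {}"
    if UV: "openin (top_of_set {a..b}) U" "openin (top_of_set {a..b}) V" "U \<noteq> {}" "V \<noteq> {}" for U V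
  proof -
    obtain x y where xy: "a \<le> x" "x < y" "y \<le> b" "{x<..<y} \<subseteq> U"
      using openin_Icc_contains_interval[OF UV(1,3) T(1)] .
    obtain u v where uv: "a \<le> u" "u < v" "v \<le> b" "{u<..<v} \<subseteq> V"
      using openin_Icc_contains_interval[OF UV(2,4) T(1)] .
    obtain t k where t: "t \<in> {x<..<y}" "k \<ge> 1" "(G ^^ k) t = t"
      using itrans_periodic_dense[OF G xy(1-3)] by blast
    obtain w l where w: "w \<in> {u<..<v}" "l \<ge> 1" "(G ^^ l) w = w"
      using itrans_periodic_dense[OF G uv(1-3)] by blast
    define Q where "Q = k * l"
    have Q: "Q \<ge> 1" using t w by (simp add: Q_def)
    have fixt: "(G ^^ (Q * j)) t = t" for j
      using funpow_mult_fixed[of k G t "l * j"] t by (simp add: Q_def ac_simps)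
    have fixw: "(G ^^ (Q * j)) w = w" for j
      using funpow_mult_fixed[of l G w "k * j"] w by (simp add: Q_def ac_simps)
    have "\<exists>j. w \<in> (G ^^ (r + Q * j)) ` {x<..<y}" for r
    proof -
      define W where "W = (\<Union>j. (G ^^ (r + Q * j)) ` {x<..<y})"
      have "connected W" unfolding W_def
      proof (rule connected_Union)
        show "connected s" if "s \<in> range (\<lambda>j. (G ^^ (r + Q * j)) ` {x<..<y})" for s
        proof -
          have "continuous_on {x<..<y} (G ^^ i)" for i
            by (rule continuous_on_subset[OF T(5)]) (use xy in auto)
          then show ?thesis using that by (auto intro!: connected_continuous_image)
        qed
        have "(G ^^ r) t = (G ^^ (r + Q * j)) t" for j by (simp add: funpow_add fixt)
        then have "(G ^^ r) t \<in> (G ^^ (r + Q * j)) ` {x<..<y}" for j using t(1) by (metis imageI)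
        then show "\<Inter> (range (\<lambda>j. (G ^^ (r + Q * j)) ` {x<..<y})) \<noteq> {}" by blast
      qed
      moreover have hit: "\<exists>z\<in>W. z \<in> {u'<..<v'}" if h: "a \<le> u'" "u' < v'" "v' \<le> b" for u' v'
      proof -
        obtain j s where "s \<in> {x<..<y}" "(G ^^ r) (((G ^^ Q) ^^ j) s) \<in> {u'<..<v'}"
          using itrans_hit_through[OF all[OF Q] T(5) T(6) xy(1-3) h] by blast
        moreover have "(G ^^ r) (((G ^^ Q) ^^ j) s) = (G ^^ (r + Q * j)) s"
          by (simp add: funpow_add funpow_mult mult.commute)
        ultimately show ?thesis unfolding W_def by force
      qed
      obtain z1 z2 where "z1 \<in> W" "z1 < w" "z2 \<in> W" "w < z2"
        using hit[of a w] hit[of w b] w uv by auto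
      ultimately have "w \<in> W"
        unfolding is_interval_connected_1[symmetric] is_interval_1 by (meson less_imp_le)
      then show ?thesis unfolding W_def by blast
    qed
    then obtain J where J: "\<And>r. w \<in> (G ^^ (r + Q * J r)) ` {x<..<y}" by metis
    define N where "N = Max ((\<lambda>r. r + Q * J r) ` {..<Q})"
    have "(G ^^ m) ` U \<inter> V \<noteq> {}" if "m > N" for m
    proof -
      define r where "r = m mod Q"
      have "r < Q" using Q by (simp add: r_def)
      then have "r + Q * J r \<le> N" unfolding N_def by (intro Max_ge) auto
      then have "r + Q * J r < r + Q * (m div Q)" using that by (simp add: r_def)
      then have "J r \<le> m div Q" by simp
      then have m: "m = Q * (m div Q - J r) + (r + Q * J r)"
        by (simp add: r_def algebra_simps diff_mult_distrib2)
      obtain s where s: "s \<in> {x<..<y}" "w = (G ^^ (r + Q * J r)) s" using J by blast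
      have "(G ^^ m) s = (G ^^ (Q * (m div Q - J r))) w"
        by (subst m) (simp add: funpow_add s(2))
      then have "(G ^^ m) s = w" by (simp add: fixw)
      then show ?thesis using s(1) xy(4) uv(4) w(1) by blast
    qed
    then show ?thesis by blast
  qed
  then show ?thesis using T(2,4) unfolding mixing_on_def compact_system_def by auto
qed

lemma splits_at_iterates:
  assumes "splits_at a b G c" "s \<in> {a..c}"
  shows "(G ^^ (2 * j)) s \<in> {a..c}" "(G ^^ Suc (2 * j)) s \<in> {c..b}"
proof -
  have *: "\<And>t. t \<in> {a..c} \<Longrightarrow> G t \<in> {c..b}" "\<And>t. t \<in> {c..b} \<Longrightarrow> G t \<in> {a..c}"
    using assms(1) unfolding splits_at_def by blast+
  show "(G ^^ (2 * j)) s \<in> {a..c}"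
  proof (induction j)
    case (Suc j)
    have "(G ^^ (2 * Suc j)) s = G (G ((G ^^ (2 * j)) s))" by simp
    then show ?case using Suc * by metis
  qed (use assms in simp)
  then show "(G ^^ Suc (2 * j)) s \<in> {c..b}" using *(1) by (metis comp_apply funpow.simps(2))
qed

text \<open>Odd iterates send \<open>{a..c}\<close> into \<open>{c..b}\<close>, so a hit of an open
  interval inside \<open>{a..c}\<close> can only occur at an even time.\<close>

lemma splits_at_itrans_square:
  assumes G: "itrans a b G" and c: "splits_at a b G c"
  shows "itrans a c (G ^^ 2)"
proof -
  note T = itransD[OF G]
  have ac: "a < c" "c < b" and im: "G ` {a..c} = {c..b}" "G ` {c..b} = {a..c}"
    using c unfolding splits_at_def by auto
  have sub: "{a..c} \<subseteq> {a..b}" using ac by auto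
  have "(G ^^ 2) ` {a..c} = G ` (G ` {a..c})" by (auto simp: numeral_2_eq_2)
  then have "(G ^^ 2) ` {a..c} = {a..c}" by (simp add: im)
  moreover have "\<exists>i. \<exists>s\<in>{x<..<y}. ((G ^^ 2) ^^ i) s \<in> {u<..<v}"
    if h: "a \<le> x" "x < y" "y \<le> c" "a \<le> u" "u < v" "v \<le> c" for x y u v
  proof -
    obtain i s where s: "s \<in> {x<..<y}" "(G ^^ i) s \<in> {u<..<v}" using T(9)[of x y u v] h ac by auto
    have "s \<in> {a..c}" using s h by auto
    have "even i"
    proof (rule ccontr)
      assume "odd i"
      then have "i = Suc (2 * (i div 2))" by simp
      then have "(G ^^ i) s \<in> {c..b}" using splits_at_iterates(2)[OF c \<open>s \<in> {a..c}\<close>] by metis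
      then show False using s(2) h by auto
    qed
    then obtain j where "i = 2 * j" by auto
    then have "((G ^^ 2) ^^ j) s \<in> {u<..<v}" using s(2) by (simp add: funpow_mult mult.commute)
    then show ?thesis using s(1) by blast
  qed
  ultimately show ?thesis using ac(1) continuous_on_subset[OF T(5)[of 2] sub] unfolding itrans_def by blast
qed

lemma has_horseshoe_mono:
  assumes "has_horseshoe a b F" "{a..b} \<subseteq> {a'..b'}"
  shows "has_horseshoe a' b' F"
  using assms unfolding has_horseshoe_def by (meson subsetD)

lemma itrans_mixing_or_splits:
  assumes G: "itrans a b G"
  shows "has_horseshoe a b (G ^^ 2)"
    and "mixing_on {a..b} G \<or> (\<exists>c. splits_at a b G c \<and> mixing_on {a..c} (G ^^ 2))"
proof -
  \<comment> \<open>The splitting point is an end of \<open>{a..c}\<close> fixed by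
    \<open>G ^^ 2\<close>. This rules out a second splitting and, by
    \<open>horseshoe_of_fixed_end\<close>, gives the horseshoe at once.\<close>
  have split: "mixing_on {a..c} (G ^^ 2) \<and> has_horseshoe a b (G ^^ 2)" if c: "splits_at a b G c" for c
  proof -
    have F: "itrans a c (G ^^ 2)" using splits_at_itrans_square[OF G c] .
    have "(G ^^ 2) c = c" "c \<le> b" using c by (simp_all add: splits_at_def numeral_2_eq_2)
    then have "\<not> (\<exists>c'. splits_at a c (G ^^ 2) c')"
      unfolding splits_at_def by (metis atLeastAtMost_iff imageI less_imp_le not_le order_refl)
    then have "mixing_on {a..c} (G ^^ 2)"
      using itrans_powers_imp_mixing itrans_powers_or_splits[OF F] by blast
    moreover have "has_horseshoe a c (G ^^ 2)"
      using horseshoe_of_fixed_end[OF F] \<open>(G ^^ 2) c = c\<close> by blast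
    ultimately show ?thesis using has_horseshoe_mono \<open>c \<le> b\<close> by (metis atLeastatMost_subset_iff order_refl)
  qed
  have nosplit: "mixing_on {a..b} G \<and> has_horseshoe a b (G ^^ 2)" if "\<not> (\<exists>c. splits_at a b G c)"
    using that itrans_powers_imp_mixing itrans_powers_or_splits[OF G] horseshoe_of_square[OF G]
    by (meson one_le_numeral)
  show "has_horseshoe a b (G ^^ 2)"
    and "mixing_on {a..b} G \<or> (\<exists>c. splits_at a b G c \<and> mixing_on {a..c} (G ^^ 2))"
    using split nosplit by blast+
qed

section \<open>Cantor functions\<close>

lemma dyadic_between:
  fixes p r :: real
  assumes "0 \<le> p" "p < r" "r \<le> 1"
  obtains n k where "k \<le> 2 ^ n" "p < real k / 2 ^ n" "real k / 2 ^ n < r"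
proof -
  obtain n where n: "(1/2::real) ^ n < r - p" using real_arch_pow_inv[of "r - p" "1/2"] assms by auto
  define k where "k = nat \<lfloor>p * 2 ^ n\<rfloor> + 1"
  have fl: "real (nat \<lfloor>p * 2 ^ n\<rfloor>) = of_int \<lfloor>p * 2 ^ n\<rfloor>" using assms(1) by (simp add: of_nat_nat)
  have lo: "p * 2 ^ n < real k" unfolding k_def using fl by linarith
  have "real k \<le> p * 2 ^ n + 1" unfolding k_def using fl by linarith
  moreover have "1 < (r - p) * 2 ^ n" using n by (simp add: power_divide field_simps)
  ultimately have hi: "real k < r * 2 ^ n" by (simp add: algebra_simps)
  have "r * 2 ^ n \<le> 2 ^ n" using assms by (simp add: mult_left_le_one_le)
  then have "real k < 2 ^ n" using hi by linarith
  then have "k \<le> 2 ^ n" by simp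
  then show ?thesis using that lo hi by (simp add: field_simps)
qed

text \<open>The points of level \<open>n + 1\<close> bisect the hull of \<open>B\<close> between consecutive points of level \<open>n\<close>;
  the Cantor function will send \<open>bisect B x y n k\<close> to \<open>k / 2 ^ n\<close>.\<close>

fun bisect :: "real set \<Rightarrow> real \<Rightarrow> real \<Rightarrow> nat \<Rightarrow> nat \<Rightarrow> real" where
  "bisect B x y 0 k = (if k = 0 then x else y)"
| "bisect B x y (Suc n) k =
    (let l = bisect B x y n (k div 2); r = bisect B x y n (Suc (k div 2)) in
     if even k then l else (Inf (B \<inter> {l<..<r}) + Sup (B \<inter> {l<..<r})) / 2)"

text \<open>Cutting at the midpoint of the hull of the points of \<open>B\<close>, and not of the
  interval, leaves points of \<open>B\<close> on both sides; perfectness makes the hull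
  nondegenerate. It is the spread of these points that is halved, and not the length of the
  interval.\<close>

lemma hull_midpoint:
  fixes B :: "real set"
  assumes perf: "\<And>b. b \<in> B \<Longrightarrow> b islimpt B" and ne: "B \<inter> {x<..<y} \<noteq> {}"
    and wid: "\<And>b b'. b \<in> B \<inter> {x<..<y} \<Longrightarrow> b' \<in> B \<inter> {x<..<y} \<Longrightarrow> b' - b \<le> \<delta>"
  defines "m \<equiv> (Inf (B \<inter> {x<..<y}) + Sup (B \<inter> {x<..<y})) / 2"
  shows "B \<inter> {x<..<m} \<noteq> {}" "B \<inter> {m<..<y} \<noteq> {}"
    "\<And>b b'. b \<in> B \<inter> {x<..<m} \<Longrightarrow> b' \<in> B \<inter> {x<..<m} \<Longrightarrow> b' - b \<le> \<delta> / 2"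
    "\<And>b b'. b \<in> B \<inter> {m<..<y} \<Longrightarrow> b' \<in> B \<inter> {m<..<y} \<Longrightarrow> b' - b \<le> \<delta> / 2"
    "x < m" "m < y"
proof -
  let ?S = "B \<inter> {x<..<y}"
  have bdd: "bdd_below ?S" "bdd_above ?S" by (auto intro!: bdd_belowI[of _ x] bdd_aboveI[of _ y])
  obtain b where b: "b \<in> ?S" using ne by blast
  have "\<exists>b'\<in>B. b' \<in> {x<..<y} \<and> b' \<noteq> b"
    using perf[of b] b unfolding islimpt_def by (metis IntE open_greaterThanLessThan)
  then obtain b' where b': "b' \<in> ?S" "b' \<noteq> b" by blast
  have "Inf ?S \<le> min b b'" "max b b' \<le> Sup ?S"
    using cInf_lower[OF b bdd(1)] cInf_lower[OF b'(1) bdd(1)] cSup_upper[OF b bdd(2)]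
      cSup_upper[OF b'(1) bdd(2)] by auto
  then have lt: "Inf ?S < Sup ?S" using b'(2) by linarith
  then have "Inf ?S < m" "m < Sup ?S" by (auto simp: m_def)
  then obtain c1 c2 where c: "c1 \<in> ?S" "c1 < m" "c2 \<in> ?S" "m < c2"
    using cInf_lessD[OF ne] less_cSupD[OF ne] by blast
  then show 1: "B \<inter> {x<..<m} \<noteq> {}" "B \<inter> {m<..<y} \<noteq> {}" by auto
  show xm: "x < m" "m < y" using c by auto
  have "Sup ?S \<le> Inf ?S + \<delta>"
  proof (rule cSup_least[OF ne])
    fix t assume t: "t \<in> ?S"
    have "t - \<delta> \<le> Inf ?S" by (rule cInf_greatest[OF ne]) (use wid[OF _ t] in force)
    then show "t \<le> Inf ?S + \<delta>" by simp
  qed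
  then have half: "m - Inf ?S \<le> \<delta> / 2" "Sup ?S - m \<le> \<delta> / 2"
    by (auto simp: m_def field_simps)
  show "b' - b \<le> \<delta> / 2" if "b \<in> B \<inter> {x<..<m}" "b' \<in> B \<inter> {x<..<m}" for b b'
    using cInf_lower[of b ?S] bdd that xm half by auto
  show "b' - b \<le> \<delta> / 2" if "b \<in> B \<inter> {m<..<y}" "b' \<in> B \<inter> {m<..<y}" for b b'
    using cSup_upper[of b' ?S] bdd that xm half by auto
qed

text \<open>\<open>\<phi> t\<close> is the supremum of the dyadic numbers whose grid point is at
  most \<open>t\<close>. A monotone function with all dyadic values in the unit interval has no
  jumps there. It increases only across \<open>B\<close> because any two grid points have
  \<open>B\<close> between them, and it increases across all of \<open>B\<close> because the spread
  of \<open>B\<close> inside a grid cell tends to 0.\<close>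

lemma cantor_function:
  fixes B :: "real set"
  assumes perf: "\<And>b. b \<in> B \<Longrightarrow> b islimpt B" and ne: "B \<inter> {x0<..<y0} \<noteq> {}"
  obtains \<phi> :: "real \<Rightarrow> real" where "mono \<phi>" "continuous_on UNIV \<phi>"
    "\<And>x y. x0 \<le> x \<Longrightarrow> x < y \<Longrightarrow> y \<le> y0 \<Longrightarrow> \<phi> x < \<phi> y \<longleftrightarrow> B \<inter> {x<..<y} \<noteq> {}"
proof -
  define q where "q = bisect B x0 y0"
  define L where "L = y0 - x0"
  have q_even: "q (Suc n) (2 * k) = q n k" for n k by (simp add: q_def)
  have q_ends: "q n 0 = x0" "q n (2 ^ n) = y0" for n by (induction n) (auto simp: q_def)
  have step: "B \<inter> {q n k<..<q n (Suc k)} \<noteq> {} \<and>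
      (\<forall>b b'. b \<in> B \<inter> {q n k<..<q n (Suc k)} \<longrightarrow> b' \<in> B \<inter> {q n k<..<q n (Suc k)} \<longrightarrow> b' - b \<le> L / 2 ^ n)"
    if "k < 2 ^ n" for n k
    using that
  proof (induction n arbitrary: k)
    case 0
    then show ?case using ne by (auto simp: q_def L_def)
  next
    case (Suc n)
    define j where "j = k div 2"
    have "j < 2 ^ n" using Suc.prems by (simp add: j_def less_mult_imp_div_less)
    note IH = Suc.IH[OF this]
    define m where "m = (Inf (B \<inter> {q n j<..<q n (Suc j)}) + Sup (B \<inter> {q n j<..<q n (Suc j)})) / 2"
    have wid: "\<And>b b'. b \<in> B \<inter> {q n j<..<q n (Suc j)} \<Longrightarrow> b' \<in> B \<inter> {q n j<..<q n (Suc j)} \<Longrightarrow>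
        b' - b \<le> L / 2 ^ n" using conjunct2[OF IH] by blast
    note M = hull_midpoint[OF perf conjunct1[OF IH] wid, folded m_def]
    have half: "L / 2 ^ Suc n = L / 2 ^ n / 2" by simp
    have qm: "q (Suc n) (Suc (2 * j)) = m" by (simp add: q_def m_def Let_def)
    have qs: "q (Suc n) (Suc (Suc (2 * j))) = q n (Suc j)" using q_even[of n "Suc j"] by simp
    have "k = 2 * j \<or> k = Suc (2 * j)" unfolding j_def by presburger
    then show ?case
    proof (elim disjE)
      assume k: "k = 2 * j"
      show ?case unfolding k q_even qm half using M(1,3) by blast
    next
      assume k: "k = Suc (2 * j)"
      show ?case unfolding k qs qm half using M(2,4) by blast
    qed
  qed
  have q_step: "q n k < q n (Suc k)" if "k < 2 ^ n" for n k
    using step[OF that] by auto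
  have q_less: "q n j < q n k" if "j < k" "k \<le> 2 ^ n" for n j k
    using that
  proof (induction k)
    case (Suc k)
    then have "q n k < q n (Suc k)" using q_step by simp
    then show ?case using Suc by (cases "j = k") auto
  qed simp
  have q_sep: "B \<inter> {q n j<..<q n k} \<noteq> {}" if "j < k" "k \<le> 2 ^ n" for n j k
  proof -
    have "q n (Suc j) \<le> q n k" using q_less[of "Suc j" k n] that by (cases "Suc j = k") auto
    then show ?thesis using step[of j n] that by fastforce
  qed
  have refine: "q (n + m) (k * 2 ^ m) = q n k" for n m k
  proof (induction m)
    case (Suc m)
    have "q (n + Suc m) (k * 2 ^ Suc m) = q (Suc (n + m)) (2 * (k * 2 ^ m))" by (simp add: ac_simps)
    then show ?case using Suc q_even by simp
  qed simp
  \<comment> \<open>Grid points of different levels are compared at the common level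
    \<open>n + m\<close>.\<close>
  have cmp: "q n k < q m j \<and> B \<inter> {q n k<..<q m j} \<noteq> {}"
    if "real k / 2 ^ n < real j / 2 ^ m" "j \<le> 2 ^ m" for n k m j
  proof -
    have "real k * 2 ^ m < real j * 2 ^ n" using that(1) by (simp add: field_simps)
    then have "real (k * 2 ^ m) < real (j * 2 ^ n)" by simp
    then have lt: "k * 2 ^ m < j * 2 ^ n" by (simp only: of_nat_less_iff)
    have "j * 2 ^ n \<le> 2 ^ (n + m)" using that(2) by (simp add: power_add)
    then show ?thesis
      using q_less[OF lt, of "n + m"] q_sep[OF lt, of "n + m"] refine[of n m k] refine[of m n j]
      by (simp add: add.commute)
  qed
  define A where "A t = insert 0 {real k / 2 ^ n |n k. k \<le> 2 ^ n \<and> q n k \<le> t}" for t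
  define \<phi> where "\<phi> t = Sup (A t)" for t
  have A01: "A t \<subseteq> {0..1}" for t
  proof
    fix z assume "z \<in> A t"
    then consider "z = 0" | n k where "z = real k / 2 ^ n" "k \<le> 2 ^ n" unfolding A_def by blast
    then show "z \<in> {0..1}"
    proof cases
      case (2 n k)
      then have "real k \<le> real (2 ^ n)" by (simp only: of_nat_le_iff)
      then have "real k \<le> 2 ^ n" by simp
      then show ?thesis unfolding 2(1) by (simp add: divide_le_eq)
    qed simp
  qed
  have A_ne: "A t \<noteq> {}" for t by (simp add: A_def)
  have A_bdd: "bdd_above (A t)" for t using A01[of t] by (meson bdd_above_Icc bdd_above_mono)
  have A_mono: "A s \<subseteq> A t" if "s \<le> t" for s t
    unfolding A_def using that by (intro insert_mono) (blast intro: order_trans)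
  have \<phi>_mono: "\<phi> s \<le> \<phi> t" if "s \<le> t" for s t
    unfolding \<phi>_def by (rule cSup_subset_mono[OF A_ne A_bdd A_mono[OF that]])
  have \<phi>0: "0 \<le> \<phi> t" for t unfolding \<phi>_def by (rule cSup_upper[OF _ A_bdd]) (simp add: A_def)
  have \<phi>1: "\<phi> t \<le> 1" for t unfolding \<phi>_def using A01[of t] by (intro cSup_least[OF A_ne]) auto
  have \<phi>_ge: "real k / 2 ^ n \<le> \<phi> t" if "k \<le> 2 ^ n" "q n k \<le> t" for n k t
    unfolding \<phi>_def by (rule cSup_upper[OF _ A_bdd]) (use that in \<open>auto simp: A_def\<close>)
  have \<phi>_le: "\<phi> t \<le> real k / 2 ^ n" if "k \<le> 2 ^ n" "t \<le> q n k" for n k t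
    unfolding \<phi>_def
  proof (rule cSup_least[OF A_ne])
    fix z assume "z \<in> A t"
    then consider "z = 0" | m j where "z = real j / 2 ^ m" "j \<le> 2 ^ m" "q m j \<le> t" unfolding A_def by blast
    then show "z \<le> real k / 2 ^ n"
    proof cases
      case (2 m j)
      show ?thesis
      proof (rule ccontr)
        assume "\<not> ?thesis"
        then have "q n k < q m j" using cmp[of k n j m] 2 by simp
        then show False using 2 that by simp
      qed
    qed simp
  qed
  have \<phi>_q: "\<phi> (q n k) = real k / 2 ^ n" if "k \<le> 2 ^ n" for n k
    using \<phi>_ge[OF that, of "q n k"] \<phi>_le[OF that, of "q n k"] by simp
  have \<phi>_less: "s < t" if "\<phi> s < \<phi> t" for s t using \<phi>_mono[of t s] that by (meson not_le)
  have below: "\<exists>s<t. \<phi> t - e < \<phi> s" if "e > 0" for t e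
  proof (cases "\<phi> t = 0")
    case True
    then show ?thesis using \<phi>0[of "t - 1"] that by (intro exI[of _ "t - 1"]) auto
  next
    case False
    then have h: "0 \<le> max 0 (\<phi> t - e)" "max 0 (\<phi> t - e) < \<phi> t" using \<phi>0[of t] that by auto
    obtain n k where "k \<le> 2 ^ n" "max 0 (\<phi> t - e) < real k / 2 ^ n" "real k / 2 ^ n < \<phi> t"
      by (rule dyadic_between[OF h \<phi>1])
    then show ?thesis using \<phi>_q[of k n] \<phi>_less[of "q n k" t] by (intro exI[of _ "q n k"]) auto
  qed
  have above: "\<exists>s>t. \<phi> s < \<phi> t + e" if "e > 0" for t e
  proof (cases "\<phi> t = 1")
    case True
    then show ?thesis using \<phi>1[of "t + 1"] that by (intro exI[of _ "t + 1"]) auto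
  next
    case False
    then have h: "\<phi> t < min 1 (\<phi> t + e)" "min 1 (\<phi> t + e) \<le> 1" using \<phi>1[of t] that by auto
    obtain n k where "k \<le> 2 ^ n" "\<phi> t < real k / 2 ^ n" "real k / 2 ^ n < min 1 (\<phi> t + e)"
      by (rule dyadic_between[OF \<phi>0 h])
    then show ?thesis using \<phi>_q[of k n] \<phi>_less[of t "q n k"] by (intro exI[of _ "q n k"]) auto
  qed
  have "isCont \<phi> t" for t
  proof (unfold continuous_at_eps_delta, intro allI impI)
    fix e :: real assume e: "e > 0"
    obtain s1 where s1: "s1 < t" "\<phi> t - e < \<phi> s1" using below[OF e] by blast
    obtain s2 where s2: "s2 > t" "\<phi> s2 < \<phi> t + e" using above[OF e] by blast
    have "\<bar>\<phi> s - \<phi> t\<bar> < e" if "\<bar>s - t\<bar> < min (t - s1) (s2 - t)" for s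
      using \<phi>_mono[of s1 s] \<phi>_mono[of s s2] s1 s2 that by (auto simp: abs_less_iff)
    then show "\<exists>d>0. \<forall>s. dist s t < d \<longrightarrow> dist (\<phi> s) (\<phi> t) < e"
      using s1 s2 by (intro exI[of _ "min (t - s1) (s2 - t)"]) (auto simp: dist_real_def)
  qed
  then have cont: "continuous_on UNIV \<phi>" by (simp add: continuous_on_eq_continuous_at)
  have sep: "\<phi> x < \<phi> y \<longleftrightarrow> B \<inter> {x<..<y} \<noteq> {}" if xy: "x0 \<le> x" "x < y" "y \<le> y0" for x y
  proof
    assume less: "\<phi> x < \<phi> y"
    obtain n k where k: "k \<le> 2 ^ n" "\<phi> x < real k / 2 ^ n" "real k / 2 ^ n < \<phi> y"
      by (rule dyadic_between[OF \<phi>0 less \<phi>1])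
    have pos: "0 \<le> real k / 2 ^ n" by simp
    \<comment> \<open>A second dyadic value is chosen because points of \<open>B\<close> are
      guaranteed only between two grid points.\<close>
    obtain m j where j: "j \<le> 2 ^ m" "real k / 2 ^ n < real j / 2 ^ m" "real j / 2 ^ m < \<phi> y"
      by (rule dyadic_between[OF pos k(3) \<phi>1])
    have "B \<inter> {q n k<..<q m j} \<noteq> {}" using cmp[OF j(2,1)] by blast
    moreover have "x < q n k" "q m j < y" using \<phi>_less k j \<phi>_q by auto
    ultimately show "B \<inter> {x<..<y} \<noteq> {}" by fastforce
  next
    assume sepxy: "B \<inter> {x<..<y} \<noteq> {}"
    \<comment> \<open>Two rounds of cutting produce \<open>b1 < b2 < b3 < b4\<close> in
      \<open>B\<close>. At a level \<open>N\<close> where the spread in each cell is below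
      \<open>\<epsilon>\<close>, one grid point falls between \<open>b1\<close> and
      \<open>b2\<close> and another between \<open>b3\<close> and \<open>b4\<close>, so
      \<open>\<phi>\<close> passes two different dyadic values.\<close>
    have half: "\<exists>m. B \<inter> {u<..<m} \<noteq> {} \<and> B \<inter> {m<..<v} \<noteq> {}" if "B \<inter> {u<..<v} \<noteq> {}" for u v
      using hull_midpoint(1,2)[OF perf that, of "v - u"] by fastforce
    obtain m where m: "B \<inter> {x<..<m} \<noteq> {}" "B \<inter> {m<..<y} \<noteq> {}" using half[OF sepxy] by blast
    obtain m1 where m1: "B \<inter> {x<..<m1} \<noteq> {}" "B \<inter> {m1<..<m} \<noteq> {}" using half[OF m(1)] by blast
    obtain m2 where m2: "B \<inter> {m<..<m2} \<noteq> {}" "B \<inter> {m2<..<y} \<noteq> {}" using half[OF m(2)] by blast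
    obtain b1 b2 b3 b4 where b: "b1 \<in> B" "b2 \<in> B" "b3 \<in> B" "b4 \<in> B" "x < b1" "b1 < m1" "m1 < b2" "b2 < m"
        "m < b3" "b3 < m2" "m2 < b4" "b4 < y"
      using m1 m2 by (auto simp: ex_in_conv[symmetric])
    have "x0 < y0" using xy by simp
    define \<epsilon> where "\<epsilon> = min (b2 - b1) (b4 - b3)"
    have "\<epsilon> > 0" using b by (simp add: \<epsilon>_def)
    then obtain N where "(1/2::real) ^ N < \<epsilon> / L"
      using real_arch_pow_inv[of "\<epsilon> / L" "1/2"] \<open>x0 < y0\<close> by (auto simp: L_def)
    then have N: "L / 2 ^ N < \<epsilon>" using \<open>x0 < y0\<close> by (simp add: L_def field_simps power_divide)
    have pick: "\<exists>k\<le>2 ^ N. c \<le> q N k \<and> q N k \<le> d"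
      if cd: "c \<in> B" "d \<in> B" "x < c" "d < y" "\<epsilon> \<le> d - c" for c d
    proof -
      define K where "K = {k. k \<le> 2 ^ N \<and> q N k \<le> d}"
      have "c < d" using cd(5) \<open>\<epsilon> > 0\<close> by linarith
      then have "0 \<in> K" using q_ends cd xy by (simp add: K_def)
      have "finite K" by (simp add: K_def)
      define k where "k = Max K"
      have k: "k \<in> K" using Max_in[OF \<open>finite K\<close>] \<open>0 \<in> K\<close> by (auto simp: k_def)
      have "k \<noteq> 2 ^ N" using k q_ends(2) cd xy by (auto simp: K_def)
      then have kN: "k < 2 ^ N" using k by (simp add: K_def)
      have "Suc k \<notin> K" using Max_ge[OF \<open>finite K\<close>, of "Suc k"] by (auto simp: k_def)
      then have dk: "d < q N (Suc k)" using kN by (simp add: K_def)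
      have "c \<le> q N k"
      proof (rule ccontr)
        assume "\<not> c \<le> q N k"
        then have "c \<in> B \<inter> {q N k<..<q N (Suc k)}" "d \<in> B \<inter> {q N k<..<q N (Suc k)}"
          using cd dk \<open>c < d\<close> by auto
        then have "d - c \<le> L / 2 ^ N" using step[OF kN] by blast
        then show False using cd(5) N by linarith
      qed
      then show ?thesis using k by (auto simp: K_def)
    qed
    obtain k where k: "k \<le> 2 ^ N" "b1 \<le> q N k" "q N k \<le> b2"
      using pick[of b1 b2] b unfolding \<epsilon>_def by force
    obtain j where j: "j \<le> 2 ^ N" "b3 \<le> q N j" "q N j \<le> b4"
      using pick[of b3 b4] b unfolding \<epsilon>_def by force
    have "q N k < q N j" using k j b by linarith
    then have "k < j" using q_less[of j k N] k(1) by (metis less_asym less_irrefl nat_neq_iff)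
    then have "real k / 2 ^ N < real j / 2 ^ N" by (simp add: divide_strict_right_mono)
    moreover have "\<phi> x \<le> \<phi> (q N k)" "\<phi> (q N j) \<le> \<phi> y" using k j b by (auto intro!: \<phi>_mono)
    ultimately show "\<phi> x < \<phi> y" using \<phi>_q[OF k(1)] \<phi>_q[OF j(1)] by linarith
  qed
  show ?thesis using that[of \<phi>] \<phi>_mono cont sep by (auto simp: mono_def)
qed

section \<open>Full intervals\<close>

lemma orb_superset: "U \<subseteq> orb f U"
proof -
  have "(f ^^ 0) ` U \<subseteq> orb f U" unfolding orb_def by (rule UN_upper) simp
  then show ?thesis by simp
qed

lemma orb_subset_invariant: "f ` A \<subseteq> A \<Longrightarrow> U \<subseteq> A \<Longrightarrow> orb f U \<subseteq> A"
  unfolding orb_def by (intro UN_least image_subsetI) (blast intro: funpow_mem)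

lemma orb_mono: "U \<subseteq> V \<Longrightarrow> orb f U \<subseteq> orb f V"
  unfolding orb_def by blast

lemma orb_Un: "orb f (U \<union> V) = orb f U \<union> orb f V"
  unfolding orb_def by blast

lemma image_orb_subset: "f ` orb f U \<subseteq> orb f U"
proof (rule image_subsetI)
  fix s assume "s \<in> orb f U"
  then obtain i t where "t \<in> U" "s = (f ^^ i) t" unfolding orb_def by blast
  then have "f s \<in> (f ^^ Suc i) ` U" by simp
  then show "f s \<in> orb f U" unfolding orb_def by blast
qed

locale basic_cycle =
  fixes f :: "real \<Rightarrow> real" and n :: nat and I M B :: "real set"
  assumes cont01: "continuous_on {0..1} f" and map01: "f ` {0..1} \<subseteq> {0..1}"
    and periodic: "periodic_interval f n I"
    and M_def: "M = cycle f n I"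
    and basic: "basic_set f M B"
begin

section \<open>The components of the cycle\<close>

definition C :: "nat \<Rightarrow> real set" where "C i = (f ^^ i) ` I"

definition lo :: "nat \<Rightarrow> real" where "lo i = Inf (C i)"

definition hi :: "nat \<Rightarrow> real" where "hi i = Sup (C i)"

lemma n1: "n \<ge> 1" and I_sub: "I \<subseteq> {0..1}" and I_ex: "\<exists>a b. a \<le> b \<and> I = {a..b}"
  and disj: "i < n \<Longrightarrow> j < n \<Longrightarrow> i \<noteq> j \<Longrightarrow> C i \<inter> C j = {}" and fnI: "(f ^^ n) ` I = I"
  using periodic unfolding periodic_interval_def C_def by auto

lemma C_Suc: "f ` C i = C (Suc i)"
  by (simp add: C_def image_comp)

lemma C_funpow: "(f ^^ k) ` C i = C (k + i)"
  by (simp add: C_def image_comp funpow_add)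

lemma C_add_n: "C (i + n) = C i"
proof -
  have "C (i + n) = (f ^^ i) ` ((f ^^ n) ` I)" by (simp add: C_def image_comp funpow_add)
  then show ?thesis by (simp add: fnI C_def)
qed

lemma C_mod: "C (i mod n) = C i"
proof -
  have "C (i + n * k) = C i" for i k
  proof (induction k)
    case (Suc k)
    have "C (i + n * Suc k) = C (i + n * k + n)" by (simp add: add_ac)
    then show ?case using Suc C_add_n by simp
  qed simp
  from this[of "i mod n" "i div n"] show ?thesis by simp
qed

lemma C_01: "C i \<subseteq> {0..1}"
  unfolding C_def using funpow_mem[OF map01] I_sub by (intro image_subsetI) (blast intro!: funpow_mem[OF map01])

lemma M_eq: "M = (\<Union>i<n. C i)"
  by (simp add: M_def cycle_def C_def)

lemma C_sub_M: "C i \<subseteq> M"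
proof -
  have "i mod n < n" using n1 by simp
  then show ?thesis unfolding M_eq using C_mod[of i] by blast
qed

lemma in_M_E:
  assumes "x \<in> M"
  obtains i where "i < n" "x \<in> C i"
  using assms unfolding M_eq by blast

lemma M_01: "M \<subseteq> {0..1}"
  unfolding M_eq using C_01 by blast

lemma f_M: "f ` M = M"
proof
  show "f ` M \<subseteq> M" unfolding M_eq image_UN C_Suc using C_sub_M M_eq by blast
  show "M \<subseteq> f ` M"
  proof
    fix x assume "x \<in> M"
    then obtain i where "x \<in> C i" by (rule in_M_E)
    then have "x \<in> C (Suc (i + n - 1))" using n1 C_add_n[of i] by simp
    then have "x \<in> f ` C (i + n - 1)" by (simp add: C_Suc)
    then show "x \<in> f ` M" using C_sub_M by blast
  qed
qed

lemma fk_M: "(f ^^ i) ` M = M"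
  using funpow_image_eq[OF f_M] .

lemma fk_in_M: "x \<in> M \<Longrightarrow> (f ^^ i) x \<in> M"
  using fk_M[of i] imageI by metis

lemma cont_f: "S \<subseteq> {0..1} \<Longrightarrow> continuous_on S (f ^^ i)"
  using continuous_on_subset[OF continuous_on_funpow[OF cont01 map01]] .

lemma cont_M: "S \<subseteq> M \<Longrightarrow> continuous_on S (f ^^ i)"
  using cont_f M_01 by blast

lemma C_compact_connected: "compact (C i)" "connected (C i)"
proof -
  obtain a b where "I = {a..b}" using I_ex by blast
  then show "compact (C i)" "connected (C i)" unfolding C_def
    using compact_continuous_image[OF cont_f[OF I_sub]] connected_continuous_image[OF cont_f[OF I_sub]]
    by auto
qed

lemma C_ne: "C i \<noteq> {}"
  unfolding C_def using I_ex by auto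

lemma C_Icc: "C i = {lo i..hi i}"
proof -
  obtain a b where ab: "C i = {a..b}"
    using C_compact_connected[of i] connected_compact_interval_1 by blast
  then have "a \<le> b" using C_ne[of i] by auto
  then show ?thesis unfolding lo_def hi_def ab by simp
qed

lemma M_compact: "compact M" "closed M"
  unfolding M_eq using C_compact_connected by (auto intro!: compact_UN compact_imp_closed)

lemma B_sub: "B \<subseteq> M" and B_inf: "infinite B"
  using basic unfolding basic_set_def by auto

lemma B_iff: "x \<in> B \<longleftrightarrow> x \<in> M \<and> (\<forall>U. rel_neighborhood M x U \<longrightarrow> closure (orb f U) = M)"
  using basic unfolding basic_set_def by blast

lemma lo_hi: "lo i < hi i"
proof (rule ccontr)
  assume "\<not> lo i < hi i"
  then obtain w where w: "C i = {w}" using C_Icc[of i] C_ne[of i] by fastforce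
  have "finite (C j)" for j
  proof -
    have "C (i + k) = {(f ^^ k) w}" for k using C_funpow[of k i] w by (simp add: add.commute)
    moreover have "C j = C (i + (j + n * i - i))"
    proof -
      have "i \<le> j + n * i" using n1 by (cases n) auto
      then have "i + (j + n * i - i) = j + n * i" by simp
      then show ?thesis using C_mod[of j] C_mod[of "j + n * i"] by (metis mod_mult_self2)
    qed
    ultimately show ?thesis by simp
  qed
  then have "finite M" unfolding M_eq by blast
  then show False using B_sub B_inf finite_subset by blast
qed

lemma connected_sub_C:
  assumes "connected S" "S \<subseteq> M" "x \<in> S" "x \<in> C i"
  shows "S \<subseteq> C i"
proof -
  define R where "R = (\<Union>j\<in>{j. j < n \<and> C j \<noteq> C i}. C j)"
  have "closed R" unfolding R_def using C_compact_connected compact_imp_closed by (intro closed_UN) auto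
  moreover have "closed (C i)" using C_compact_connected compact_imp_closed by blast
  moreover have "S \<subseteq> C i \<union> R" using assms(2) unfolding M_eq R_def by blast
  moreover have "C i \<inter> R \<inter> S = {}"
  proof -
    have "C j \<inter> C i = {}" if "j < n" "C j \<noteq> C i" for j
    proof -
      have "i mod n < n" "i mod n \<noteq> j" using n1 that C_mod[of i] by auto
      then show ?thesis using disj[of j "i mod n"] that C_mod[of i] by auto
    qed
    then show ?thesis unfolding R_def by blast
  qed
  ultimately have "C i \<inter> S = {} \<or> R \<inter> S = {}" using assms(1) connected_closedD by blast
  then show ?thesis using assms \<open>S \<subseteq> C i \<union> R\<close> by blast
qed

text \<open>At an end of a component the interval is one-sided: \<open>x\<close> may equal
  \<open>l\<close> or \<open>r\<close>, and \<open>\<delta>\<close> controls only the points of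
  \<open>M\<close>. Points of \<open>B\<close> may lie at such ends.\<close>

lemma nbhd:
  assumes "x \<in> M" "\<epsilon> > 0"
  obtains l r \<delta> where "l < r" "l \<le> x" "x \<le> r" "{l..r} \<subseteq> M" "{l..r} \<subseteq> {x-\<epsilon><..<x+\<epsilon>}"
    "\<delta> > 0" "M \<inter> {x-\<delta><..<x+\<delta>} \<subseteq> {l..r}"
proof -
  obtain i where i: "i < n" "x \<in> C i" using assms(1) by (rule in_M_E)
  define R where "R = (\<Union>j\<in>{..<n} - {i}. C j)"
  have "open (- R)" unfolding R_def using C_compact_connected compact_imp_closed
    by (intro open_Compl closed_UN) auto
  moreover have "x \<in> - R" using disj i unfolding R_def by fastforce
  ultimately obtain e where e: "e > 0" "ball x e \<subseteq> - R" using open_contains_ball by metis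
  define d where "d = min e \<epsilon> / 2"
  have d: "d > 0" "d < e" "d < \<epsilon>" using e assms(2) by (auto simp: d_def min_def)
  have x: "lo i \<le> x" "x \<le> hi i" using i C_Icc[of i] by auto
  have "{max (lo i) (x - d)..min (hi i) (x + d)} \<subseteq> M"
    using C_sub_M[of i] unfolding C_Icc[of i] by auto
  moreover have "M \<inter> {x-d<..<x+d} \<subseteq> {max (lo i) (x - d)..min (hi i) (x + d)}"
  proof
    fix z assume z: "z \<in> M \<inter> {x-d<..<x+d}"
    then have "z \<in> ball x e" using d by (auto simp: dist_real_def)
    then have "z \<notin> R" using e by blast
    then have "z \<in> C i" using z unfolding M_eq R_def by blast
    then show "z \<in> {max (lo i) (x - d)..min (hi i) (x + d)}" using z C_Icc[of i] by auto
  qed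
  moreover have "{max (lo i) (x - d)..min (hi i) (x + d)} \<subseteq> {x-\<epsilon><..<x+\<epsilon>}"
    using d by (intro subsetI) auto
  ultimately show ?thesis
    using that[of "max (lo i) (x - d)" "min (hi i) (x + d)" d] d x lo_hi[of i] by auto
qed

section \<open>Intervals with dense orbit\<close>

definition cl :: "real \<Rightarrow> real \<Rightarrow> real set" where "cl l r = closure (orb f {l..r})"

definition full :: "real \<Rightarrow> real \<Rightarrow> bool" where "full l r \<longleftrightarrow> M \<subseteq> cl l r"

lemma cl_least: "closed A \<Longrightarrow> f ` A \<subseteq> A \<Longrightarrow> {l..r} \<subseteq> A \<Longrightarrow> cl l r \<subseteq> A"
  unfolding cl_def by (intro closure_minimal orb_subset_invariant)

lemma cl_closed: "closed (cl l r)"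
  by (simp add: cl_def)

lemma Icc_sub_cl: "{l..r} \<subseteq> cl l r"
  unfolding cl_def by (rule subset_trans[OF orb_superset closure_subset])

lemma cl_sub_M: "{l..r} \<subseteq> M \<Longrightarrow> cl l r \<subseteq> M"
  by (rule cl_least[OF M_compact(2)]) (simp_all add: f_M)

lemma f_cl: "{l..r} \<subseteq> M \<Longrightarrow> f ` cl l r \<subseteq> closure (f ` orb f {l..r})"
  using cont_M[OF cl_sub_M, of l r 1] unfolding cl_def
  by (intro image_closure_subset closed_closure closure_subset) simp

lemma cl_invariant: "{l..r} \<subseteq> M \<Longrightarrow> f ` cl l r \<subseteq> cl l r"
  unfolding cl_def by (rule subset_trans[OF f_cl[unfolded cl_def] closure_mono[OF image_orb_subset]])

lemma full_mono: "full l r \<Longrightarrow> {l..r} \<subseteq> {l'..r'} \<Longrightarrow> full l' r'"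
  unfolding full_def cl_def by (erule subset_trans) (rule closure_mono[OF orb_mono])

lemma full_closed_invariant: "full l r \<Longrightarrow> closed A \<Longrightarrow> f ` A \<subseteq> A \<Longrightarrow> {l..r} \<subseteq> A \<Longrightarrow> M \<subseteq> A"
  unfolding full_def using cl_least by blast

lemma B_full:
  assumes "x \<in> B" "{l..r} \<subseteq> M" "\<delta> > 0" "M \<inter> {x-\<delta><..<x+\<delta>} \<subseteq> {l..r}"
  shows "full l r"
proof -
  have "rel_neighborhood M x {l..r}" unfolding rel_neighborhood_def
    using assms B_sub by (intro conjI exI[of _ "M \<inter> {x-\<delta><..<x+\<delta>}"]) (auto intro: openin_open_Int)
  then show ?thesis using assms(1) B_iff unfolding full_def cl_def by blast
qed

lemma B_full_inside:
  assumes "x \<in> B" "{l..r} \<subseteq> M" "l < x" "x < r"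
  shows "full l r"
  by (rule B_full[OF assms(1,2), of "min (x - l) (r - x)"]) (use assms in auto)

lemma B_I:
  assumes "x \<in> M" and ex: "\<And>\<epsilon>. \<epsilon> > 0 \<Longrightarrow> \<exists>l r. {l..r} \<subseteq> M \<inter> {x-\<epsilon><..<x+\<epsilon>} \<and> full l r"
  shows "x \<in> B"
proof -
  have "closure (orb f U) = M" if U: "rel_neighborhood M x U" for U
  proof
    have UM: "U \<subseteq> M" using U unfolding rel_neighborhood_def by blast
    then show "closure (orb f U) \<subseteq> M"
      by (intro closure_minimal orb_subset_invariant M_compact) (simp_all add: f_M)
    obtain W T where W: "open T" "W = M \<inter> T" "x \<in> W" "W \<subseteq> U"
      using U unfolding rel_neighborhood_def openin_open by blast
    then obtain e where e: "e > 0" "ball x e \<subseteq> T" using open_contains_ball by (metis IntE)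
    obtain l r where lr: "{l..r} \<subseteq> M \<inter> {x-e<..<x+e}" "full l r" using ex[OF e(1)] by blast
    have "{x-e<..<x+e} \<subseteq> ball x e" by (auto simp: dist_real_def)
    then have "{l..r} \<subseteq> U" using lr W e by blast
    then show "M \<subseteq> closure (orb f U)"
      using lr(2) closure_mono[OF orb_mono, of "{l..r}" U f] unfolding full_def cl_def by blast
  qed
  then show ?thesis using B_iff assms(1) by blast
qed

lemma B_closed: "closed B"
  unfolding closed_limpt
proof (intro allI impI)
  fix x assume x: "x islimpt B"
  then have xM: "x \<in> M" using B_sub M_compact(2) by (meson closed_limpt islimpt_subset)
  show "x \<in> B"
  proof (rule B_I[OF xM])
    fix \<epsilon> :: real assume e: "\<epsilon> > 0"
    then obtain b where b: "b \<in> B" "\<bar>b - x\<bar> < \<epsilon> / 2"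
      using x unfolding islimpt_approachable dist_real_def by (meson half_gt_zero)
    obtain l r \<delta> where lr: "{l..r} \<subseteq> M" "{l..r} \<subseteq> {b-\<epsilon>/2<..<b+\<epsilon>/2}" "\<delta> > 0" "M \<inter> {b-\<delta><..<b+\<delta>} \<subseteq> {l..r}"
      using nbhd[of b "\<epsilon>/2"] b B_sub e by (metis half_gt_zero subsetD)
    have "{b-\<epsilon>/2<..<b+\<epsilon>/2} \<subseteq> {x-\<epsilon><..<x+\<epsilon>}" using b(2)
      unfolding abs_less_iff subset_iff greaterThanLessThan_iff by linarith
    then show "\<exists>l r. {l..r} \<subseteq> M \<inter> {x-\<epsilon><..<x+\<epsilon>} \<and> full l r"
      using lr B_full[OF b(1) lr(1,3,4)] by blast
  qed
qed

lemma B_compact: "compact B"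
  using B_closed B_sub M_compact(1) by (meson bounded_subset compact_eq_bounded_closed)

text \<open>\<open>f\<close> maps \<open>M\<close> onto itself, so dropping the first
  \<open>N\<close> times keeps the orbit dense. This is what makes the visits in
  \<open>full_hit\<close> arbitrarily late.\<close>

lemma full_tail:
  assumes "full l r" "{l..r} \<subseteq> M"
  shows "M \<subseteq> closure ((f ^^ N) ` orb f {l..r})"
proof -
  have "M = (f ^^ N) ` M" by (simp add: fk_M)
  also have "\<dots> \<subseteq> (f ^^ N) ` closure (orb f {l..r})" using assms(1) unfolding full_def cl_def by blast
  also have "\<dots> \<subseteq> closure ((f ^^ N) ` orb f {l..r})"
    using cont_M[OF cl_sub_M[OF assms(2)], of N] unfolding cl_def
    by (intro image_closure_subset closed_closure closure_subset)
  finally show ?thesis .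
qed

lemma full_hit:
  assumes "full l r" "{l..r} \<subseteq> M" "{u<..<v} \<inter> M \<noteq> {}"
  obtains i s where "i \<ge> N" "s \<in> {l..r}" "(f ^^ i) s \<in> {u<..<v}"
proof -
  obtain z where "z \<in> M" "z \<in> {u<..<v}" using assms(3) by blast
  then have "{u<..<v} \<inter> closure ((f ^^ N) ` orb f {l..r}) \<noteq> {}" using full_tail[OF assms(1,2)] by blast
  then obtain y where "y \<in> (f ^^ N) ` orb f {l..r}" "y \<in> {u<..<v}"
    using open_Int_closure_eq_empty[of "{u<..<v}"] by (metis disjoint_iff open_greaterThanLessThan)
  then obtain i s where "s \<in> {l..r}" "y = (f ^^ N) ((f ^^ i) s)" unfolding orb_def by blast
  then show ?thesis using that[of "N + i" s] \<open>y \<in> {u<..<v}\<close> by (simp add: funpow_add)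
qed

lemma connected_chain:
  fixes V :: "nat \<Rightarrow> real set"
  assumes "\<And>j. connected (V j)" "\<And>j. V j \<inter> V (Suc j) \<noteq> {}"
  shows "connected (\<Union>j. V j)"
proof -
  have P: "connected (\<Union>j\<le>m. V j)" for m
  proof (induction m)
    case (Suc m)
    have "(\<Union>j\<le>m. V j) \<inter> V (Suc m) \<noteq> {}" using assms(2)[of m] by blast
    then have "connected ((\<Union>j\<le>m. V j) \<union> V (Suc m))" using Suc assms(1) by (intro connected_Un)
    then show ?case by (simp add: atMost_Suc Un_commute)
  qed (simp add: assms(1))
  have "(\<Union>j. V j) = \<Union> (range (\<lambda>m. \<Union>j\<le>m. V j))" by auto
  moreover have "connected (\<Union> (range (\<lambda>m. \<Union>j\<le>m. V j)))"
  proof (rule connected_Union)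
    have "V 0 \<noteq> {}" using assms(2)[of 0] by blast
    then show "\<Inter> (range (\<lambda>m. \<Union>j\<le>m. V j)) \<noteq> {}" by blast
  qed (use P in auto)
  ultimately show ?thesis by simp
qed

text \<open>Sorted by time modulo \<open>k\<close>, the images of a returning interval form
  \<open>k\<close> connected chains, so the orbit closure is a union of \<open>k\<close> closed
  intervals. One of them contains infinitely many points of \<open>B\<close>, hence one in its
  interior, and is full; the closed invariant set \<open>cl l r\<close> containing it is then all of
  \<open>M\<close>.\<close>

lemma full_of_return:
  assumes lr: "{l..r} \<subseteq> M" and k: "k \<ge> 1" "t \<in> {l..r}" "(f ^^ k) t \<in> {l..r}" and Bcl: "B \<subseteq> cl l r"
  shows "full l r"
proof -
  define W where "W \<rho> = (\<Union>j. (f ^^ (k * j + \<rho>)) ` {l..r})" for \<rho>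
  have conn: "connected (W \<rho>)" for \<rho>
    unfolding W_def
  proof (rule connected_chain)
    show "connected ((f ^^ (k * j + \<rho>)) ` {l..r})" for j
      by (rule connected_continuous_image[OF cont_M[OF lr]]) simp
    fix j
    have "(f ^^ (k * Suc j + \<rho>)) t = (f ^^ (k * j + \<rho>)) ((f ^^ k) t)"
      by (simp add: funpow_add[symmetric, THEN fun_cong, simplified] add_ac)
    then show "(f ^^ (k * j + \<rho>)) ` {l..r} \<inter> (f ^^ (k * Suc j + \<rho>)) ` {l..r} \<noteq> {}"
      using k(2,3) by (metis disjoint_iff imageI)
  qed
  have W_orb: "W \<rho> \<subseteq> orb f {l..r}" for \<rho> unfolding W_def orb_def by blast
  have "orb f {l..r} = (\<Union>\<rho><k. W \<rho>)"
  proof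
    show "orb f {l..r} \<subseteq> (\<Union>\<rho><k. W \<rho>)"
    proof
      fix z assume "z \<in> orb f {l..r}"
      then obtain i s where "s \<in> {l..r}" "z = (f ^^ i) s" unfolding orb_def by blast
      then have "z \<in> W (i mod k)" unfolding W_def
        by (intro UN_I[of "i div k"]) (auto simp: mult_div_mod_eq)
      then show "z \<in> (\<Union>\<rho><k. W \<rho>)" using k(1) by (intro UN_I[of "i mod k"]) auto
    qed
  qed (use W_orb in blast)
  then have "cl l r \<subseteq> (\<Union>\<rho><k. closure (W \<rho>))"
    unfolding cl_def using closure_subset by (intro closure_minimal closed_UN) (force simp: subset_iff)+
  then have "B = (\<Union>\<rho><k. B \<inter> closure (W \<rho>))" using Bcl by blast
  then obtain \<rho> where \<rho>: "infinite (B \<inter> closure (W \<rho>))" using B_inf by (metis finite_UN_I finite_lessThan)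
  have WM: "closure (W \<rho>) \<subseteq> M"
    using cl_sub_M[OF lr] closure_mono[OF W_orb] unfolding cl_def by blast
  then have "compact (closure (W \<rho>))"
    using M_compact by (meson bounded_subset closed_closure compact_eq_bounded_closed)
  then obtain p q where pq: "closure (W \<rho>) = {p..q}"
    using connected_compact_interval_1 connected_imp_connected_closure[OF conn] by blast
  have "\<not> B \<inter> closure (W \<rho>) \<subseteq> {p, q}" using \<rho> finite_subset by blast
  then obtain b where b: "b \<in> B" "p < b" "b < q" unfolding pq by force
  have "full p q" using B_full_inside[OF b(1) _ b(2,3)] WM pq by simp
  moreover have "{p..q} \<subseteq> cl l r" using closure_mono[OF W_orb] pq unfolding cl_def by blast
  ultimately show ?thesis
    using full_closed_invariant[OF _ cl_closed cl_invariant[OF lr]] unfolding full_def by blast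
qed

text \<open>The complement of \<open>A\<close> is backward invariant, so it must be visited by \<open>{l..r}\<close> itself,
  and it is covered by images of \<open>{l..r}\<close>; hence \<open>{l..r}\<close> returns to itself.\<close>

lemma full_of_cover:
  assumes lr: "l < r" "{l..r} \<subseteq> M" and A: "closed A" "f ` A \<subseteq> A" "\<not> M \<subseteq> A"
    and cover: "M \<subseteq> cl l r \<union> A"
  shows "full l r"
proof -
  have bwd: "t \<notin> A" if "(f ^^ i) t \<notin> A" for i t using funpow_mem[OF A(2)] that by blast
  obtain s0 where s0: "s0 \<in> M" "s0 \<in> - A" using A(3) by blast
  have "s0 \<in> closure (orb f {l..r})" using s0 cover unfolding cl_def by blast
  then obtain y where "y \<in> orb f {l..r}" "y \<notin> A"
    using s0(2) A(1) open_Int_closure_eq_empty[of "- A"] by (metis ComplD disjoint_iff open_Compl)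
  then obtain t where t: "t \<in> {l..r}" "t \<in> - A" unfolding orb_def using bwd by blast
  obtain e where e: "e > 0" "ball t e \<subseteq> - A" using A(1) t(2) open_contains_ball open_Compl by metis
  define p where "p = max l (t - e / 2)"
  define q where "q = min r (t + e / 2)"
  have pq: "p < q" "{p..q} \<subseteq> {l..r}" using t(1) lr e by (auto simp: p_def q_def)
  have "{p..q} \<subseteq> ball t e" using e by (auto simp: p_def q_def dist_real_def)
  then have pqA: "{p..q} \<inter> A = {}" using e by blast
  define s where "s = (p + q) / 2"
  have s: "s \<in> {p<..<q}" using pq by (auto simp: s_def)
  then have sM: "s \<in> M" using pq lr by auto
  \<comment> \<open>Passing to a preimage makes the visiting time positive: \<open>w\<close> lies
    outside \<open>A\<close>, hence in \<open>cl l r\<close>, and so \<open>s\<close> is a limit of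
    points of the orbit at times at least 1.\<close>
  then obtain w where w: "w \<in> M" "s = f w" using f_M by blast
  have pqA': "z \<notin> A" if "z \<in> {p<..<q}" for z
    using pqA that by (metis disjoint_iff greaterThanLessThan_subseteq_atLeastAtMost_iff order_refl subsetD)
  then have "s \<notin> A" using s by blast
  then have "w \<in> cl l r" using w cover A(2) by blast
  then have "s \<in> closure (f ` orb f {l..r})" using f_cl[OF lr(2)] w by blast
  then obtain y where "y \<in> f ` orb f {l..r}" "y \<in> {p<..<q}"
    using s open_Int_closure_eq_empty[of "{p<..<q}"] by (metis disjoint_iff open_greaterThanLessThan)
  then obtain i u where u: "u \<in> {l..r}" "(f ^^ Suc i) u \<in> {p<..<q}" unfolding orb_def by auto
  have ret: "(f ^^ Suc i) u \<in> {l..r}" using u(2) pq by auto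
  \<comment> \<open>A neighborhood of a point of \<open>B\<close> outside \<open>cl l r\<close> is
    full and visits \<open>{p<..<q}\<close>, which avoids \<open>A\<close>. The visiting point then
    lies outside \<open>A\<close> as well, hence in \<open>cl l r\<close>.\<close>
  have "B \<subseteq> cl l r"
  proof
    fix b assume b: "b \<in> B"
    show "b \<in> cl l r"
    proof (rule ccontr)
      assume "b \<notin> cl l r"
      then obtain d where d: "d > 0" "ball b d \<subseteq> - cl l r"
        using cl_closed[of l r] open_contains_ball open_Compl by (metis ComplI)
      obtain l' r' \<delta> where lr': "{l'..r'} \<subseteq> M" "{l'..r'} \<subseteq> {b-d<..<b+d}" "\<delta> > 0" "M \<inter> {b-\<delta><..<b+\<delta>} \<subseteq> {l'..r'}"
        using nbhd[of b d] b B_sub d(1) by (metis subsetD)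
      obtain j v where jv: "v \<in> {l'..r'}" "(f ^^ j) v \<in> {p<..<q}"
        using full_hit[OF B_full[OF b lr'(1,3,4)] lr'(1), of p q 0] sM s by blast
      then have "(f ^^ j) v \<notin> A" using pqA' by blast
      then have "v \<in> cl l r" using bwd cover lr'(1) jv(1) by blast
      moreover have "v \<in> {b-d<..<b+d}" using lr'(2) jv(1) by blast
      then have "v \<in> ball b d" by (auto simp: dist_real_def)
      ultimately show False using d by blast
    qed
  qed
  then show ?thesis using full_of_return[OF lr(2) _ u(1) ret] by simp
qed

text \<open>If the left piece is not full, its orbit closure is a closed invariant set missing part
  of \<open>M\<close>, and together with that of the right piece it covers \<open>M\<close>. This is
  the hypothesis of \<open>full_of_cover\<close>.\<close>

lemma full_split:
  assumes "l < r" "{l..r} \<subseteq> M" "full l r" "l \<le> m" "m \<le> r"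
  shows "l < m \<and> full l m \<or> m < r \<and> full m r"
proof (cases "l = m \<or> m = r")
  case False
  then have m: "l < m" "m < r" using assms by auto
  have sub: "{l..m} \<subseteq> M" "{m..r} \<subseteq> M" using assms(2) m by auto
  show ?thesis
  proof (cases "full l m")
    case False
    have "{l..r} = {m..r} \<union> {l..m}" using m by auto
    then have "cl l r = cl m r \<union> cl l m" unfolding cl_def by (simp only: orb_Un closure_Un)
    then have "full m r"
      using full_of_cover[OF m(2) sub(2) cl_closed cl_invariant[OF sub(1)]] False assms(3)
      unfolding full_def by blast
    then show ?thesis using m by blast
  qed (use m in blast)
qed (use assms in auto)

text \<open>By \<open>full_split\<close>, two adjacent intervals that are not full have a union that
  is not full, so \<open>Bolzano\<close> applies. The local hypothesis holds because a point outside
  \<open>B\<close> has a neighborhood containing no full interval.\<close>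

lemma full_meets_B:
  assumes lr: "l < r" "{l..r} \<subseteq> M" "full l r"
  shows "{l..r} \<inter> B \<noteq> {}"
proof
  assume none: "{l..r} \<inter> B = {}"
  define P where "P a b \<longleftrightarrow> (l \<le> a \<and> a < b \<and> b \<le> r \<longrightarrow> \<not> full a b)" for a b
  have "P l r"
  proof (rule Bolzano)
    fix a b c assume "P a b" "P b c" "a \<le> b" "b \<le> c"
    then show "P a c" using full_split[of a c b] lr(2) unfolding P_def
      by (metis (no_types, opaque_lifting) atLeastatMost_subset_iff order_trans)
  next
    fix x assume x: "l \<le> x" "x \<le> r"
    then have "x \<in> M" "x \<notin> B" using lr(2) none by auto
    then obtain e where e: "e > 0" "\<And>a b. {a..b} \<subseteq> M \<inter> {x-e<..<x+e} \<Longrightarrow> \<not> full a b"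
      using B_I by blast
    have "P a b" if "a \<le> x" "x \<le> b" "b - a < e" for a b
      unfolding P_def
    proof (intro impI)
      assume ab: "l \<le> a \<and> a < b \<and> b \<le> r"
      have "{a..b} \<subseteq> {l..r}" "{a..b} \<subseteq> {x-e<..<x+e}" using ab that by auto
      then show "\<not> full a b" using e(2) lr(2) by blast
    qed
    then show "\<exists>d>0. \<forall>a b. a \<le> x \<and> x \<le> b \<and> b - a < d \<longrightarrow> P a b" using e(1) by blast
  qed (use lr in simp)
  then show False using lr by (simp add: P_def)
qed

text \<open>If a point of \<open>B\<close> lay strictly between two values of \<open>f ^^ i\<close>
  on a gap, then a closed interval inside the open gap would have an image around that point. The
  image contains a full interval, so the interval inside the gap is itself full and meets
  \<open>B\<close>.\<close>

lemma gap_image: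
  assumes pq: "{p..q} \<subseteq> M" "{p<..<q} \<inter> B = {}" and u: "u1 \<in> {p..q}" "u2 \<in> {p..q}"
    and b: "(f ^^ i) u1 < b" "b < (f ^^ i) u2"
  shows "b \<notin> B"
proof
  assume bB: "b \<in> B"
  have "p < q" using u b by (cases "p = q") auto
  note ci = cont_M[OF pq(1), of i]
  \<comment> \<open>The two points are moved off the ends of the gap with their images still on the
    two sides of \<open>b\<close>: \<open>full_meets_B\<close> is about closed intervals and could
    otherwise return an end of the gap.\<close>
  have ap: "\<exists>w\<in>{p<..<q}. y < (f ^^ i) w \<and> (f ^^ i) w < z" if w: "u \<in> {p..q}" "y < (f ^^ i) u" "(f ^^ i) u < z" for u y z
  proof -
    obtain s t where st: "p \<le> s" "s < t" "t \<le> q" "(f ^^ i) ` {s..t} \<subseteq> {y<..<z}"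
      using local_interval[OF ci \<open>p < q\<close> w zero_less_one] by metis
    have "(s + t) / 2 \<in> {s..t}" "(s + t) / 2 \<in> {p<..<q}" using st by auto
    then show ?thesis using st(4) by (meson greaterThanLessThan_iff image_subset_iff)
  qed
  obtain w1 where w1: "w1 \<in> {p<..<q}" "(f ^^ i) w1 < b" using ap[OF u(1), of "(f ^^ i) u1 - 1" b] b by auto
  obtain w2 where w2: "w2 \<in> {p<..<q}" "b < (f ^^ i) w2" using ap[OF u(2), of b "(f ^^ i) u2 + 1"] b by auto
  have ne: "w1 \<noteq> w2" using w1 w2 by auto
  define l where "l = min w1 w2"
  define r where "r = max w1 w2"
  have lr: "l < r" "{l..r} \<subseteq> {p<..<q}" using ne w1 w2 by (auto simp: l_def r_def)
  have lrM: "{l..r} \<subseteq> M" using lr pq(1) by (auto simp: subset_iff)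
  have conn: "connected ((f ^^ i) ` {l..r})" by (rule connected_continuous_image[OF cont_M[OF lrM]]) simp
  have "w1 \<in> {l..r}" "w2 \<in> {l..r}" by (auto simp: l_def r_def)
  then have sub: "{(f ^^ i) w1..(f ^^ i) w2} \<subseteq> (f ^^ i) ` {l..r}"
    using connected_contains_Icc[OF conn] by blast
  then have "{(f ^^ i) w1..(f ^^ i) w2} \<subseteq> M" using lrM fk_M by blast
  then have "full ((f ^^ i) w1) ((f ^^ i) w2)" using B_full_inside[OF bB] w1 w2 by blast
  moreover have "(f ^^ i) ` {l..r} \<subseteq> cl l r"
    using Icc_sub_cl funpow_mem[OF cl_invariant[OF lrM]] by blast
  ultimately have "full l r"
    using full_closed_invariant[OF _ cl_closed cl_invariant[OF lrM]] sub unfolding full_def by blast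
  then show False using full_meets_B[OF lr(1) lrM] lr(2) pq(2) by blast
qed

text \<open>Enlarge the interval to a whole gap \<open>{p..q}\<close> of \<open>B\<close> in its
  component. A full gap returns to itself, and by \<open>gap_image\<close> the returning image is
  contained in the gap. Finitely many images of the gap then cover \<open>M\<close>, one of them has
  a point of \<open>B\<close> in its interior, and this contradicts
  \<open>gap_image\<close>.\<close>

lemma full_meets_B_inside:
  assumes lr: "l < r" "{l..r} \<subseteq> M" "full l r"
  shows "{l<..<r} \<inter> B \<noteq> {}"
proof
  assume none: "{l<..<r} \<inter> B = {}"
  have "l \<in> M" using lr by auto
  then obtain i where i: "i < n" "l \<in> C i" by (rule in_M_E)
  have lrC: "{l..r} \<subseteq> C i"
    using connected_sub_C[OF _ lr(2) _ i(2)] lr(1) by simp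
  then have lh: "lo i \<le> l" "r \<le> hi i" using C_Icc[of i] lr(1) by auto
  have "\<exists>p. lo i \<le> p \<and> p \<le> l \<and> {p<..<r} \<inter> B = {} \<and> (p \<in> B \<or> p = lo i)"
  proof (cases "B \<inter> {lo i..l} = {}")
    case True
    then have "{lo i<..<r} \<inter> {l} \<inter> B = {}" "\<And>z. z \<in> B \<Longrightarrow> \<not> (lo i \<le> z \<and> z \<le> l)" by auto
    then have "{lo i<..<r} \<inter> B = {}" using none by (force simp: disjoint_iff)
    then show ?thesis using lh by auto
  next
    case False
    have "compact (B \<inter> {lo i..l})" using B_compact by (intro compact_Int_closed) auto
    then obtain p where p: "p \<in> B \<inter> {lo i..l}" "\<And>z. z \<in> B \<inter> {lo i..l} \<Longrightarrow> z \<le> p"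
      using compact_attains_sup[OF _ False] by blast
    have "{p<..<r} \<inter> B = {}"
    proof (rule ccontr)
      assume "\<not> ?thesis"
      then obtain z where z: "z \<in> B" "p < z" "z < r" by auto
      then have "z \<le> l" using none lr(1) by force
      then show False using p(1) p(2)[of z] z by auto
    qed
    then show ?thesis using p(1) by auto
  qed
  \<comment> \<open>Each end of the gap is a point of \<open>B\<close> or an end of the component.
    An image crossing it would have a point of \<open>B\<close> strictly between two values or leave
    the component.\<close>
  then obtain p where p: "lo i \<le> p" "p \<le> l" "{p<..<r} \<inter> B = {}" "p \<in> B \<or> p = lo i" by blast
  have "\<exists>q. r \<le> q \<and> q \<le> hi i \<and> {p<..<q} \<inter> B = {} \<and> (q \<in> B \<or> q = hi i)"
  proof (cases "B \<inter> {r..hi i} = {}")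
    case True
    then have "{p<..<hi i} \<inter> B = {}" using p(3) by (force simp: disjoint_iff)
    then show ?thesis using lh by auto
  next
    case False
    have "compact (B \<inter> {r..hi i})" using B_compact by (intro compact_Int_closed) auto
    then obtain q where q: "q \<in> B \<inter> {r..hi i}" "\<And>z. z \<in> B \<inter> {r..hi i} \<Longrightarrow> q \<le> z"
      using compact_attains_inf[OF _ False] by blast
    have "{p<..<q} \<inter> B = {}"
    proof (rule ccontr)
      assume "\<not> ?thesis"
      then obtain z where z: "z \<in> B" "p < z" "z < q" by auto
      then have "r \<le> z" using p(3) by force
      then show False using q(1) q(2)[of z] z by auto
    qed
    then show ?thesis using q(1) by auto
  qed
  then obtain q where q: "r \<le> q" "q \<le> hi i" "{p<..<q} \<inter> B = {}" "q \<in> B \<or> q = hi i" by blast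
  have pq: "p < q" "{p..q} \<subseteq> C i" using p q lr(1) C_Icc[of i] by auto
  then have pqM: "{p..q} \<subseteq> M" using C_sub_M by blast
  have fpq: "full p q" using full_mono[OF lr(3)] p q by auto
  have "(p + q) / 2 \<in> {p<..<q}" "(p + q) / 2 \<in> {p..q}" using pq by auto
  then have "{p<..<q} \<inter> M \<noteq> {}" using pqM by blast
  then obtain k s where k: "k \<ge> 1" "s \<in> {p..q}" "(f ^^ k) s \<in> {p<..<q}"
    using full_hit[OF fpq pqM, of p q 1] by blast
  have conn: "connected ((f ^^ j) ` {p..q})" for j
    by (rule connected_continuous_image[OF cont_M[OF pqM]]) simp
  have "(f ^^ k) s \<in> C i" using k(3) pq(2) by auto
  then have fkC: "(f ^^ k) ` {p..q} \<subseteq> C i"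
    using connected_sub_C[OF conn, of k _ i] pqM fk_M k(2) by blast
  have fk: "(f ^^ k) ` {p..q} \<subseteq> {p..q}"
  proof (rule image_subsetI)
    fix t assume t: "t \<in> {p..q}"
    have tC: "(f ^^ k) t \<in> {lo i..hi i}" using fkC t C_Icc[of i] by blast
    have "\<not> q < (f ^^ k) t"
    proof
      assume h: "q < (f ^^ k) t"
      then have "q \<in> B" using tC q(4) by auto
      then show False using gap_image[OF pqM q(3) k(2) t, of k q] k(3) h by auto
    qed
    moreover have "\<not> (f ^^ k) t < p"
    proof
      assume h: "(f ^^ k) t < p"
      then have "p \<in> B" using tC p(4) by auto
      then show False using gap_image[OF pqM q(3) t k(2), of k p] k(3) h by auto
    qed
    ultimately show "(f ^^ k) t \<in> {p..q}" by auto
  qed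
  define A where "A = (\<Union>j<k. (f ^^ j) ` {p..q})"
  have comp: "compact ((f ^^ j) ` {p..q})" for j
    by (rule compact_continuous_image[OF cont_M[OF pqM]]) simp
  have "closed A" unfolding A_def using comp compact_imp_closed by (intro closed_UN) auto
  moreover have "f ` A \<subseteq> A"
  proof (rule image_subsetI)
    fix z assume "z \<in> A"
    then obtain j t where jt: "j < k" "t \<in> {p..q}" "z = (f ^^ j) t" unfolding A_def by blast
    have fz: "f z = (f ^^ Suc j) t" using jt by simp
    show "f z \<in> A"
    proof (cases "Suc j = k")
      case True
      then have "f z \<in> {p..q}" using fk jt(2) fz by blast
      then have "f z \<in> (f ^^ 0) ` {p..q}" by simp
      then show ?thesis unfolding A_def using k(1) by (intro UN_I[of 0]) auto
    next
      case False
      then show ?thesis unfolding A_def fz using jt by (intro UN_I[of "Suc j"]) auto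
    qed
  qed
  moreover have "{p..q} \<subseteq> A"
  proof -
    have "(f ^^ 0) ` {p..q} \<subseteq> A" unfolding A_def using k(1) by (intro UN_upper) auto
    then show ?thesis by simp
  qed
  ultimately have "M \<subseteq> A" using full_closed_invariant[OF fpq] by blast
  then have "B = (\<Union>j<k. B \<inter> (f ^^ j) ` {p..q})" using B_sub unfolding A_def by blast
  then obtain j where j: "infinite (B \<inter> (f ^^ j) ` {p..q})" using B_inf by (metis finite_UN_I finite_lessThan)
  obtain u v where uv: "(f ^^ j) ` {p..q} = {u..v}" using comp conn connected_compact_interval_1 by blast
  have "\<not> B \<inter> (f ^^ j) ` {p..q} \<subseteq> {u, v}" using j finite_subset by blast
  then obtain b where b: "b \<in> B" "u < b" "b < v" unfolding uv by force
  then have "u \<in> (f ^^ j) ` {p..q}" "v \<in> (f ^^ j) ` {p..q}" unfolding uv by auto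
  then obtain u1 u2 where "u1 \<in> {p..q}" "u2 \<in> {p..q}" "u = (f ^^ j) u1" "v = (f ^^ j) u2" by blast
  then show False using gap_image[OF pqM q(3), of u1 u2 j b] b by blast
qed

lemma B_limpt:
  assumes b: "b \<in> B"
  shows "b islimpt B"
  unfolding islimpt_approachable
proof (intro allI impI)
  fix \<epsilon> :: real assume "\<epsilon> > 0"
  then obtain l r \<delta> where lr: "l < r" "l \<le> b" "b \<le> r" "{l..r} \<subseteq> M" "{l..r} \<subseteq> {b-\<epsilon><..<b+\<epsilon>}"
    "\<delta> > 0" "M \<inter> {b-\<delta><..<b+\<delta>} \<subseteq> {l..r}"
    using nbhd[of b \<epsilon>] b B_sub by blast
  have sub: "{l..b} \<subseteq> M" "{b..r} \<subseteq> M" using lr(2-4) by auto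
  have "\<exists>b'\<in>B. b' \<in> {l..r} \<and> b' \<noteq> b"
    using full_split[OF lr(1,4) B_full[OF b lr(4,6,7)] lr(2,3)]
  proof (elim disjE conjE)
    assume "l < b" "full l b"
    then have "{l<..<b} \<inter> B \<noteq> {}" using full_meets_B_inside sub by blast
    then show ?thesis using lr(3) by fastforce
  next
    assume "b < r" "full b r"
    then have "{b<..<r} \<inter> B \<noteq> {}" using full_meets_B_inside sub by blast
    then show ?thesis using lr(2) by fastforce
  qed
  then obtain b' where "b' \<in> B" "b' \<in> {l..r}" "b' \<noteq> b" by blast
  then show "\<exists>x'\<in>B. x' \<noteq> b \<and> dist x' b < \<epsilon>" using lr(5) by (intro bexI[of _ b']) (auto simp: dist_real_def subset_iff abs_less_iff)
qed

lemma B_perfect: "perfect_set B"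
  unfolding perfect_set_def using B_closed B_limpt by blast

end

section \<open>The factor map\<close>

lemma omega_limit_iff:
  fixes T :: "'a::metric_space \<Rightarrow> 'a"
  shows "y \<in> omega_limit T x \<longleftrightarrow> (\<forall>e>0. \<forall>N. \<exists>j\<ge>N. dist ((T ^^ j) x) y < e)"
proof
  assume "y \<in> omega_limit T x"
  then obtain r where r: "strict_mono r" "(\<lambda>m. (T ^^ r m) x) \<longlonglongrightarrow> y" unfolding omega_limit_def by blast
  show "\<forall>e>0. \<forall>N. \<exists>j\<ge>N. dist ((T ^^ j) x) y < e"
  proof (intro allI impI)
    fix e :: real and N :: nat assume "e > 0"
    then obtain m where "\<And>k. k \<ge> m \<Longrightarrow> dist ((T ^^ r k) x) y < e" using r(2) unfolding lim_sequentially by blast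
    then show "\<exists>j\<ge>N. dist ((T ^^ j) x) y < e"
      using seq_suble[OF r(1), of "max m N"] by (intro exI[of _ "r (max m N)"]) auto
  qed
next
  assume *: "\<forall>e>0. \<forall>N. \<exists>j\<ge>N. dist ((T ^^ j) x) y < e"
  have "\<exists>r. \<forall>m. dist ((T ^^ r m) x) y < inverse (real (Suc m)) \<and> r m < r (Suc m)"
  proof (rule dependent_nat_choice)
    show "\<exists>j. dist ((T ^^ j) x) y < inverse (real (Suc 0))" using *[rule_format, of 1 0] by auto
    show "\<exists>k. dist ((T ^^ k) x) y < inverse (real (Suc (Suc m))) \<and> j < k" for j m
      using *[rule_format, of "inverse (real (Suc (Suc m)))" "Suc j"] by (auto simp: Suc_le_eq)
  qed
  then obtain r where r: "\<And>m. dist ((T ^^ r m) x) y < inverse (real (Suc m))" "\<And>m. r m < r (Suc m)" by blast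
  have "(\<lambda>m. (T ^^ r m) x) \<longlonglongrightarrow> y"
  proof (rule metric_LIMSEQ_I)
    fix e :: real assume "e > 0"
    then obtain N where N: "inverse (real (Suc N)) < e" using reals_Archimedean by blast
    have "dist ((T ^^ r m) x) y < e" if "m \<ge> N" for m
    proof -
      have "inverse (real (Suc m)) \<le> inverse (real (Suc N))" using that by (intro le_imp_inverse_le) auto
      then show ?thesis using r(1)[of m] N by linarith
    qed
    then show "\<exists>N. \<forall>m\<ge>N. dist ((T ^^ r m) x) y < e" by blast
  qed
  moreover have "strict_mono r" using r(2) by (simp add: strict_mono_Suc_iff)
  ultimately show "y \<in> omega_limit T x" unfolding omega_limit_def by blast
qed

lemma omega_limit_subset:
  assumes "closed S" "\<And>j. j \<ge> N \<Longrightarrow> (T ^^ j) x \<in> S"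
  shows "omega_limit T (x :: 'a::metric_space) \<subseteq> S"
proof
  fix y assume y: "y \<in> omega_limit T x"
  have "y \<in> closure S" unfolding closure_approachable
    using y[unfolded omega_limit_iff] assms(2) by blast
  then show "y \<in> S" using assms(1) by simp
qed

lemma nonstrictly_periodicI:
  fixes C :: "nat \<Rightarrow> real set"
  assumes n: "n \<ge> 1" and cont: "continuous_on (\<Union>i<n. C i) \<psi>"
    and C: "\<And>i. i < n \<Longrightarrow> C i = {a i..b i} \<and> a i < b i"
    and disj: "\<And>i j. i < n \<Longrightarrow> j < n \<Longrightarrow> i \<noteq> j \<Longrightarrow> C i \<inter> C j = {}"
    and step: "\<And>i. i < n \<Longrightarrow> \<psi> ` C i \<subseteq> C (Suc i mod n)"
  shows "nonstrictly_periodic n (\<Union>i<n. C i) \<psi>"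
proof -
  define \<rho> where "\<rho> i = card {j. j < n \<and> a j \<le> a i}" for i
  have a_inj: "a i \<noteq> a j" if "i < n" "j < n" "i \<noteq> j" for i j
    using disj[OF that] C[OF that(1)] C[OF that(2)] by (auto simp: disjoint_iff)
  have \<rho>_less: "\<rho> i < \<rho> j" if "j < n" "a i < a j" for i j
  proof -
    have "{k. k < n \<and> a k \<le> a i} \<subseteq> {k. k < n \<and> a k \<le> a j}" using that(2) by (intro Collect_mono) linarith
    moreover have "j \<in> {k. k < n \<and> a k \<le> a j}" "j \<notin> {k. k < n \<and> a k \<le> a i}" using that by auto
    ultimately have "{k. k < n \<and> a k \<le> a i} \<subset> {k. k < n \<and> a k \<le> a j}" by blast
    then show ?thesis unfolding \<rho>_def by (intro psubset_card_mono) simp_all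
  qed
  have \<rho>_inj: "inj_on \<rho> {..<n}"
  proof (rule inj_onI)
    fix i j assume h: "i \<in> {..<n}" "j \<in> {..<n}" "\<rho> i = \<rho> j"
    show "i = j"
    proof (rule ccontr)
      assume "i \<noteq> j"
      then have "a i < a j \<or> a j < a i" using a_inj h by (meson lessThan_iff linorder_less_linear)
      then show False using \<rho>_less h by (metis lessThan_iff less_irrefl)
    qed
  qed
  have "\<rho> ` {..<n} \<subseteq> {1..n}"
  proof (rule image_subsetI)
    fix i assume i: "i \<in> {..<n}"
    then have "i \<in> {j. j < n \<and> a j \<le> a i}" by auto
    then have "card {i} \<le> \<rho> i" unfolding \<rho>_def by (intro card_mono) simp_all
    moreover have "\<rho> i \<le> card {..<n}" unfolding \<rho>_def by (intro card_mono) (simp, blast)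
    ultimately show "\<rho> i \<in> {1..n}" by simp
  qed
  then have im: "\<rho> ` {..<n} = {1..n}" by (intro card_subset_eq) (auto simp: card_image[OF \<rho>_inj])
  define \<tau> where "\<tau> = inv_into {..<n} \<rho>"
  have \<tau>: "\<tau> k < n" "\<rho> (\<tau> k) = k" if "k \<in> {1..n}" for k
    using that im inv_into_into[of k \<rho> "{..<n}"] f_inv_into_f[of k \<rho> "{..<n}"] unfolding \<tau>_def by auto
  have \<tau>\<rho>: "\<tau> (\<rho> i) = i" if "i < n" for i using \<rho>_inj that unfolding \<tau>_def by simp
  define \<sigma> where "\<sigma> k = \<rho> (Suc (\<tau> k) mod n)" for k
  have \<rho>_in: "\<rho> i \<in> {1..n}" if "i < n" for i using im that by blast
  have \<sigma>_pow: "(\<sigma> ^^ m) (\<rho> 0) = \<rho> (m mod n)" for m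
  proof (induction m)
    case (Suc m)
    have "m mod n < n" using n by simp
    then show ?case using Suc by (simp add: \<sigma>_def \<tau>\<rho> mod_Suc_eq)
  qed simp
  have "{1..n} = orbit \<sigma> (\<rho> 0)"
  proof
    show "{1..n} \<subseteq> orbit \<sigma> (\<rho> 0)"
    proof
      fix k assume k: "k \<in> {1..n}"
      have "(\<sigma> ^^ (\<tau> k + n)) (\<rho> 0) = k" using \<tau>[OF k] by (simp only: \<sigma>_pow) simp
      moreover have "0 < \<tau> k + n" using n by simp
      ultimately show "k \<in> orbit \<sigma> (\<rho> 0)" unfolding orbit_altdef mem_Collect_eq by metis
    qed
    show "orbit \<sigma> (\<rho> 0) \<subseteq> {1..n}" unfolding orbit_altdef using \<sigma>_pow \<rho>_in n
      by (auto simp del: atLeastAtMost_iff)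
  qed
  then have cyc: "cyclic_on \<sigma> {1..n}" unfolding cyclic_on_def using \<rho>_in[of 0] n by auto
  define J where "J k = C (\<tau> k)" for k
  have J: "\<exists>a b. a < b \<and> J k = {a..b}" if "k \<in> {1..n}" for k
    using C[OF \<tau>(1)[OF that]] unfolding J_def by blast
  have ord: "\<forall>x\<in>J k. \<forall>y\<in>J l. x < y" if kl: "k \<in> {1..n}" "l \<in> {1..n}" "k < l" for k l
  proof (intro ballI)
    fix x y assume xy: "x \<in> J k" "y \<in> J l"
    note k = \<tau>[OF kl(1)] and l = \<tau>[OF kl(2)]
    have ne: "\<tau> k \<noteq> \<tau> l" using k(2) l(2) kl(3) by auto
    have "\<not> a (\<tau> l) < a (\<tau> k)" using \<rho>_less[OF k(1), of "\<tau> l"] k(2) l(2) kl(3) by auto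
    then have lt: "a (\<tau> k) < a (\<tau> l)" using a_inj[OF k(1) l(1) ne] by simp
    have "a (\<tau> l) \<notin> C (\<tau> k)" using disj[OF k(1) l(1) ne] C[OF l(1)] by (auto simp: disjoint_iff)
    then have "b (\<tau> k) < a (\<tau> l)" using lt C[OF k(1)] by auto
    then show "x < y" using xy C[OF k(1)] C[OF l(1)] unfolding J_def by auto
  qed
  have stepJ: "\<psi> ` J k \<subseteq> J (\<sigma> k)" if "k \<in> {1..n}" for k
    using step[OF \<tau>(1)[OF that]] \<tau>\<rho>[of "Suc (\<tau> k) mod n"] n unfolding J_def \<sigma>_def by simp
  have "(\<Union>i<n. C i) = (\<Union>k\<in>{1..n}. J k)"
  proof
    show "(\<Union>i<n. C i) \<subseteq> (\<Union>k\<in>{1..n}. J k)"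
      using \<rho>_in \<tau>\<rho> unfolding J_def by (intro UN_least) (metis UN_upper lessThan_iff)
    show "(\<Union>k\<in>{1..n}. J k) \<subseteq> (\<Union>i<n. C i)" unfolding J_def using \<tau>(1) by (intro UN_least) blast
  qed
  then show ?thesis unfolding nonstrictly_periodic_def using n cont J ord cyc stepJ by metis
qed

context basic_cycle
begin

section \<open>Invariance and maximality of \<open>B\<close>\<close>

lemma f_B: "f ` B \<subseteq> B"
proof (rule image_subsetI)
  fix b assume b: "b \<in> B"
  then have bM: "b \<in> M" using B_sub by blast
  show "f b \<in> B"
  proof (rule B_I)
    show "f b \<in> M" using f_M bM by blast
    fix \<epsilon> :: real assume "\<epsilon> > 0"
    moreover have "continuous_on M f" using cont_M[OF order_refl, of 1] by simp
    ultimately obtain d where d: "d > 0" "\<And>y. y \<in> M \<Longrightarrow> dist y b < d \<Longrightarrow> dist (f y) (f b) < \<epsilon>"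
      using bM unfolding continuous_on_iff by blast
    obtain l r \<delta> where lr: "l < r" "{l..r} \<subseteq> M" "{l..r} \<subseteq> {b-d<..<b+d}" "\<delta> > 0" "M \<inter> {b-\<delta><..<b+\<delta>} \<subseteq> {l..r}"
      using nbhd[OF bM d(1)] by metis
    have fl: "full l r" using B_full[OF b lr(2,4,5)] .
    have "continuous_on {l..r} f" using cont_M[OF lr(2), of 1] by simp
    then have "compact (f ` {l..r})" "connected (f ` {l..r})"
      by (auto intro: compact_continuous_image connected_continuous_image)
    then obtain u v where uv: "f ` {l..r} = {u..v}" using connected_compact_interval_1 by blast
    \<comment> \<open>The orbit of the image is the orbit from time 1 on, which is still dense by
      \<open>full_tail\<close>.\<close>
    have "(f ^^ 1) ` orb f {l..r} = orb f {u..v}"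
      unfolding orb_def uv[symmetric] by (simp add: image_UN image_image funpow_swap1)
    then have "full u v" using full_tail[OF fl lr(2), of 1] unfolding full_def cl_def by simp
    moreover have "{u..v} \<subseteq> M" using uv lr(2) f_M by blast
    moreover have "{u..v} \<subseteq> {f b-\<epsilon><..<f b+\<epsilon>}"
    proof -
      have "f y \<in> {f b-\<epsilon><..<f b+\<epsilon>}" if "y \<in> {l..r}" for y
      proof -
        have "y \<in> {b-d<..<b+d}" "y \<in> M" using that lr by blast+
        then have "dist (f y) (f b) < \<epsilon>" by (intro d(2)) (auto simp: dist_real_def abs_less_iff)
        then show ?thesis by (auto simp: dist_real_def abs_less_iff)
      qed
      then show ?thesis unfolding uv[symmetric] by blast
    qed
    ultimately show "\<exists>l r. {l..r} \<subseteq> M \<inter> {f b-\<epsilon><..<f b+\<epsilon>} \<and> full l r" by blast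
  qed
qed

lemma fk_B: "b \<in> B \<Longrightarrow> (f ^^ i) b \<in> B"
  using funpow_mem[OF f_B] .

lemma component_full: "full (lo i) (hi i)"
proof -
  have sub: "{lo i..hi i} \<subseteq> M" using C_sub_M C_Icc by blast
  have "C (i + k) \<subseteq> cl (lo i) (hi i)" for k
  proof (induction k)
    case 0
    show ?case using Icc_sub_cl[of "lo i" "hi i"] C_Icc[of i] by simp
  next
    case (Suc k)
    have "C (i + Suc k) = f ` C (i + k)" by (simp add: C_Suc)
    then show ?case using Suc cl_invariant[OF sub] by blast
  qed
  moreover have "C j = C (i + (j + n * i - i))" for j
  proof -
    have "i \<le> j + n * i" using n1 by (cases n) auto
    then have "i + (j + n * i - i) = j + n * i" by simp
    then show ?thesis using C_mod[of j] C_mod[of "j + n * i"] by (metis mod_mult_self2)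
  qed
  ultimately have "C j \<subseteq> cl (lo i) (hi i)" for j by metis
  then show ?thesis unfolding full_def by (meson in_M_E subsetD subsetI)
qed

lemma B_in_component: "{lo i<..<hi i} \<inter> B \<noteq> {}"
  using full_meets_B_inside[OF lo_hi _ component_full] C_sub_M C_Icc by blast

text \<open>An orbit accumulating on all of \<open>B\<close> enters a component and then stays in
  \<open>M\<close>. It visits an interval near a limit point \<open>x\<close> infinitely often, so
  this interval returns to itself; its orbit closure contains a tail of the orbit and hence
  \<open>B\<close>. Thus \<open>full_of_return\<close> makes the interval full.\<close>

lemma omega_limit_maximal:
  assumes z: "z \<in> {0..1}" "B \<subseteq> omega_limit f z"
  shows "omega_limit f z = B"
proof
  obtain b where b: "b \<in> B" "lo 0 < b" "b < hi 0" using B_in_component[of 0] by auto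
  then obtain j0 where "dist ((f ^^ j0) z) b < min (b - lo 0) (hi 0 - b)"
    using z(2)[THEN subsetD, OF b(1), unfolded omega_limit_iff] by (metis diff_gt_0_iff_gt min_less_iff_conj)
  then have "(f ^^ j0) z \<in> C 0" unfolding C_Icc by (auto simp: dist_real_def abs_less_iff)
  then have "(f ^^ (k + j0)) z \<in> M" for k
    unfolding funpow_add o_apply using fk_in_M C_sub_M by blast
  then have tail: "(f ^^ j) z \<in> M" if "j \<ge> j0" for j using that by (metis le_add_diff_inverse2)
  show "omega_limit f z \<subseteq> B"
  proof
    fix x assume x: "x \<in> omega_limit f z"
    have xM: "x \<in> M" using omega_limit_subset[OF M_compact(2) tail] x by blast
    show "x \<in> B"
    proof (rule B_I[OF xM])
      fix \<epsilon> :: real assume "\<epsilon> > 0"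
      then obtain l r \<delta> where lr: "l < r" "{l..r} \<subseteq> M" "{l..r} \<subseteq> {x-\<epsilon><..<x+\<epsilon>}" "\<delta> > 0" "M \<inter> {x-\<delta><..<x+\<delta>} \<subseteq> {l..r}"
        using nbhd[OF xM] by metis
      have ent: "\<exists>j\<ge>N. (f ^^ j) z \<in> {l..r}" for N
      proof -
        obtain j where j: "j \<ge> max N j0" "dist ((f ^^ j) z) x < \<delta>"
          using x[unfolded omega_limit_iff] lr(4) by blast
        then have "(f ^^ j) z \<in> M \<inter> {x-\<delta><..<x+\<delta>}"
          using tail[of j] by (auto simp: dist_real_def abs_less_iff)
        then have "(f ^^ j) z \<in> {l..r}" using lr(5) by blast
        moreover have "N \<le> j" using j(1) by simp
        ultimately show ?thesis by blast
      qed
      obtain j1 where j1: "(f ^^ j1) z \<in> {l..r}" using ent[of 0] by blast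
      obtain j2 where j2: "j2 \<ge> Suc j1" "(f ^^ j2) z \<in> {l..r}" using ent[of "Suc j1"] by blast
      have "(f ^^ ((j2 - j1) + j1)) z \<in> {l..r}" using j2 by simp
      then have ret: "(f ^^ (j2 - j1)) ((f ^^ j1) z) \<in> {l..r}" by (simp only: funpow_add o_apply)
      have "(f ^^ j) z \<in> cl l r" if "j \<ge> j1" for j
      proof -
        have "(f ^^ (j - j1)) ((f ^^ j1) z) \<in> cl l r"
          using funpow_mem[OF cl_invariant[OF lr(2)]] j1 Icc_sub_cl by blast
        then have "(f ^^ ((j - j1) + j1)) z \<in> cl l r" by (simp only: funpow_add o_apply)
        then show ?thesis using that by simp
      qed
      then have "B \<subseteq> cl l r" using omega_limit_subset[OF cl_closed] z(2) by blast
      then have "full l r" using full_of_return[OF lr(2) _ j1 ret] j2(1) by simp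
      then show "\<exists>l r. {l..r} \<subseteq> M \<inter> {x-\<epsilon><..<x+\<epsilon>} \<and> full l r" using lr by blast
    qed
  qed
qed (use z in blast)

text \<open>Adding the gaps between the components to \<open>B\<close> makes the Cantor function separate them.\<close>

definition Bp :: "real set" where "Bp = B \<union> closure (- M)"

lemma Bp_limpt: "b \<in> Bp \<Longrightarrow> b islimpt Bp"
proof -
  assume "b \<in> Bp"
  then consider "b \<in> B" | "b \<in> - M" | "b islimpt (- M)" unfolding Bp_def closure_def by blast
  then show "b islimpt Bp"
  proof cases
    case 1
    then show ?thesis using B_limpt islimpt_subset unfolding Bp_def by blast
  next
    case 2
    have "open (- M)" using M_compact by auto
    then have "b islimpt (- M)" using 2 by (simp add: interior_limit_point interior_open)
    then show ?thesis unfolding Bp_def by (rule islimpt_subset) (use closure_subset[of "- M"] in blast)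
  next
    case 3
    then show ?thesis unfolding Bp_def by (rule islimpt_subset) (use closure_subset[of "- M"] in blast)
  qed
qed

lemma phi_ex: "\<exists>\<phi> :: real \<Rightarrow> real. mono \<phi> \<and> continuous_on UNIV \<phi> \<and>
    (\<forall>x y. 0 \<le> x \<longrightarrow> x < y \<longrightarrow> y \<le> 1 \<longrightarrow> (\<phi> x < \<phi> y \<longleftrightarrow> Bp \<inter> {x<..<y} \<noteq> {}))"
proof -
  obtain b where "b \<in> B" using B_inf by (metis finite.emptyI ex_in_conv)
  moreover have "b \<in> {- 1<..<2}" using B_sub M_01 \<open>b \<in> B\<close> by force
  ultimately have "Bp \<inter> {- 1<..<2} \<noteq> {}" unfolding Bp_def by blast
  then obtain \<phi> :: "real \<Rightarrow> real" where "mono \<phi>" "continuous_on UNIV \<phi>"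
    "\<And>x y. - 1 \<le> x \<Longrightarrow> x < y \<Longrightarrow> y \<le> 2 \<Longrightarrow> \<phi> x < \<phi> y \<longleftrightarrow> Bp \<inter> {x<..<y} \<noteq> {}"
    using cantor_function[OF Bp_limpt] by blast
  then show ?thesis by (intro exI[of _ \<phi>]) auto
qed

definition \<phi> :: "real \<Rightarrow> real" where
  "\<phi> = (SOME \<phi>. mono \<phi> \<and> continuous_on UNIV \<phi> \<and>
    (\<forall>x y. 0 \<le> x \<longrightarrow> x < y \<longrightarrow> y \<le> 1 \<longrightarrow> (\<phi> x < \<phi> y \<longleftrightarrow> Bp \<inter> {x<..<y} \<noteq> {})))"

lemma phi_mono: "x \<le> y \<Longrightarrow> \<phi> x \<le> \<phi> y" and phi_cont: "continuous_on S \<phi>"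
  and phi_less01: "0 \<le> x \<Longrightarrow> x < y \<Longrightarrow> y \<le> 1 \<Longrightarrow> \<phi> x < \<phi> y \<longleftrightarrow> Bp \<inter> {x<..<y} \<noteq> {}"
  using someI_ex[OF phi_ex] unfolding \<phi>_def[symmetric]
  by (auto simp: mono_def intro: continuous_on_subset)

lemma phi_lessD: "\<phi> x < \<phi> y \<Longrightarrow> x < y"
  using phi_mono[of y x] by (meson not_le)

lemma phi_less:
  assumes "{x..y} \<subseteq> M" "x < y"
  shows "\<phi> x < \<phi> y \<longleftrightarrow> B \<inter> {x<..<y} \<noteq> {}"
proof -
  have "x \<in> M" "y \<in> M" using assms by auto
  then have "0 \<le> x" "y \<le> 1" using M_01 by auto
  moreover have "{x<..<y} \<inter> - M = {}" using assms(1) by (auto simp: subset_iff)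
  then have "{x<..<y} \<inter> closure (- M) = {}" using open_Int_closure_eq_empty[of "{x<..<y}" "- M"] by simp
  then have "Bp \<inter> {x<..<y} = B \<inter> {x<..<y}" unfolding Bp_def by blast
  ultimately show ?thesis using phi_less01 assms(2) by simp
qed

lemma phi_eqD:
  assumes "x \<in> M" "y \<in> M" "x < y" "\<phi> x = \<phi> y"
  shows "{x..y} \<subseteq> M" "{x<..<y} \<inter> B = {}"
proof -
  have "0 \<le> x" "y \<le> 1" using assms(1,2) M_01 by auto
  then have *: "Bp \<inter> {x<..<y} = {}" using phi_less01[OF _ assms(3)] assms(4) by auto
  then show "{x<..<y} \<inter> B = {}" unfolding Bp_def by blast
  show "{x..y} \<subseteq> M"
  proof
    fix z assume z: "z \<in> {x..y}"
    show "z \<in> M"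
    proof (rule ccontr)
      assume "z \<notin> M"
      then have "z \<in> Bp" unfolding Bp_def using closure_subset[of "- M"] by blast
      moreover have "z \<in> {x<..<y}" using z assms(1,2) \<open>z \<notin> M\<close> by (cases "z = x"; cases "z = y") auto
      ultimately show False using * by blast
    qed
  qed
qed

text \<open>Two points of one fibre bound an interval in \<open>M\<close> whose interior misses
  \<open>B\<close>; by \<open>gap_image\<close> no point of \<open>B\<close> lies strictly between
  their images.\<close>

lemma phi_f_less:
  assumes "x \<in> M" "y \<in> M" "x < y" "\<phi> x = \<phi> y"
  shows "\<phi> (f x) = \<phi> (f y)"
proof (rule ccontr)
  assume ne: "\<phi> (f x) \<noteq> \<phi> (f y)"
  note xy = phi_eqD[OF assms]
  have conn: "connected (f ` {x..y})"
    using connected_continuous_image[OF cont_M[OF xy(1), of 1]] by simp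
  have im: "f ` {x..y} \<subseteq> M" using xy(1) f_M by blast
  have sub: "{f u..f v} \<subseteq> M" if "u \<in> {x..y}" "v \<in> {x..y}" for u v
    using connected_contains_Icc[OF conn, of "f u" "f v"] that im by blast
  have contra: False if uv: "u \<in> {x..y}" "v \<in> {x..y}" "\<phi> (f u) < \<phi> (f v)" for u v
  proof -
    obtain b where b: "b \<in> B" "f u < b" "b < f v"
      using phi_less[OF sub[OF uv(1,2)] phi_lessD[OF uv(3)]] uv(3) by auto
    then show False using gap_image[OF xy uv(1,2), of 1 b] by simp
  qed
  have "\<phi> (f x) < \<phi> (f y) \<or> \<phi> (f y) < \<phi> (f x)" using ne by linarith
  then show False using contra[of x y] contra[of y x] assms(3) by auto
qed

lemma phi_f:
  assumes "x \<in> M" "y \<in> M" "\<phi> x = \<phi> y"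
  shows "\<phi> (f x) = \<phi> (f y)"
  using phi_f_less[of x y] phi_f_less[of y x] assms by (metis linorder_neqE_linordered_idom)

section \<open>The quotient map\<close>

definition M' :: "real set" where "M' = \<phi> ` M"

definition g :: "real \<Rightarrow> real" where "g y = \<phi> (f (SOME x. x \<in> M \<and> \<phi> x = y))"

lemma g_phi: "x \<in> M \<Longrightarrow> g (\<phi> x) = \<phi> (f x)"
  unfolding g_def by (rule someI2[of "\<lambda>x'. x' \<in> M \<and> \<phi> x' = \<phi> x" x]) (auto intro: phi_f)

lemma gk_phi: "x \<in> M \<Longrightarrow> (g ^^ i) (\<phi> x) = \<phi> ((f ^^ i) x)"
  by (induction i) (simp_all add: g_phi fk_in_M)

lemma M'_compact: "compact M'"
  unfolding M'_def using compact_continuous_image[OF phi_cont M_compact(1)] .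

lemma g_M': "g ` M' = M'"
proof -
  have "g ` M' = \<phi> ` (f ` M)" unfolding M'_def image_image using g_phi by (intro image_cong) auto
  then show ?thesis by (simp add: f_M M'_def)
qed

text \<open>The graph is the image of the compact set \<open>M\<close> under a continuous map, hence
  closed, and \<open>M'\<close> is compact.\<close>

lemma g_cont: "continuous_on M' g"
proof (rule continuous_from_closed_graph[OF M'_compact])
  show "g \<in> M' \<rightarrow> M'" using g_M' by blast
  have "(\<lambda>x. (x, g x)) ` M' = (\<lambda>x. (\<phi> x, \<phi> (f x))) ` M"
    unfolding M'_def image_image using g_phi by (intro image_cong) auto
  moreover have "continuous_on M (\<phi> \<circ> f)"
    using cont_M[OF order_refl, of 1] by (intro continuous_on_compose phi_cont) simp
  then have "continuous_on M (\<lambda>x. (\<phi> x, \<phi> (f x)))"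
    by (intro continuous_on_Pair phi_cont) (simp add: o_def)
  ultimately show "closed ((\<lambda>x. (x, g x)) ` M')"
    using compact_continuous_image[OF _ M_compact(1)] compact_imp_closed by metis
qed

definition D :: "nat \<Rightarrow> real set" where "D i = \<phi> ` C i"

lemma D_Icc: "D i = {\<phi> (lo i)..\<phi> (hi i)}"
proof
  show "D i \<subseteq> {\<phi> (lo i)..\<phi> (hi i)}" unfolding D_def C_Icc by (auto intro: phi_mono)
  show "{\<phi> (lo i)..\<phi> (hi i)} \<subseteq> D i"
  proof
    fix y assume "y \<in> {\<phi> (lo i)..\<phi> (hi i)}"
    then have "\<exists>x\<in>{lo i..hi i}. \<phi> x = y" using lo_hi[of i] by (intro ivt_Icc phi_cont) auto
    then show "y \<in> D i" unfolding D_def C_Icc by blast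
  qed
qed

lemma D_nondegenerate: "\<phi> (lo i) < \<phi> (hi i)"
  using phi_less[OF _ lo_hi] B_in_component[of i] C_sub_M[of i] C_Icc[of i] by blast

lemma D_disj:
  assumes "i < n" "j < n" "i \<noteq> j"
  shows "D i \<inter> D j = {}"
proof -
  have less: "\<phi> x \<noteq> \<phi> y" if "x \<in> C i" "y \<in> C j" "i < n" "j < n" "i \<noteq> j" "x < y" for x y i j
  proof
    assume "\<phi> x = \<phi> y"
    then have "{x..y} \<subseteq> M" using phi_eqD[of x y] that C_sub_M by blast
    then have "{x..y} \<subseteq> C i" using connected_sub_C[of "{x..y}" x i] that by auto
    moreover have "y \<in> {x..y}" using that by simp
    ultimately show False using disj[of i j] that by blast
  qed
  have "\<phi> x \<noteq> \<phi> y" if xy: "x \<in> C i" "y \<in> C j" for x y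
  proof -
    have "x \<noteq> y" using disj[OF assms] xy by blast
    then consider "x < y" | "y < x" by linarith
    then show ?thesis using less[OF xy assms] less[OF xy(2,1) assms(2,1)] assms(3) by cases auto
  qed
  then show ?thesis unfolding D_def by blast
qed

lemma D_Suc: "g ` D i = D (Suc i)"
proof -
  have "g ` D i = \<phi> ` (f ` C i)" unfolding D_def image_image
    using g_phi C_sub_M by (intro image_cong) auto
  then show ?thesis by (simp add: C_Suc D_def)
qed

lemma D_mod: "D (i mod n) = D i"
  by (simp add: D_def C_mod)

lemma M'_eq: "M' = (\<Union>i<n. D i)"
  unfolding M'_def D_def using C_sub_M by (blast elim: in_M_E)

lemma f_nonstrictly_periodic: "nonstrictly_periodic n M f"
  unfolding M_eq
proof (rule nonstrictly_periodicI[OF n1])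
  show "continuous_on (\<Union>i<n. C i) f" using cont_M[OF order_refl, of 1] M_eq by simp
  show "f ` C i \<subseteq> C (Suc i mod n)" for i by (simp add: C_Suc C_mod)
qed (use C_Icc lo_hi disj in auto)

lemma g_nonstrictly_periodic: "nonstrictly_periodic n M' g"
  unfolding M'_eq
proof (rule nonstrictly_periodicI[OF n1])
  show "continuous_on (\<Union>i<n. D i) g" using g_cont M'_eq by simp
  show "g ` D i \<subseteq> D (Suc i mod n)" for i by (simp add: D_Suc D_mod)
qed (use D_Icc D_nondegenerate D_disj in auto)

text \<open>The nearest point of \<open>B\<close> to the left of \<open>x\<close> in the component
  has no point of \<open>B\<close> between itself and \<open>x\<close>, so it has the same value. If
  there is none on the left, the nearest one on the right is taken.\<close>

lemma B_meets_fibre: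
  assumes "x \<in> C i"
  obtains b where "b \<in> B" "b \<in> C i" "\<phi> b = \<phi> x"
proof (cases "B \<inter> {lo i..x} = {}")
  case False
  have "compact (B \<inter> {lo i..x})" using B_compact by (intro compact_Int_closed) auto
  then obtain p where p: "p \<in> B \<inter> {lo i..x}" "\<And>z. z \<in> B \<inter> {lo i..x} \<Longrightarrow> z \<le> p"
    using compact_attains_sup[OF _ False] by blast
  have pC: "p \<in> C i" "{p..x} \<subseteq> C i" using p(1) assms C_Icc[of i] by auto
  have "\<phi> p = \<phi> x"
  proof (cases "p = x")
    case ne: False
    have "B \<inter> {p<..<x} = {}"
    proof (rule ccontr)
      assume "\<not> ?thesis"
      then obtain z where "z \<in> B" "p < z" "z < x" by auto
      then show False using p(1) p(2)[of z] by auto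
    qed
    then have "\<not> \<phi> p < \<phi> x" using phi_less[of p x] pC C_sub_M ne p(1) by fastforce
    then show ?thesis using phi_mono[of p x] p(1) by auto
  qed simp
  then show ?thesis using that p(1) pC(1) by blast
next
  case True
  then have ne: "B \<inter> {x..hi i} \<noteq> {}" using B_in_component[of i] by fastforce
  have "compact (B \<inter> {x..hi i})" using B_compact by (intro compact_Int_closed) auto
  then obtain q where q: "q \<in> B \<inter> {x..hi i}" "\<And>z. z \<in> B \<inter> {x..hi i} \<Longrightarrow> q \<le> z"
    using compact_attains_inf[OF _ ne] by blast
  have qC: "q \<in> C i" "{x..q} \<subseteq> C i" using q(1) assms C_Icc[of i] by auto
  have "\<phi> x = \<phi> q"
  proof (cases "q = x")
    case ne: False
    have "B \<inter> {x<..<q} = {}"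
    proof (rule ccontr)
      assume "\<not> ?thesis"
      then obtain z where "z \<in> B" "x < z" "z < q" by auto
      then show False using q(1) q(2)[of z] by auto
    qed
    then have "\<not> \<phi> x < \<phi> q" using phi_less[of x q] qC C_sub_M ne q(1) by fastforce
    then show ?thesis using phi_mono[of x q] q(1) by auto
  qed simp
  then show ?thesis using that[OF _ qC(1)] q(1) by simp
qed

lemma B_meets_fibre_M:
  assumes "x \<in> M"
  obtains b where "b \<in> B" "\<phi> b = \<phi> x"
  using assms B_meets_fibre in_M_E by metis

lemma phi_B: "\<phi> ` B = M'"
proof
  show "\<phi> ` B \<subseteq> M'" unfolding M'_def using B_sub by blast
  show "M' \<subseteq> \<phi> ` B" unfolding M'_def using B_meets_fibre_M by (metis image_iff image_subsetI)
qed

lemma fibre_interior: "interior {y \<in> M. \<phi> y = x} \<inter> B = {}"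
proof (rule ccontr)
  assume "\<not> ?thesis"
  then obtain b where b: "b \<in> B" "b \<in> interior {y \<in> M. \<phi> y = x}" by blast
  then obtain e where e: "e > 0" "cball b e \<subseteq> {y \<in> M. \<phi> y = x}" by (meson mem_interior_cball)
  then have sub: "{b-e..b+e} \<subseteq> {y \<in> M. \<phi> y = x}" by (simp add: cball_eq_atLeastAtMost)
  have "b - e \<in> {b-e..b+e}" "b + e \<in> {b-e..b+e}" using e(1) by auto
  then have "\<phi> (b - e) = \<phi> (b + e)" "b - e \<in> M" "b + e \<in> M" using sub by blast+
  then have "{b-e<..<b+e} \<inter> B = {}" using phi_eqD(2)[of "b - e" "b + e"] e(1) by auto
  moreover have "b \<in> {b-e<..<b+e}" using e(1) by simp
  ultimately show False using b(1) by blast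
qed

lemma B_almost_conjugate: "almost_conjugates n \<phi> M f B M' g"
  unfolding almost_conjugates_def
  using f_nonstrictly_periodic g_nonstrictly_periodic phi_mono phi_cont g_phi B_sub B_closed f_B
    phi_B fibre_interior
  by (auto simp: mono_on_def M'_def[symmetric])

text \<open>Fibres of \<open>\<phi>\<close> over \<open>{\<phi> l<..<\<phi> r}\<close> lie inside \<open>{l<..<r}\<close>, so a point can be replaced by
  a point of \<open>B\<close> in its fibre.\<close>

lemma B_hits:
  assumes lr: "{l..r} \<subseteq> M" "\<phi> l < \<phi> r" and uv: "{u..v} \<subseteq> M" "\<phi> u < \<phi> v"
  obtains j s where "j \<ge> N" "s \<in> B" "\<phi> s \<in> {\<phi> l<..<\<phi> r}" "\<phi> ((f ^^ j) s) \<in> {\<phi> u<..<\<phi> v}"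
proof -
  have small: "\<exists>x\<in>B. \<exists>e>0. \<forall>y. \<bar>y - x\<bar> < e \<longrightarrow> \<phi> y \<in> {\<phi> a<..<\<phi> b}" if ab: "{a..b} \<subseteq> M" "\<phi> a < \<phi> b" for a b
  proof -
    define w where "w = (\<phi> a + \<phi> b) / 2"
    have w: "\<phi> a < w" "w < \<phi> b" using ab by (auto simp: w_def)
    have "\<exists>x\<in>{a..b}. \<phi> x = w" using phi_lessD[OF ab(2)] w by (intro ivt_Icc phi_cont) auto
    then obtain x where x: "x \<in> B" "\<phi> x = w" using B_meets_fibre_M ab(1) by (metis subsetD)
    have "open (\<phi> -` {\<phi> a<..<\<phi> b})" by (rule open_vimage[OF open_greaterThanLessThan phi_cont])
    moreover have "x \<in> \<phi> -` {\<phi> a<..<\<phi> b}" using x w by simp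
    ultimately obtain e where "e > 0" "ball x e \<subseteq> \<phi> -` {\<phi> a<..<\<phi> b}" using open_contains_ball by metis
    then show ?thesis using x(1) by (intro bexI[of _ x] exI[of _ e]) (auto simp: ball_def dist_real_def abs_minus_commute subset_iff)
  qed
  obtain x e where x: "x \<in> B" "e > 0" "\<And>y. \<bar>y - x\<bar> < e \<Longrightarrow> \<phi> y \<in> {\<phi> l<..<\<phi> r}" using small[OF lr] by metis
  obtain y d where y: "y \<in> B" "d > 0" "\<And>z. \<bar>z - y\<bar> < d \<Longrightarrow> \<phi> z \<in> {\<phi> u<..<\<phi> v}" using small[OF uv] by metis
  obtain p q \<delta> where pq: "{p..q} \<subseteq> M" "{p..q} \<subseteq> {x-e<..<x+e}" "\<delta> > 0" "M \<inter> {x-\<delta><..<x+\<delta>} \<subseteq> {p..q}"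
    using nbhd[of x e] x(1,2) B_sub by (metis subsetD)
  have "full p q" using B_full[OF x(1) pq(1,3,4)] .
  moreover have "{y-d<..<y+d} \<inter> M \<noteq> {}" using y(1,2) B_sub by force
  ultimately obtain j t where t: "j \<ge> N" "t \<in> {p..q}" "(f ^^ j) t \<in> {y-d<..<y+d}"
    using full_hit[OF _ pq(1), of "y - d" "y + d" N] by blast
  have tM: "t \<in> M" and "t \<in> {x-e<..<x+e}" using t(2) pq by blast+
  then have t1: "\<phi> t \<in> {\<phi> l<..<\<phi> r}" by (intro x(3)) (auto simp: abs_less_iff)
  have t2: "\<phi> ((f ^^ j) t) \<in> {\<phi> u<..<\<phi> v}" by (rule y(3)) (use t(3) in \<open>auto simp: abs_less_iff\<close>)
  obtain s where s: "s \<in> B" "\<phi> s = \<phi> t" using B_meets_fibre_M[OF tM] by blast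
  have "\<phi> ((f ^^ j) s) = \<phi> ((f ^^ j) t)" using gk_phi[of s j] gk_phi[OF tM, of j] s B_sub by (metis subsetD)
  then show ?thesis using that[OF t(1) s(1)] s(2) t1 t2 by simp
qed

lemma B_near_interval:
  assumes "b \<in> B" "\<epsilon> > 0"
  obtains l r where "{l..r} \<subseteq> M" "\<phi> l < \<phi> r" "{l..r} \<subseteq> {b-\<epsilon><..<b+\<epsilon>}"
proof -
  obtain l r \<delta> where lr: "l < r" "{l..r} \<subseteq> M" "{l..r} \<subseteq> {b-\<epsilon><..<b+\<epsilon>}" "\<delta> > 0" "M \<inter> {b-\<delta><..<b+\<delta>} \<subseteq> {l..r}"
    using nbhd[of b \<epsilon>] assms B_sub by (metis subsetD)
  have "full l r" using B_full[OF assms(1) lr(2,4,5)] .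
  then have "\<phi> l < \<phi> r" using phi_less[OF lr(2,1)] full_meets_B_inside[OF lr(1,2)] by blast
  then show ?thesis using that lr by blast
qed

lemma phi_inside:
  assumes "{l..r} \<subseteq> {x-e<..<x+e}" "\<phi> s \<in> {\<phi> l<..<\<phi> r}"
  shows "\<bar>s - x\<bar> < e"
proof -
  have "s \<in> {l..r}" using phi_lessD[of l s] phi_lessD[of s r] assms(2) by auto
  then have "s \<in> {x-e<..<x+e}" using assms(1) by blast
  then show ?thesis by (auto simp: abs_less_iff)
qed

text \<open>Baire's theorem in \<open>B\<close>, for the countably many sets of points that visit a
  given rational interval at some time \<open>\<ge> N\<close>. Letting \<open>N\<close> vary forces
  infinitely many visits, so that the limit set and not merely the orbit closure is
  \<open>B\<close>.\<close>

lemma B_transitive_point: "\<exists>x\<in>B. omega_limit f x = B"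
proof -
  define T where "T p r N = {x \<in> B. \<exists>j\<ge>N. (f ^^ j) x \<in> {p<..<r}}" for p r and N :: nat
  define \<G> where "\<G> = (\<lambda>(p, r, N). T p r N) ` {(p, r, N). p \<in> \<rat> \<and> r \<in> \<rat> \<and> B \<inter> {p<..<r} \<noteq> {} \<and> N \<in> (UNIV :: nat set)}"
  have "countable ((\<rat> :: real set) \<times> (\<rat> :: real set) \<times> (UNIV :: nat set))"
    by (intro countable_SIGMA countable_rat) auto
  then have "countable \<G>" unfolding \<G>_def
    by (intro countable_image) (rule countable_subset, auto)
  moreover have "openin (top_of_set B) S \<and> B \<subseteq> closure S" if "S \<in> \<G>" for S
  proof -
    obtain p r N where S: "S = T p r N" and pr: "B \<inter> {p<..<r} \<noteq> {}" using \<open>S \<in> \<G>\<close> unfolding \<G>_def by auto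
    have "S = (\<Union>j\<in>{N..}. B \<inter> (f ^^ j) -` {p<..<r})" unfolding S T_def by auto
    moreover have "openin (top_of_set B) (B \<inter> (f ^^ j) -` {p<..<r})" for j
      by (rule continuous_openin_preimage_gen[OF cont_M[OF B_sub]]) simp
    ultimately have op: "openin (top_of_set B) S" by (simp only:) (blast intro: openin_Union)
    have "B \<subseteq> closure S"
    proof
      fix b assume b: "b \<in> B"
      show "b \<in> closure S" unfolding closure_approachable
      proof (intro allI impI)
        fix e :: real assume e: "e > 0"
        obtain l r' where lr: "{l..r'} \<subseteq> M" "\<phi> l < \<phi> r'" "{l..r'} \<subseteq> {b-e<..<b+e}"
          using B_near_interval[OF b e] by blast
        obtain c where c: "c \<in> B" "p < c" "c < r" using pr by auto
        define d where "d = min (c - p) (r - c)"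
        have "d > 0" using c by (simp add: d_def)
        then obtain u v where uv: "{u..v} \<subseteq> M" "\<phi> u < \<phi> v" "{u..v} \<subseteq> {c-d<..<c+d}"
          using B_near_interval[OF c(1)] by blast
        obtain j s where s: "j \<ge> N" "s \<in> B" "\<phi> s \<in> {\<phi> l<..<\<phi> r'}" "\<phi> ((f ^^ j) s) \<in> {\<phi> u<..<\<phi> v}"
          using B_hits[OF lr(1,2) uv(1,2)] by blast
        have "\<bar>s - b\<bar> < e" using phi_inside[OF lr(3) s(3)] .
        moreover have "\<bar>(f ^^ j) s - c\<bar> < d" using phi_inside[OF uv(3) s(4)] .
        then have "(f ^^ j) s \<in> {p<..<r}" by (auto simp: d_def abs_less_iff)
        then have "s \<in> S" unfolding S T_def using s(1,2) by blast
        ultimately show "\<exists>y\<in>S. dist y b < e" by (auto simp: dist_real_def)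
      qed
    qed
    then show ?thesis using op by blast
  qed
  ultimately have dense: "B \<subseteq> closure (\<Inter>\<G>)" using Baire[OF B_closed] by blast
  obtain b0 where b0: "b0 \<in> B" using B_inf by (metis finite.emptyI ex_in_conv)
  then have "\<Inter>\<G> \<noteq> {}" using dense by (metis closure_empty empty_iff subsetD)
  then obtain x where x: "x \<in> \<Inter>\<G>" by blast
  have TG: "T p r N \<in> \<G>" if "p \<in> \<rat>" "r \<in> \<rat>" "B \<inter> {p<..<r} \<noteq> {}" for p r N
    unfolding \<G>_def using that by force
  have "0 \<le> b0" "b0 \<le> 1" using b0 B_sub M_01 by force+
  then have "B \<inter> {- 1<..<2} \<noteq> {}" using b0 by force
  then have "x \<in> T (- 1) 2 0" using TG[of "- 1" 2 0] x by auto
  then have xB: "x \<in> B" unfolding T_def by blast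
  have "y \<in> omega_limit f x" if y: "y \<in> B" for y
    unfolding omega_limit_iff
  proof (intro allI impI)
    fix e :: real and N :: nat assume "e > 0"
    then obtain p r where pr: "p \<in> \<rat>" "r \<in> \<rat>" "y - e < p" "p < y" "y < r" "r < y + e"
      using Rats_dense_in_real[of "y - e" y] Rats_dense_in_real[of y "y + e"] by auto
    then have "y \<in> B \<inter> {p<..<r}" using y by simp
    then have "T p r N \<in> \<G>" using TG pr(1,2) by blast
    then have "x \<in> T p r N" using x by blast
    then obtain j where "j \<ge> N" "(f ^^ j) x \<in> {p<..<r}" unfolding T_def by blast
    then show "\<exists>j\<ge>N. dist ((f ^^ j) x) y < e" using pr
      by (intro exI[of _ j]) (auto simp: dist_real_def abs_less_iff)
  qed
  moreover have "omega_limit f x \<subseteq> B" using omega_limit_subset[OF B_closed, of 0 f x] fk_B[OF xB] by blast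
  ultimately show ?thesis using xB by blast
qed

lemma B_transitive: "transitive_on B f"
  unfolding transitive_on_def compact_system_def
  using B_transitive_point B_compact cont_M[OF B_sub, of 1] f_B by simp

text \<open>From time 1 on, the orbit with limit set \<open>B\<close> lies in the compact image of
  \<open>B\<close>, which therefore contains that limit set.\<close>

lemma f_B_eq: "f ` B = B"
proof
  obtain x where x: "x \<in> B" "omega_limit f x = B" using B_transitive_point by blast
  have "compact (f ` B)" using compact_continuous_image[OF cont_M[OF B_sub, of 1] B_compact] by simp
  then have "closed (f ` B)" by (rule compact_imp_closed)
  moreover have "(f ^^ j) x \<in> f ` B" if "j \<ge> 1" for j
    using that fk_B[OF x(1), of "j - 1"] by (cases j) auto
  ultimately show "B \<subseteq> f ` B" using omega_limit_subset[of "f ` B" 1 f x] x(2) by blast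
qed (rule f_B)

lemma g_transitive: "transitive_on M' g"
proof -
  obtain x where x: "x \<in> B" "omega_limit f x = B" using B_transitive_point by blast
  then have xM: "x \<in> M" using B_sub by blast
  have "omega_limit g (\<phi> x) \<subseteq> M'"
    using omega_limit_subset[of M' 0 g "\<phi> x"] M'_compact compact_imp_closed gk_phi[OF xM] fk_in_M[OF xM]
    unfolding M'_def by auto
  moreover have "M' \<subseteq> omega_limit g (\<phi> x)"
  proof
    fix y assume "y \<in> M'"
    then obtain b where b: "b \<in> B" "y = \<phi> b" using phi_B by blast
    then obtain r where r: "strict_mono r" "(\<lambda>m. (f ^^ r m) x) \<longlonglongrightarrow> b"
      using x(2) unfolding omega_limit_def by blast
    have "isCont \<phi> b" using phi_cont[of UNIV] by (simp add: continuous_on_eq_continuous_at)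
    then have "(\<lambda>m. \<phi> ((f ^^ r m) x)) \<longlonglongrightarrow> \<phi> b" using r(2) isCont_tendsto_compose by blast
    then have "(\<lambda>m. (g ^^ r m) (\<phi> x)) \<longlonglongrightarrow> y" using b(2) gk_phi[OF xM] by simp
    then show "y \<in> omega_limit g (\<phi> x)" using r(1) unfolding omega_limit_def by blast
  qed
  moreover have "\<phi> x \<in> M'" using xM by (simp add: M'_def)
  ultimately show ?thesis unfolding transitive_on_def compact_system_def
    using M'_compact g_cont g_M' by blast
qed

text \<open>An iterate \<open>z\<close> of the transitive point near \<open>b\<close> returns
  arbitrarily close to itself, which \<open>no_periodic_no_recurrence\<close> forbids in an interval
  without periodic points. The interval is taken in \<open>{0..1}\<close> since \<open>B\<close> may
  contain none.\<close>

lemma B_periodic: "B \<subseteq> closure (Per f)"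
proof
  fix b assume b: "b \<in> B"
  obtain x where x: "x \<in> B" "omega_limit f x = B" using B_transitive_point by blast
  have near: "\<exists>j\<ge>N. \<bar>(f ^^ j) x - y\<bar> < e" if "y \<in> B" "e > 0" for y e N
    using that x(2) omega_limit_iff[of y f x] by (auto simp: dist_real_def)
  show "b \<in> closure (Per f)" unfolding closure_approachable
  proof (intro allI impI)
    fix e :: real assume e: "e > 0"
    define J where "J = {b-e<..<b+e} \<inter> {0..1}"
    have "is_interval J" unfolding J_def is_interval_1 by auto
    have "\<exists>t\<in>J. \<exists>k\<ge>1. (f ^^ k) t = t"
    proof (rule ccontr)
      assume "\<not> ?thesis"
      then have np: "\<And>t k. t \<in> J \<Longrightarrow> k \<ge> 1 \<Longrightarrow> (f ^^ k) t \<noteq> t" by blast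
      obtain i where i: "\<bar>(f ^^ i) x - b\<bar> < e" using near[OF b e] by blast
      define z where "z = (f ^^ i) x"
      have zk: "(f ^^ k) z = (f ^^ (k + i)) x" for k by (simp add: z_def funpow_add)
      have in01: "(f ^^ k) z \<in> {0..1}" for k
        using zk fk_B[OF x(1)] B_sub M_01 by (metis subsetD)
      have "z \<in> B" using fk_B[OF x(1)] by (simp add: z_def)
      then have ret: "\<exists>k\<ge>N. \<bar>(f ^^ k) z - z\<bar> < d" if d: "d > 0" for N d
      proof -
        obtain j where "j \<ge> N + i" "\<bar>(f ^^ j) x - z\<bar> < d" using near[OF \<open>z \<in> B\<close> d] by blast
        then show ?thesis using zk[of "j - i"] by (intro exI[of _ "j - i"]) auto
      qed
      define d where "d = e - \<bar>z - b\<bar>"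
      have d: "d > 0" using i by (simp add: d_def z_def)
      have zJ: "z \<in> J" using i in01[of 0] by (auto simp: J_def z_def abs_less_iff)
      have inJ: "(f ^^ k) z \<in> J" if "\<bar>(f ^^ k) z - z\<bar> < d" for k
      proof -
        have "\<bar>(f ^^ k) z - b\<bar> < e" using that unfolding d_def by linarith
        then show ?thesis using in01[of k] by (auto simp: J_def abs_less_iff)
      qed
      obtain m where m: "m \<ge> 1" "\<bar>(f ^^ m) z - z\<bar> < d" using ret[OF d] by blast
      have "0 < \<bar>(f ^^ m) z - z\<bar>" using np[OF zJ m(1)] by simp
      then obtain k where k: "k \<ge> Suc m" "\<bar>(f ^^ k) z - z\<bar> < \<bar>(f ^^ m) z - z\<bar>" using ret by blast
      have "\<bar>(f ^^ m) z - z\<bar> \<le> \<bar>(f ^^ k) z - z\<bar>"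
        by (rule no_periodic_no_recurrence[OF cont01 map01 \<open>is_interval J\<close> _ np zJ inJ[OF m(2)] inJ])
           (use m k J_def in auto)
      then show False using k(2) by simp
    qed
    then obtain t k where "t \<in> J" "k \<ge> 1" "(f ^^ k) t = t" by blast
    then show "\<exists>y\<in>Per f. dist y b < e" unfolding Per_def J_def
      by (intro bexI[of _ t]) (auto simp: dist_real_def abs_less_iff)
  qed
qed

section \<open>The return map on a component\<close>

abbreviation "la \<equiv> \<phi> (lo 0)"
abbreviation "lb \<equiv> \<phi> (hi 0)"

lemma C_disj_mod: "x \<in> C i \<Longrightarrow> x \<in> C j \<Longrightarrow> i mod n = j mod n"
  using disj[of "i mod n" "j mod n"] C_mod n1 by (metis disjoint_iff mod_less_divisor less_le_trans zero_less_one)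

lemma D_disj_mod: "x \<in> D i \<Longrightarrow> x \<in> D j \<Longrightarrow> i mod n = j mod n"
  using D_disj[of "i mod n" "j mod n"] D_mod n1 by (metis disjoint_iff mod_less_divisor less_le_trans zero_less_one)

lemma D_sub_M': "D i \<subseteq> M'"
  unfolding D_def M'_def using C_sub_M by blast

lemma D_funpow: "(g ^^ k) ` D i = D (k + i)"
proof (induction k)
  case (Suc k)
  have "(g ^^ Suc k) ` D i = g ` ((g ^^ k) ` D i)" by (simp add: image_comp)
  then show ?case using Suc D_Suc by simp
qed simp

lemma gk_cont: "S \<subseteq> M' \<Longrightarrow> continuous_on S (g ^^ k)"
  using continuous_on_subset[OF continuous_on_funpow[OF g_cont]] g_M' by blast

lemma C0: "C 0 = I"
  by (simp add: C_def)

lemma Dn: "(g ^^ n) ` D 0 = D 0" and Cn: "(f ^^ n) ` C 0 = C 0"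
  using D_funpow[of n 0] D_mod[of n] C_funpow[of n 0] C_mod[of n] by simp_all

lemma phi_surj_C0:
  assumes "y \<in> {la..lb}"
  obtains x where "x \<in> C 0" "\<phi> x = y"
proof -
  have "y \<in> D 0" using assms by (simp add: D_Icc)
  then show ?thesis using that unfolding D_def by (elim imageE) simp
qed

lemma Icc_sub_M: "x \<in> C i \<Longrightarrow> y \<in> C i \<Longrightarrow> {x..y} \<subseteq> M"
  using C_sub_M[of i] unfolding C_Icc[of i] by auto

text \<open>\<open>B_hits\<close> gives a hit at some time \<open>j\<close>. As the sets
  \<open>D i\<close> are disjoint and passed through cyclically, a hit from \<open>D 0\<close> to
  \<open>D 0\<close> forces \<open>n\<close> to divide \<open>j\<close>.\<close>

lemma g_itrans: "itrans la lb (g ^^ n)"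
  unfolding itrans_def
proof (intro conjI allI impI)
  show "la < lb" by (rule D_nondegenerate)
  show "continuous_on {la..lb} (g ^^ n)" using gk_cont[OF D_sub_M', of 0] D_Icc by simp
  show "(g ^^ n) ` {la..lb} = {la..lb}" using Dn D_Icc by simp
  fix x y u v assume h: "la \<le> x" "x < y" "y \<le> lb" "la \<le> u" "u < v" "v \<le> lb"
  have "x \<in> {la..lb}" "y \<in> {la..lb}" "u \<in> {la..lb}" "v \<in> {la..lb}" using h by auto
  then obtain x' y' u' v' where xy: "x' \<in> C 0" "\<phi> x' = x" "y' \<in> C 0" "\<phi> y' = y"
      "u' \<in> C 0" "\<phi> u' = u" "v' \<in> C 0" "\<phi> v' = v"
    by (metis phi_surj_C0)
  obtain j s where s: "s \<in> B" "\<phi> s \<in> {x<..<y}" "\<phi> ((f ^^ j) s) \<in> {u<..<v}"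
    using B_hits[OF Icc_sub_M[OF xy(1,3)] _ Icc_sub_M[OF xy(5,7)]] h xy by metis
  have gj: "(g ^^ j) (\<phi> s) = \<phi> ((f ^^ j) s)" using gk_phi s(1) B_sub by blast
  have "\<phi> s \<in> D 0" "\<phi> ((f ^^ j) s) \<in> D 0" using s h D_Icc[of 0] by auto
  then have "(g ^^ j) (\<phi> s) \<in> D j" using D_funpow[of j 0] by auto
  then have "j mod n = 0 mod n" using D_disj_mod \<open>\<phi> ((f ^^ j) s) \<in> D 0\<close> gj by metis
  then obtain m where "j = n * m" by auto
  then have "((g ^^ n) ^^ m) (\<phi> s) \<in> {u<..<v}" using gj s(3) by (simp add: funpow_mult mult.commute)
  then show "\<exists>i. \<exists>s\<in>{x<..<y}. ((g ^^ n) ^^ i) s \<in> {u<..<v}" using s(2) by blast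
qed

text \<open>A finite connected image is a point, and then \<open>g ^^ n\<close> would collapse the
  interval too. The finite set \<open>F\<close> allows exceptional values to be avoided, such as the
  splitting point and the ends of \<open>D 0\<close>.\<close>

lemma g_no_collapse:
  assumes "la \<le> x" "x < y" "y \<le> lb" "i \<le> n" "finite F"
  obtains w where "w \<in> {x<..<y}" "(g ^^ i) w \<notin> F"
proof -
  have sub: "{x<..<y} \<subseteq> D 0" unfolding D_Icc using assms(1,3) by (intro subsetI) simp
  have conn: "connected ((g ^^ i) ` {x<..<y})"
    by (rule connected_continuous_image[OF gk_cont[OF subset_trans[OF sub D_sub_M']]]) simp
  have "\<not> (g ^^ i) ` {x<..<y} \<subseteq> F"
  proof
    assume "(g ^^ i) ` {x<..<y} \<subseteq> F"
    then have "finite ((g ^^ i) ` {x<..<y})" using assms(5) finite_subset by blast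
    then obtain w where w: "(g ^^ i) ` {x<..<y} \<subseteq> {w}"
      using conn connected_finite_iff_sing by (metis empty_subsetI order_refl)
    have "(g ^^ n) ` {x<..<y} \<subseteq> {(g ^^ (n - i)) w}"
    proof (rule image_subsetI)
      fix t assume "t \<in> {x<..<y}"
      then have "(g ^^ i) t = w" using w by blast
      moreover have "(g ^^ ((n - i) + i)) t = (g ^^ (n - i)) ((g ^^ i) t)" by (simp only: funpow_add o_apply)
      ultimately show "(g ^^ n) t \<in> {(g ^^ (n - i)) w}" using assms(4) by simp
    qed
    then show False using itrans_no_collapse[OF g_itrans assms(1-3), of 1] by auto
  qed
  then show ?thesis using that by blast
qed

lemma B_between:
  assumes "{l..r} \<subseteq> M" "w \<in> {\<phi> l<..<\<phi> r}"
  obtains y where "y \<in> B" "\<phi> y = w" "l < y" "y < r"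
proof -
  have "\<phi> l < \<phi> r" using assms(2) by auto
  then have "\<exists>x\<in>{l..r}. \<phi> x = w" using phi_lessD[of l r] assms(2) by (intro ivt_Icc phi_cont) auto
  then obtain y where y: "y \<in> B" "\<phi> y = w" using B_meets_fibre_M assms(1) by (metis subsetD)
  then show ?thesis using that phi_lessD[of l y] phi_lessD[of y r] assms(2) by auto
qed

lemma phi_in_D0: "x \<in> M \<Longrightarrow> \<phi> x \<in> {la..lb} \<longleftrightarrow> x \<in> C 0"
proof
  assume "x \<in> M" "\<phi> x \<in> {la..lb}"
  then obtain i where i: "i < n" "x \<in> C i" by (metis in_M_E)
  then have "\<phi> x \<in> D i" "\<phi> x \<in> D 0" using \<open>\<phi> x \<in> {la..lb}\<close> D_Icc unfolding D_def by blast+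
  then have "i mod n = 0 mod n" by (rule D_disj_mod)
  then show "x \<in> C 0" using i by simp
next
  assume "x \<in> C 0"
  then show "\<phi> x \<in> {la..lb}" using D_Icc[of 0] unfolding D_def by blast
qed

lemma fi_B: "(f ^^ i) ` (B \<inter> C 0) = B \<inter> C i"
proof
  show "(f ^^ i) ` (B \<inter> C 0) \<subseteq> B \<inter> C i" using fk_B C_funpow[of i 0] by auto
  show "B \<inter> C i \<subseteq> (f ^^ i) ` (B \<inter> C 0)"
  proof
    fix b assume b: "b \<in> B \<inter> C i"
    then obtain b' where b': "b' \<in> B" "b = (f ^^ i) b'" using funpow_image_eq[OF f_B_eq, of i] by blast
    then obtain j where j: "j < n" "b' \<in> C j" using B_sub by (metis in_M_E subsetD)
    then have "b \<in> C (i + j)" using C_funpow[of i j] b' by blast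
    then have "(i + j) mod n = i mod n" using C_disj_mod b by blast
    then have "n dvd (i + j) - i" using mod_eq_dvd_iff_nat[of i "i + j" n] by simp
    then have "j = 0" using j(1) by (cases j) (auto dest: dvd_imp_le)
    then show "b \<in> (f ^^ i) ` (B \<inter> C 0)" using j b' by auto
  qed
qed

definition part :: "real \<Rightarrow> real \<Rightarrow> real set" where
  "part x y = closure {z \<in> B. \<phi> z \<in> {x<..<y}}"

lemma part_sub: "part x y \<subseteq> B \<inter> {z. x \<le> \<phi> z \<and> \<phi> z \<le> y}"
proof -
  have "closed {z. x \<le> \<phi> z \<and> \<phi> z \<le> y}"
    by (intro closed_Collect_conj closed_Collect_le continuous_on_const phi_cont)
  then show ?thesis unfolding part_def using B_closed by (intro closure_minimal closed_Int) auto
qed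

lemma part_closed: "closed (part x y)"
  by (simp add: part_def)

lemma part_compact: "compact (part x y)"
  by (metis part_closed part_sub B_compact compact_Int_closed inf.absorb_iff2 le_inf_iff)

lemma near_part:
  assumes "b \<in> B" "\<epsilon> > 0"
  obtains l r where "l < r" "{l..r} \<subseteq> M" "\<phi> l < \<phi> r" "b - \<epsilon> < l" "r < b + \<epsilon>" "b \<in> C i \<longrightarrow> {l..r} \<subseteq> C i"
proof -
  obtain l r \<delta> where lr: "l < r" "l \<le> b" "b \<le> r" "{l..r} \<subseteq> M" "{l..r} \<subseteq> {b-\<epsilon><..<b+\<epsilon>}" "\<delta> > 0" "M \<inter> {b-\<delta><..<b+\<delta>} \<subseteq> {l..r}"
    using nbhd[of b \<epsilon>] assms B_sub by (metis subsetD)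
  have "full l r" using B_full[OF assms(1) lr(4,6,7)] .
  then have "\<phi> l < \<phi> r" using phi_less[OF lr(4,1)] full_meets_B_inside[OF lr(1,4)] by blast
  moreover have "b - \<epsilon> < l" "r < b + \<epsilon>"
    using lr(1,5) by (metis atLeastAtMost_iff greaterThanLessThan_iff less_imp_le order_refl subsetD)+
  moreover have "{l..r} \<subseteq> C i" if "b \<in> C i" using connected_sub_C[of "{l..r}" b i] lr that by auto
  ultimately show ?thesis using that lr by blast
qed

text \<open>Since \<open>g ^^ i\<close> collapses no interval, the points of \<open>B\<close> over
  \<open>{x<..<y}\<close> whose image value avoids \<open>F\<close> are dense in the part, and
  continuity of \<open>f ^^ i\<close> carries the closure along.\<close>

lemma part_push:
  assumes xy: "la \<le> x" "x < y" "y \<le> lb" "i \<le> n" "finite F"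
  shows "(f ^^ i) ` part x y \<subseteq> closure {z \<in> B. \<phi> z \<in> (g ^^ i) ` {x<..<y} - F}"
proof -
  define S where "S = {z \<in> B. \<phi> z \<in> {x<..<y}}"
  define S' where "S' = {z \<in> S. (g ^^ i) (\<phi> z) \<notin> F}"
  have "S \<subseteq> closure S'"
  proof
    fix z assume z: "z \<in> S"
    show "z \<in> closure S'" unfolding closure_approachable
    proof (intro allI impI)
      fix e :: real assume e: "e > 0"
      have "open (\<phi> -` {x<..<y})" by (rule open_vimage[OF open_greaterThanLessThan phi_cont])
      moreover have "z \<in> \<phi> -` {x<..<y}" using z by (simp add: S_def)
      ultimately obtain d where d: "d > 0" "ball z d \<subseteq> \<phi> -` {x<..<y}" using open_contains_ball by metis
      have zB: "z \<in> B" and "min e d > 0" using z e d by (auto simp: S_def)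
      then obtain l r where lr: "l < r" "{l..r} \<subseteq> M" "\<phi> l < \<phi> r" "z - min e d < l" "r < z + min e d"
        by (rule near_part)
      have "l \<in> ball z d" "r \<in> ball z d" using lr by (auto simp: dist_real_def)
      then have "x < \<phi> l" "\<phi> r < y" using d(2) by auto
      then obtain w where w: "w \<in> {\<phi> l<..<\<phi> r}" "(g ^^ i) w \<notin> F"
        using g_no_collapse[of "\<phi> l" "\<phi> r" i F] lr(3) xy by (metis less_imp_le order_trans)
      obtain t where t: "t \<in> B" "\<phi> t = w" "l < t" "t < r" using B_between[OF lr(2) w(1)] .
      then have "t \<in> S'" using w \<open>x < \<phi> l\<close> \<open>\<phi> r < y\<close> unfolding S'_def S_def by auto
      moreover have "dist t z < e" using t lr by (auto simp: dist_real_def)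
      ultimately show "\<exists>t\<in>S'. dist t z < e" by blast
    qed
  qed
  then have "part x y \<subseteq> closure S'" unfolding part_def S_def[symmetric] by (simp add: closure_minimal)
  moreover have "(f ^^ i) ` closure S' \<subseteq> closure ((f ^^ i) ` S')"
  proof (rule image_closure_subset)
    have "closure S' \<subseteq> B" using B_closed by (intro closure_minimal) (auto simp: S'_def S_def)
    then show "continuous_on (closure S') (f ^^ i)" using cont_M B_sub by blast
  qed (rule closed_closure, rule closure_subset)
  moreover have "(f ^^ i) ` S' \<subseteq> {z \<in> B. \<phi> z \<in> (g ^^ i) ` {x<..<y} - F}"
  proof (rule image_subsetI)
    fix z assume z: "z \<in> S'"
    then have zB: "z \<in> B" by (simp add: S'_def S_def)
    have "\<phi> ((f ^^ i) z) = (g ^^ i) (\<phi> z)" using gk_phi zB B_sub by (metis subsetD)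
    then show "(f ^^ i) z \<in> {z \<in> B. \<phi> z \<in> (g ^^ i) ` {x<..<y} - F}"
      using z fk_B[OF zB] unfolding S'_def S_def by auto
  qed
  ultimately show ?thesis using closure_mono by blast
qed

lemma part_image:
  assumes "la \<le> x" "x < y" "y \<le> lb"
  shows "\<phi> ` part x y = {x..y}"
proof
  show "\<phi> ` part x y \<subseteq> {x..y}" using part_sub[of x y] by fastforce
  have "{x<..<y} \<subseteq> \<phi> ` part x y"
  proof
    fix w assume w: "w \<in> {x<..<y}"
    then have "w \<in> M'" using D_sub_M'[of 0] D_Icc[of 0] assms by auto
    then have "w \<in> \<phi> ` B" by (simp add: phi_B)
    then obtain b where b: "b \<in> B" "w = \<phi> b" by (rule imageE)
    then have "b \<in> part x y" unfolding part_def using w by (intro closure_subset[THEN subsetD]) simp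
    then show "w \<in> \<phi> ` part x y" using b(2) by simp
  qed
  moreover have "closed (\<phi> ` part x y)"
    using compact_continuous_image[OF phi_cont part_compact] compact_imp_closed by blast
  ultimately have "closure {x<..<y} \<subseteq> \<phi> ` part x y" by (simp add: closure_minimal)
  then show "{x..y} \<subseteq> \<phi> ` part x y" using assms by simp
qed

text \<open>The right side depends on \<open>s\<close> only through \<open>\<phi> s\<close>. So the
  set prescribed for \<open>J = {lo 0..s}\<close> does not change while \<open>s\<close> varies in
  one fibre, and \<open>s\<close> can be chosen there to make \<open>J\<close> invariant.\<close>

lemma part_eq_interior:
  assumes ls: "lo 0 < s" "s \<le> hi 0"
  shows "closure (interior {lo 0..s} \<inter> B) = part la (\<phi> s)"
proof
  show "closure (interior {lo 0..s} \<inter> B) \<subseteq> part la (\<phi> s)"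
  proof (rule closure_minimal[OF _ part_closed])
    show "interior {lo 0..s} \<inter> B \<subseteq> part la (\<phi> s)"
    proof
      fix z assume "z \<in> interior {lo 0..s} \<inter> B"
      then have z: "z \<in> B" "lo 0 < z" "z < s" by auto
      show "z \<in> part la (\<phi> s)" unfolding part_def closure_approachable
      proof (intro allI impI)
        fix e :: real assume "e > 0"
        then have "min e (min (z - lo 0) (s - z)) > 0" using z by simp
        then obtain l r where lr: "l < r" "{l..r} \<subseteq> M" "\<phi> l < \<phi> r"
            "z - min e (min (z - lo 0) (s - z)) < l" "r < z + min e (min (z - lo 0) (s - z))"
          by (rule near_part[OF z(1)])
        have lr': "lo 0 \<le> l" "r \<le> s" "z - e < l" "r < z + e" using lr(4,5) by auto
        have "(\<phi> l + \<phi> r) / 2 \<in> {\<phi> l<..<\<phi> r}" using lr(3) by auto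
        then obtain t where t: "t \<in> B" "\<phi> t = (\<phi> l + \<phi> r) / 2" "l < t" "t < r"
          using B_between[OF lr(2)] by blast
        have "la \<le> \<phi> l" "\<phi> r \<le> \<phi> s" using lr' phi_mono by auto
        then have "la < \<phi> t" "\<phi> t < \<phi> s" using t(2) lr(3) by auto
        then show "\<exists>t\<in>{z \<in> B. \<phi> z \<in> {la<..<\<phi> s}}. dist t z < e" using t lr'
          by (intro bexI[of _ t]) (auto simp: dist_real_def)
      qed
    qed
  qed
  have "{z \<in> B. \<phi> z \<in> {la<..<\<phi> s}} \<subseteq> interior {lo 0..s} \<inter> B" using phi_lessD by auto
  then show "part la (\<phi> s) \<subseteq> closure (interior {lo 0..s} \<inter> B)" unfolding part_def by (rule closure_mono)
qed

lemma part_whole: "part la lb = B \<inter> C 0"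
proof
  have "z \<in> C 0" if "z \<in> B" "la \<le> \<phi> z" "\<phi> z \<le> lb" for z
    using phi_in_D0[of z] that B_sub by auto
  then show "part la lb \<subseteq> B \<inter> C 0" using part_sub by blast
  have "closed (B \<inter> C 0)" using B_closed C_compact_connected compact_imp_closed by blast
  show "B \<inter> C 0 \<subseteq> part la lb"
  proof
    fix z assume z: "z \<in> B \<inter> C 0"
    show "z \<in> part la lb" unfolding part_def closure_approachable
    proof (intro allI impI)
      fix e :: real assume e: "e > 0"
      have zB: "z \<in> B" and zC: "z \<in> C 0" using z by auto
      obtain l r where lr: "l < r" "{l..r} \<subseteq> M" "\<phi> l < \<phi> r" "z - e < l" "r < z + e"
          "z \<in> C 0 \<longrightarrow> {l..r} \<subseteq> C 0"
        by (rule near_part[OF zB e, where i = 0])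
      have "(\<phi> l + \<phi> r) / 2 \<in> {\<phi> l<..<\<phi> r}" using lr(3) by auto
      then obtain t where t: "t \<in> B" "\<phi> t = (\<phi> l + \<phi> r) / 2" "l < t" "t < r"
        using B_between[OF lr(2)] by blast
      have "l \<in> {l..r}" "r \<in> {l..r}" using lr(1) by auto
      then have "l \<in> C 0" "r \<in> C 0" using lr(6) zC by blast+
      then have "la \<le> \<phi> l" "\<phi> r \<le> lb" unfolding C_Icc by (auto intro: phi_mono)
      then have "la < \<phi> t" "\<phi> t < lb" using t(2) lr(3) by auto
      then show "\<exists>t\<in>{z \<in> B. \<phi> z \<in> {la<..<lb}}. dist t z < e" using t lr
        by (intro bexI[of _ t]) (auto simp: dist_real_def)
    qed
  qed
qed

lemma interval_almost_conjugate:
  assumes J: "c < d" "{c..d} \<subseteq> C 0" "(f ^^ k) ` {c..d} \<subseteq> {c..d}" "\<phi> c < \<phi> d"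
    and F: "F \<subseteq> B \<inter> {c..d}" "closed F" "(f ^^ k) ` F \<subseteq> F" "\<phi> ` F = {\<phi> c..\<phi> d}"
  shows "almost_conjugates 1 \<phi> {c..d} (f ^^ k) F {\<phi> c..\<phi> d} (g ^^ k)"
proof -
  have JM: "{c..d} \<subseteq> M" using J(2) C_sub_M by blast
  have im: "\<phi> ` {c..d} = {\<phi> c..\<phi> d}"
  proof
    show "\<phi> ` {c..d} \<subseteq> {\<phi> c..\<phi> d}" by (auto intro: phi_mono)
    show "{\<phi> c..\<phi> d} \<subseteq> \<phi> ` {c..d}" using F(1,4) by blast
  qed
  have comm: "\<phi> ((f ^^ k) x) = (g ^^ k) (\<phi> x)" if "x \<in> {c..d}" for x using gk_phi JM that by (metis subsetD)
  have gJ: "(g ^^ k) ` {\<phi> c..\<phi> d} \<subseteq> {\<phi> c..\<phi> d}"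
  proof (unfold im[symmetric], intro image_subsetI, elim imageE)
    fix w x assume x: "w = \<phi> x" "x \<in> {c..d}"
    have "(g ^^ k) w = \<phi> ((f ^^ k) x)" using x comm by simp
    moreover have "(f ^^ k) x \<in> {c..d}" using x(2) J(3) by blast
    ultimately show "(g ^^ k) w \<in> \<phi> ` {c..d}" by simp
  qed
  have one: "(\<Union>i<1::nat. X) = X" for X :: "real set" by auto
  have "nonstrictly_periodic 1 (\<Union>i<1::nat. {c..d}) (f ^^ k)"
    by (rule nonstrictly_periodicI[of 1 _ _ "\<lambda>_. c" "\<lambda>_. d"]) (use J cont_M[OF JM] in auto)
  moreover have "{\<phi> c..\<phi> d} \<subseteq> M'" unfolding im[symmetric] M'_def using JM by blast
  then have "continuous_on {\<phi> c..\<phi> d} (g ^^ k)" by (rule gk_cont)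
  then have "nonstrictly_periodic 1 (\<Union>i<1::nat. {\<phi> c..\<phi> d}) (g ^^ k)"
    by (intro nonstrictly_periodicI[of 1 _ _ "\<lambda>_. \<phi> c" "\<lambda>_. \<phi> d"]) (use J gJ in auto)
  moreover have "interior {y \<in> {c..d}. \<phi> y = x} \<inter> F = {}" for x
  proof -
    have "interior {y \<in> {c..d}. \<phi> y = x} \<subseteq> interior {y \<in> M. \<phi> y = x}"
      using JM by (intro interior_mono) blast
    then show ?thesis using fibre_interior[of x] F(1) by blast
  qed
  ultimately show ?thesis unfolding almost_conjugates_def one
    using im comm F phi_cont phi_mono by (simp add: mono_on_def)
qed

definition decomposition :: "real set \<Rightarrow> nat \<Rightarrow> real set \<Rightarrow> bool" where
  "decomposition J k B' \<longleftrightarrow> (\<exists>c d. c < d \<and> J = {c..d}) \<and> J \<subseteq> I \<and> (k = n \<or> k = 2 * n) \<and>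
       B' = closure (interior J \<inter> B) \<and>
       (f ^^ k) ` J = J \<and>
       (f ^^ k) ` B' = B' \<and>
       (\<forall>i j. i < j \<and> j < k \<longrightarrow> (\<exists>p. (f ^^ i) ` B' \<inter> (f ^^ j) ` B' \<subseteq> {p})) \<and>
       (\<Union>i<k. (f ^^ i) ` B') = B \<and>
       (\<exists>K' g \<phi>. almost_conjugates 1 \<phi> J (f ^^ k) B' K' g \<and> mixing_on K' g) \<and>
       (k = n \<longrightarrow> J = I)"

lemma decomposition_if_mixing:
  assumes mix: "mixing_on {la..lb} (g ^^ n)"
  shows "decomposition I n (B \<inter> C 0)"
proof -
  have I: "I = {lo 0..hi 0}" using C0 C_Icc[of 0] by simp
  have B': "B \<inter> C 0 = closure (interior I \<inter> B)"
    using part_eq_interior[OF lo_hi order_refl] part_whole I by simp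
  have Bn: "(f ^^ n) ` (B \<inter> C 0) = B \<inter> C 0" using fi_B[of n] C_mod[of n] by simp
  have disjB: "\<exists>p. (f ^^ i) ` (B \<inter> C 0) \<inter> (f ^^ j) ` (B \<inter> C 0) \<subseteq> {p}" if "i < j \<and> j < n" for i j
    unfolding fi_B using disj[of i j] that by auto
  have cover: "(\<Union>i<n. (f ^^ i) ` (B \<inter> C 0)) = B"
    unfolding fi_B using B_sub by (auto elim: in_M_E)
  have conj: "almost_conjugates 1 \<phi> {lo 0..hi 0} (f ^^ n) (B \<inter> C 0) {la..lb} (g ^^ n)"
  proof (rule interval_almost_conjugate[OF lo_hi _ _ D_nondegenerate])
    show "closed (B \<inter> C 0)" using B_closed C_compact_connected compact_imp_closed by blast
    show "\<phi> ` (B \<inter> C 0) = {la..lb}" using part_image[of la lb] part_whole D_nondegenerate by simp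
  qed (simp_all add: Cn Bn flip: C_Icc)
  show ?thesis unfolding decomposition_def
  proof (intro conjI allI impI)
    show "\<exists>c d. c < d \<and> I = {c..d}" using lo_hi[of 0] I by blast
    show "\<exists>K' g \<phi>. almost_conjugates 1 \<phi> I (f ^^ n) (B \<inter> C 0) K' g \<and> mixing_on K' g"
      using conj[folded I] mix by blast
  qed (rule refl | fact B' fnI Bn disjB cover order_refl disjI1[OF refl])+
qed

section \<open>The splitting case\<close>

lemma phi_cl_less: "z \<in> closure {y \<in> B. \<phi> y < \<phi> e} \<Longrightarrow> z \<le> e"
proof -
  have "{y \<in> B. \<phi> y < \<phi> e} \<subseteq> {..e}" using phi_lessD by (auto intro: less_imp_le)
  then have "closure {y \<in> B. \<phi> y < \<phi> e} \<subseteq> {..e}" by (simp add: closure_minimal)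
  then show "z \<in> closure {y \<in> B. \<phi> y < \<phi> e} \<Longrightarrow> z \<le> e" by blast
qed

lemma phi_cl_greater: "z \<in> closure {y \<in> B. \<phi> e < \<phi> y} \<Longrightarrow> e \<le> z"
proof -
  have "{y \<in> B. \<phi> e < \<phi> y} \<subseteq> {e..}" using phi_lessD by (auto intro: less_imp_le)
  then have "closure {y \<in> B. \<phi> e < \<phi> y} \<subseteq> {e..}" by (simp add: closure_minimal)
  then show "z \<in> closure {y \<in> B. \<phi> e < \<phi> y} \<Longrightarrow> e \<le> z" by blast
qed

lemma funpow_split: "i \<le> n \<Longrightarrow> (g ^^ n) t = (g ^^ (n - i)) ((g ^^ i) t)"
proof -
  assume "i \<le> n"
  then have "(g ^^ n) t = (g ^^ ((n - i) + i)) t" by simp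
  then show ?thesis by (simp only: funpow_add o_apply)
qed

text \<open>The images of the two halves lie on different sides of the image of the splitting point,
  since \<open>g ^^ (n - i)\<close> sends everything they have in common to that point.\<close>

lemma split_images_meet:
  assumes sp: "splits_at la lb (g ^^ n) p" and i: "i < n"
  shows "\<exists>e. (f ^^ i) ` part la p \<inter> (f ^^ i) ` part p lb \<subseteq> {e}"
proof -
  have p: "la < p" "p < lb" "(g ^^ n) p = p" and im: "(g ^^ n) ` {la..p} = {p..lb}" "(g ^^ n) ` {p..lb} = {la..p}"
    using sp unfolding splits_at_def by auto
  define L where "L = (g ^^ i) ` {la..p}"
  define R where "R = (g ^^ i) ` {p..lb}"
  define d where "d = (g ^^ i) p"
  have "{la..p} \<subseteq> D 0" "{p..lb} \<subseteq> D 0" using p unfolding D_Icc by auto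
  then have contLR: "continuous_on {la..p} (g ^^ i)" "continuous_on {p..lb} (g ^^ i)"
    using gk_cont D_sub_M' by (meson subset_trans)+
  have conn: "connected L" "connected R" unfolding L_def R_def
    by (rule connected_continuous_image[OF contLR(1)], simp)
       (rule connected_continuous_image[OF contLR(2)], simp)
  have dLR: "d \<in> L" "d \<in> R" unfolding d_def L_def R_def using p by auto
  have common: "(g ^^ (n - i)) z = p" if "z \<in> L" "z \<in> R" for z
  proof -
    obtain t t' where t: "t \<in> {la..p}" "z = (g ^^ i) t" and t': "t' \<in> {p..lb}" "z = (g ^^ i) t'"
      using \<open>z \<in> L\<close> \<open>z \<in> R\<close> unfolding L_def R_def by blast
    have "(g ^^ n) t \<in> {p..lb}" by (rule subst[OF im(1), of "\<lambda>X. (g ^^ n) t \<in> X"]) (rule imageI[OF t(1)])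
    moreover have "(g ^^ n) t' \<in> {la..p}" by (rule subst[OF im(2), of "\<lambda>X. (g ^^ n) t' \<in> X"]) (rule imageI[OF t'(1)])
    ultimately have "(g ^^ (n - i)) z \<in> {p..lb}" "(g ^^ (n - i)) z \<in> {la..p}"
      using funpow_split[of i t] funpow_split[of i t'] i t(2) t'(2) by simp_all
    then show ?thesis by simp
  qed
  \<comment> \<open>A second common point would put a whole interval into both images, and
    \<open>g ^^ n\<close> would collapse a subinterval of the left half to \<open>p\<close>.\<close>
  have meet: "z = d" if z: "z \<in> L" "z \<in> R" for z
  proof (rule ccontr)
    assume "z \<noteq> d"
    have seg: "closed_segment z d \<subseteq> L" "closed_segment z d \<subseteq> R"
      using conn dLR z by (metis closed_segment_subset is_interval_connected_1 is_interval_convex)+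
    define u where "u = min z d"
    define v where "v = max z d"
    have uv: "u < v" "{u..v} \<subseteq> L" "{u..v} \<subseteq> R" using \<open>z \<noteq> d\<close> seg
      by (auto simp: u_def v_def closed_segment_eq_real_ivl split: if_splits)
    define m where "m = (u + v) / 2"
    have "\<exists>s\<in>{la..p}. (g ^^ i) s = m"
    proof -
      have "m \<in> L" using uv(1,2) by (auto simp: m_def)
      then show ?thesis unfolding L_def by blast
    qed
    then obtain s where s: "s \<in> {la..p}" "(g ^^ i) s = m" by blast
    have ms: "u < (g ^^ i) s" "(g ^^ i) s < v" using s(2) uv(1) by (auto simp: m_def)
    obtain x y where xy: "la \<le> x" "x < y" "y \<le> p" "(g ^^ i) ` {x..y} \<subseteq> {u<..<v}"
      using local_interval[OF contLR(1) p(1) s(1) ms zero_less_one] by metis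
    have "(g ^^ n) r = p" if "r \<in> {x..y}" for r
    proof -
      have "(g ^^ i) r \<in> {u..v}" using xy(4) that by fastforce
      then have "(g ^^ i) r \<in> L" "(g ^^ i) r \<in> R" using uv by blast+
      then show ?thesis using common[of "(g ^^ i) r"] funpow_split[of i r] i by simp
    qed
    moreover obtain w where "w \<in> {x<..<y}" "(g ^^ n) w \<notin> {p}"
      using g_no_collapse[of x y n "{p}"] xy p by (metis finite.emptyI finite_insert less_imp_le order_refl order_trans)
    ultimately show False by auto
  qed
  have nontriv: "\<exists>z\<in>L. z \<noteq> d" "\<exists>z\<in>R. z \<noteq> d"
  proof -
    obtain w where "w \<in> {la<..<p}" "(g ^^ i) w \<notin> {d}"
      using g_no_collapse[of la p i "{d}"] p i by (metis finite.emptyI finite_insert less_imp_le order_refl)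
    then show "\<exists>z\<in>L. z \<noteq> d" unfolding L_def by auto
    obtain w where "w \<in> {p<..<lb}" "(g ^^ i) w \<notin> {d}"
      using g_no_collapse[of p lb i "{d}"] p i by (metis finite.emptyI finite_insert less_imp_le order_refl)
    then show "\<exists>z\<in>R. z \<noteq> d" unfolding R_def by auto
  qed
  have ivl: "w \<in> L" if "z \<in> L" "w \<in> closed_segment z d" for z w
    using that conn(1) dLR(1) by (metis closed_segment_subset is_interval_connected_1 is_interval_convex subsetD)
  have ivr: "w \<in> R" if "z \<in> R" "w \<in> closed_segment z d" for z w
    using that conn(2) dLR(2) by (metis closed_segment_subset is_interval_connected_1 is_interval_convex subsetD)
  \<comment> \<open>If both images reached to the same side of \<open>d\<close>, they would share a
    point other than \<open>d\<close>.\<close>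
  have below: "\<not> (z < d \<and> z' < d)" if "z \<in> L" "z' \<in> R" for z z'
  proof
    assume h: "z < d \<and> z' < d"
    then have "max z z' \<in> L" "max z z' \<in> R"
      using ivl[OF that(1), of "max z z'"] ivr[OF that(2), of "max z z'"]
      by (auto simp: closed_segment_eq_real_ivl)
    then show False using meet[of "max z z'"] h by auto
  qed
  have above: "\<not> (d < z \<and> d < z')" if "z \<in> L" "z' \<in> R" for z z'
  proof
    assume h: "d < z \<and> d < z'"
    then have "min z z' \<in> L" "min z z' \<in> R"
      using ivl[OF that(1), of "min z z'"] ivr[OF that(2), of "min z z'"]
      by (auto simp: closed_segment_eq_real_ivl)
    then show False using meet[of "min z z'"] h by auto
  qed
  obtain zl zr where zl: "zl \<in> L" "zl \<noteq> d" and zr: "zr \<in> R" "zr \<noteq> d" using nontriv by blast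
  have "p \<in> {la..lb}" using p by auto
  \<comment> \<open>Any representative of the fibre over \<open>p\<close> serves: the closure of the
    points of \<open>B\<close> with value below \<open>d\<close> stays to the left of
    \<open>e\<close> or at it, and the closure of those with value above \<open>d\<close> to the
    right or at it.\<close>
  then obtain e0 where e0: "e0 \<in> C 0" "\<phi> e0 = p" by (rule phi_surj_C0)
  define e where "e = (f ^^ i) e0"
  have e: "\<phi> e = d" unfolding e_def d_def e0(2)[symmetric] using gk_phi e0(1) C_sub_M by (metis subsetD)
  have pushL: "(f ^^ i) ` part la p \<subseteq> closure {z \<in> B. \<phi> z \<in> L - {d}}"
  proof -
    have "(f ^^ i) ` part la p \<subseteq> closure {z \<in> B. \<phi> z \<in> (g ^^ i) ` {la<..<p} - {d}}"
      using part_push[of la p i "{d}"] p i by simp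
    also have "\<dots> \<subseteq> closure {z \<in> B. \<phi> z \<in> L - {d}}" unfolding L_def by (intro closure_mono) auto
    finally show ?thesis .
  qed
  have pushR: "(f ^^ i) ` part p lb \<subseteq> closure {z \<in> B. \<phi> z \<in> R - {d}}"
  proof -
    have "(f ^^ i) ` part p lb \<subseteq> closure {z \<in> B. \<phi> z \<in> (g ^^ i) ` {p<..<lb} - {d}}"
      using part_push[of p lb i "{d}"] p i by simp
    also have "\<dots> \<subseteq> closure {z \<in> B. \<phi> z \<in> R - {d}}" unfolding R_def by (intro closure_mono) auto
    finally show ?thesis .
  qed
  have "z = e" if z: "z \<in> (f ^^ i) ` part la p" "z \<in> (f ^^ i) ` part p lb" for z
  proof (cases "zl < d")
    case True
    then have R: "R - {d} \<subseteq> {d<..}" using below[OF zl(1)] by force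
    then have "d < zr" using zr by auto
    then have L: "L - {d} \<subseteq> {..<d}" using above[OF _ zr(1)] by force
    have "closure {z \<in> B. \<phi> z \<in> L - {d}} \<subseteq> closure {y \<in> B. \<phi> y < \<phi> e}"
      using L e by (intro closure_mono) auto
    moreover have "closure {z \<in> B. \<phi> z \<in> R - {d}} \<subseteq> closure {y \<in> B. \<phi> e < \<phi> y}"
      using R e by (intro closure_mono) auto
    ultimately have "z \<le> e" "e \<le> z" using z pushL pushR phi_cl_less phi_cl_greater by (meson subsetD)+
    then show ?thesis by simp
  next
    case False
    then have "d < zl" using zl by simp
    then have R: "R - {d} \<subseteq> {..<d}" using above[OF zl(1)] by force
    then have "zr < d" using zr by auto
    then have L: "L - {d} \<subseteq> {d<..}" using below[OF _ zr(1)] by force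
    have "closure {z \<in> B. \<phi> z \<in> R - {d}} \<subseteq> closure {y \<in> B. \<phi> y < \<phi> e}"
      using R e by (intro closure_mono) auto
    moreover have "closure {z \<in> B. \<phi> z \<in> L - {d}} \<subseteq> closure {y \<in> B. \<phi> e < \<phi> y}"
      using L e by (intro closure_mono) auto
    ultimately have "z \<le> e" "e \<le> z" using z pushL pushR phi_cl_less phi_cl_greater by (meson subsetD)+
    then show ?thesis by simp
  qed
  then show ?thesis by blast
qed

lemma part_split:
  assumes "la < p" "p < lb"
  shows "part la p \<union> part p lb = B \<inter> C 0"
proof
  have "part la p \<subseteq> part la lb" "part p lb \<subseteq> part la lb"
    unfolding part_def using assms by (auto intro!: closure_mono)
  then show "part la p \<union> part p lb \<subseteq> B \<inter> C 0" using part_whole by blast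
  have "part la lb = (f ^^ 0) ` part la lb" by simp
  also have "\<dots> \<subseteq> closure {z \<in> B. \<phi> z \<in> (g ^^ 0) ` {la<..<lb} - {p}}"
    using part_push[of la lb 0 "{p}"] D_nondegenerate by blast
  also have "\<dots> \<subseteq> closure ({z \<in> B. \<phi> z \<in> {la<..<p}} \<union> {z \<in> B. \<phi> z \<in> {p<..<lb}})"
    by (intro closure_mono) auto
  also have "\<dots> = part la p \<union> part p lb" by (simp only: closure_Un part_def)
  finally show "B \<inter> C 0 \<subseteq> part la p \<union> part p lb" using part_whole by simp
qed

text \<open>Dropping the values at the ends from the pushed parts gives the inclusions. For the
  converse, \<open>f ^^ n\<close> maps \<open>B \<inter> C 0\<close> onto itself; a point of
  \<open>B\<close> over the open right half cannot come from the right part, whose image lies over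
  the left half.\<close>

lemma split_swaps_parts:
  assumes sp: "splits_at la lb (g ^^ n) p"
  shows "(f ^^ n) ` part la p = part p lb" "(f ^^ n) ` part p lb = part la p"
proof -
  have p: "la < p" "p < lb" and im: "(g ^^ n) ` {la..p} = {p..lb}" "(g ^^ n) ` {p..lb} = {la..p}"
    using sp unfolding splits_at_def by auto
  have s1: "(f ^^ n) ` part la p \<subseteq> part p lb"
  proof -
    have "(f ^^ n) ` part la p \<subseteq> closure {z \<in> B. \<phi> z \<in> (g ^^ n) ` {la<..<p} - {p, lb}}"
      using part_push[of la p n "{p, lb}"] p by simp
    moreover have "(g ^^ n) ` {la<..<p} \<subseteq> (g ^^ n) ` {la..p}" by (intro image_mono) auto
    then have "(g ^^ n) ` {la<..<p} - {p, lb} \<subseteq> {p<..<lb}" unfolding im by auto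
    then have "closure {z \<in> B. \<phi> z \<in> (g ^^ n) ` {la<..<p} - {p, lb}} \<subseteq> part p lb"
      unfolding part_def by (intro closure_mono) blast
    ultimately show ?thesis by blast
  qed
  have s2: "(f ^^ n) ` part p lb \<subseteq> part la p"
  proof -
    have "(f ^^ n) ` part p lb \<subseteq> closure {z \<in> B. \<phi> z \<in> (g ^^ n) ` {p<..<lb} - {p, la}}"
      using part_push[of p lb n "{p, la}"] p by simp
    moreover have "(g ^^ n) ` {p<..<lb} \<subseteq> (g ^^ n) ` {p..lb}" by (intro image_mono) auto
    then have "(g ^^ n) ` {p<..<lb} - {p, la} \<subseteq> {la<..<p}" unfolding im by auto
    then have "closure {z \<in> B. \<phi> z \<in> (g ^^ n) ` {p<..<lb} - {p, la}} \<subseteq> part la p"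
      unfolding part_def by (intro closure_mono) blast
    ultimately show ?thesis by blast
  qed
  have closed_im: "closed ((f ^^ n) ` part x y)" for x y
  proof -
    have "part x y \<subseteq> M" using part_sub B_sub by blast
    then have "compact ((f ^^ n) ` part x y)" by (rule compact_continuous_image[OF cont_M part_compact])
    then show ?thesis by (rule compact_imp_closed)
  qed
  have onto: "\<exists>x\<in>part la p \<union> part p lb. y = (f ^^ n) x" if "y \<in> B" "\<phi> y \<in> {la..lb}" for y
  proof -
    have "y \<in> B \<inter> C n" using that phi_in_D0[of y] B_sub C_mod[of n] by auto
    then show ?thesis using fi_B[of n] part_split[OF p] by blast
  qed
  have "part p lb \<subseteq> (f ^^ n) ` part la p"
    unfolding part_def[of p lb]
  proof (rule closure_minimal[OF _ closed_im], rule subsetI)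
    fix y assume y: "y \<in> {z \<in> B. \<phi> z \<in> {p<..<lb}}"
    then obtain x where x: "x \<in> part la p \<union> part p lb" "y = (f ^^ n) x" using onto[of y] p by auto
    have "x \<notin> part p lb"
    proof
      assume "x \<in> part p lb"
      then have "y \<in> part la p" using s2 x(2) by blast
      then show False using part_sub[of la p] y by auto
    qed
    then show "y \<in> (f ^^ n) ` part la p" using x by blast
  qed
  then show "(f ^^ n) ` part la p = part p lb" using s1 by blast
  have "part la p \<subseteq> (f ^^ n) ` part p lb"
    unfolding part_def[of la p]
  proof (rule closure_minimal[OF _ closed_im], rule subsetI)
    fix y assume y: "y \<in> {z \<in> B. \<phi> z \<in> {la<..<p}}"
    then obtain x where x: "x \<in> part la p \<union> part p lb" "y = (f ^^ n) x" using onto[of y] p by auto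
    have "x \<notin> part la p"
    proof
      assume "x \<in> part la p"
      then have "y \<in> part p lb" using s1 x(2) by blast
      then show False using part_sub[of p lb] y by auto
    qed
    then show "y \<in> (f ^^ n) ` part p lb" using x by blast
  qed
  then show "(f ^^ n) ` part p lb = part la p" using s2 by blast
qed

text \<open>Over the splitting point \<open>\<phi>\<close> may collapse an interval, on which the right end of the
  invariant interval is found as a fixed point of a monotone map.\<close>

lemma split_invariant_interval:
  assumes sp: "splits_at la lb (g ^^ n) p"
  obtains s where "lo 0 < s" "s \<le> hi 0" "\<phi> s = p" "(f ^^ (2 * n)) ` {lo 0..s} = {lo 0..s}"
proof -
  have p: "la < p" "p < lb" and im: "(g ^^ n) ` {la..p} = {p..lb}" "(g ^^ n) ` {p..lb} = {la..p}"
    using sp unfolding splits_at_def by auto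
  define T where "T = f ^^ n"
  have TT: "(f ^^ (2 * n)) x = T (T x)" for x
    by (simp add: T_def mult_2 funpow_add)
  have phiT: "\<phi> (T x) = (g ^^ n) (\<phi> x)" if "x \<in> C 0" for x
    using gk_phi[of x n] C_sub_M that unfolding T_def by (metis subsetD)
  have TC: "T ` C 0 = C 0" using Cn by (simp add: T_def)
  have phiC: "\<phi> x \<in> {la..lb}" if "x \<in> C 0" for x using that D_Icc[of 0] unfolding D_def by blast
  have left: "\<phi> (T x) \<in> {p..lb}" if "x \<in> C 0" "\<phi> x \<le> p" for x
    using phiT[OF that(1)] phiC[OF that(1)] that(2) im(1) by (metis atLeastAtMost_iff imageI)
  have right: "\<phi> (T x) \<in> {la..p}" if "x \<in> C 0" "p \<le> \<phi> x" for x
    using phiT[OF that(1)] phiC[OF that(1)] that(2) im(2) by (metis atLeastAtMost_iff imageI)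
  define Z where "Z = {x \<in> C 0. \<phi> x = p}"
  have "compact Z"
  proof -
    have "closed (\<phi> -` {p})" by (rule closed_vimage[OF closed_singleton phi_cont])
    moreover have "Z = C 0 \<inter> \<phi> -` {p}" unfolding Z_def by blast
    ultimately show ?thesis using C_compact_connected by (simp add: compact_Int_closed)
  qed
  moreover have "Z \<noteq> {}" using phi_surj_C0[of p] p unfolding Z_def by (metis (mono_tags, lifting) atLeastAtMost_iff empty_iff less_imp_le mem_Collect_eq)
  ultimately obtain e1 e2 where e: "e1 \<in> Z" "\<And>x. x \<in> Z \<Longrightarrow> e1 \<le> x" "e2 \<in> Z" "\<And>x. x \<in> Z \<Longrightarrow> x \<le> e2"
    using compact_attains_inf[of Z] compact_attains_sup[of Z] by metis
  have eC: "e1 \<in> C 0" "e2 \<in> C 0" "\<phi> e1 = p" "\<phi> e2 = p" using e unfolding Z_def by auto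
  have e12: "e1 \<le> e2" using e by blast
  have loe: "lo 0 < e1" using phi_lessD[of "lo 0" e1] eC p by simp
  have ehi: "e2 \<le> hi 0" using eC C_Icc[of 0] by auto
  have lt: "\<phi> x < p" if "x \<in> C 0" "x < e1" for x
  proof -
    have "\<phi> x \<le> p" using phi_mono[of x e1] that eC by simp
    moreover have "\<phi> x \<noteq> p" using e(2)[of x] that unfolding Z_def by auto
    ultimately show ?thesis by simp
  qed
  have le2: "x \<le> e2" if "x \<in> C 0" "\<phi> x \<le> p" for x
  proof (cases "\<phi> x = p")
    case True
    then show ?thesis using e(4)[of x] that unfolding Z_def by blast
  next
    case False
    then show ?thesis using phi_lessD[of x e2] that eC by simp
  qed
  \<comment> \<open>\<open>H s\<close> is the right end of the image of \<open>{lo 0..s}\<close>. It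
    maps \<open>{e1..e2}\<close> into itself monotonically, and the supremum of the points with
    \<open>s \<le> H s\<close> is fixed, as in the Knaster-Tarski theorem.\<close>
  define H where "H s = Sup ((f ^^ (2 * n)) ` {lo 0..s})" for s
  have H: "(f ^^ (2 * n)) ` {lo 0..s} = {lo 0..H s} \<and> e1 \<le> H s \<and> H s \<le> e2" if s: "e1 \<le> s" "s \<le> e2" for s
  proof -
    have subC: "{lo 0..s} \<subseteq> C 0" using s ehi C_Icc[of 0] by auto
    then have subM: "{lo 0..s} \<subseteq> M" using C_sub_M by blast
    have phis: "\<phi> x \<le> p" if "x \<in> {lo 0..s}" for x using phi_mono[of x e2] that s eC by auto
    have into: "(f ^^ (2 * n)) ` {lo 0..s} \<subseteq> {lo 0..e2}"
    proof (rule image_subsetI)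
      fix x assume x: "x \<in> {lo 0..s}"
      have xC: "x \<in> C 0" using x subC by blast
      have TxC: "T x \<in> C 0" "T (T x) \<in> C 0" using TC xC by blast+
      have "p \<le> \<phi> (T x)" using left[OF xC phis[OF x]] by simp
      then have "\<phi> (T (T x)) \<le> p" using right[OF TxC(1)] by simp
      then show "(f ^^ (2 * n)) x \<in> {lo 0..e2}" using le2[OF TxC(2)] TxC(2) C_Icc[of 0] TT by auto
    qed
    \<comment> \<open>A point left of \<open>e1\<close> has value below \<open>p\<close>. A preimage
      two returns back again has value below \<open>p\<close>, because each half is sent to the
      other; so it lies left of \<open>e1\<close> and in \<open>{lo 0..s}\<close>.\<close>
    have onto: "{lo 0..<e1} \<subseteq> (f ^^ (2 * n)) ` {lo 0..s}"
    proof
      fix x assume x: "x \<in> {lo 0..<e1}"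
      then have xC: "x \<in> C 0" using e12 ehi C_Icc[of 0] by auto
      obtain w where w: "w \<in> C 0" "x = T w" using TC xC by blast
      obtain w' where w': "w' \<in> C 0" "w = T w'" using TC w(1) by blast
      have "\<phi> x < p" using lt[OF xC] x by simp
      then have "p < \<phi> w" using left[OF w(1)] w(2) by fastforce
      then have "\<phi> w' < p" using right[OF w'(1)] w'(2) by fastforce
      then have "w' < e1" using phi_lessD[of w' e1] eC by simp
      then have "w' \<in> {lo 0..s}" using w'(1) C_Icc[of 0] s by auto
      then show "x \<in> (f ^^ (2 * n)) ` {lo 0..s}" using w w' TT by (metis imageI)
    qed
    have comp: "compact ((f ^^ (2 * n)) ` {lo 0..s})" "connected ((f ^^ (2 * n)) ` {lo 0..s})"
      using compact_continuous_image[OF cont_M[OF subM]] connected_continuous_image[OF cont_M[OF subM]] by auto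
    then obtain a b where ab: "(f ^^ (2 * n)) ` {lo 0..s} = {a..b}"
      using connected_compact_interval_1 by blast
    have "closure {lo 0..<e1} \<subseteq> {a..b}" using onto unfolding ab by (simp add: closure_minimal)
    then have sub: "{lo 0..e1} \<subseteq> {a..b}" using loe by simp
    then have "lo 0 \<in> {a..b}" "e1 \<in> {a..b}" using loe by auto
    moreover have "a \<in> {lo 0..e2}" "b \<in> {lo 0..e2}" using into ab \<open>lo 0 \<in> {a..b}\<close> by auto
    ultimately have "a = lo 0" "e1 \<le> b" "b \<le> e2" by auto
    moreover have "H s = b" unfolding H_def ab using \<open>lo 0 \<in> {a..b}\<close> by simp
    ultimately show ?thesis using ab by simp
  qed
  have H_mono: "H s \<le> H t" if "e1 \<le> s" "s \<le> t" "t \<le> e2" for s t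
  proof -
    have "(f ^^ (2 * n)) ` {lo 0..s} \<subseteq> (f ^^ (2 * n)) ` {lo 0..t}" using that by (intro image_mono) auto
    then have "{lo 0..H s} \<subseteq> {lo 0..H t}" using H[of s] H[of t] that by auto
    then show ?thesis using H[of s] that loe by auto
  qed
  define S where "S = {s \<in> {e1..e2}. s \<le> H s}"
  have S: "e1 \<in> S" "bdd_above S" using H[of e1] e12 by (auto simp: S_def intro: bdd_aboveI[of _ e2])
  define s where "s = Sup S"
  have "S \<noteq> {}" using S(1) by blast
  have s12: "e1 \<le> s" "s \<le> e2"
    unfolding s_def
    by (rule cSup_upper[OF S], rule cSup_least[OF \<open>S \<noteq> {}\<close>]) (simp add: S_def)
  have below: "t \<le> s" if "t \<in> S" for t using cSup_upper[OF that S(2)] by (simp add: s_def)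
  have "Sup S \<le> H s"
  proof (rule cSup_least[OF \<open>S \<noteq> {}\<close>])
    fix t assume t: "t \<in> S"
    then have "e1 \<le> t" "t \<le> H t" by (auto simp: S_def)
    then show "t \<le> H s" using H_mono[OF _ below[OF t] s12(2)] by simp
  qed
  then have "s \<le> H s" by (simp add: s_def)
  moreover have "H s \<le> s"
  proof -
    have "H s \<le> H (H s)" using H_mono[of s "H s"] H[OF s12] s12 calculation by simp
    then have "H s \<in> S" using H[OF s12] by (auto simp: S_def)
    then show ?thesis by (rule below)
  qed
  ultimately have "H s = s" by simp
  then have inv: "(f ^^ (2 * n)) ` {lo 0..s} = {lo 0..s}" using H[OF s12] by simp
  have "\<phi> s = p" using phi_mono[OF s12(1)] phi_mono[OF s12(2)] eC by simp
  then show ?thesis using that[of s] inv s12 loe ehi by simp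
qed

lemma decomposition_if_splits:
  assumes sp: "splits_at la lb (g ^^ n) p" and mix: "mixing_on {la..p} ((g ^^ n) ^^ 2)"
  shows "\<exists>J. decomposition J (2 * n) (part la p)"
proof -
  have p: "la < p" "p < lb" using sp unfolding splits_at_def by auto
  obtain s where s: "lo 0 < s" "s \<le> hi 0" "\<phi> s = p" "(f ^^ (2 * n)) ` {lo 0..s} = {lo 0..s}"
    using split_invariant_interval[OF sp] .
  define J where "J = {lo 0..s}"
  have JC: "J \<subseteq> C 0" using s C_Icc[of 0] by (auto simp: J_def)
  have B': "part la p = closure (interior J \<inter> B)" using part_eq_interior[OF s(1,2)] s(3) by (simp add: J_def)
  have swap: "(f ^^ n) ` part la p = part p lb" "(f ^^ n) ` part p lb = part la p"
    using split_swaps_parts[OF sp] .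
  have addn: "(f ^^ (i + n)) ` X = (f ^^ i) ` ((f ^^ n) ` X)" for i X
    by (simp add: funpow_add image_comp)
  have inv: "(f ^^ (2 * n)) ` part la p = part la p"
    using addn[of n "part la p"] by (simp add: swap mult_2)
  have partC: "part la p \<subseteq> B \<inter> C 0" "part p lb \<subseteq> B \<inter> C 0" using part_split[OF p] by blast+
  have fiC: "(f ^^ i) ` part la p \<subseteq> C i" for i
  proof -
    have "(f ^^ i) ` part la p \<subseteq> (f ^^ i) ` (B \<inter> C 0)" using partC by (intro image_mono)
    then show ?thesis using fi_B[of i] by blast
  qed
  \<comment> \<open>Two different times below \<open>2 * n\<close> that agree modulo
    \<open>n\<close> differ by exactly \<open>n\<close>, and \<open>f ^^ n\<close> turns the left
    part into the right one. At other pairs of times the images lie in disjoint components.\<close>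
  have meet: "\<exists>e. (f ^^ i) ` part la p \<inter> (f ^^ j) ` part la p \<subseteq> {e}" if ij: "i < j \<and> j < 2 * n" for i j
  proof (cases "i mod n = j mod n")
    case True
    then have "n dvd j - i" using mod_eq_dvd_iff_nat[of i j n] ij by simp
    then obtain k where k: "j - i = n * k" by blast
    have "k = 1"
    proof -
      have "k \<noteq> 0" using k ij by (cases k) auto
      moreover have "k < 2"
      proof (rule ccontr)
        assume "\<not> k < 2"
        then have "n * 2 \<le> n * k" by (intro mult_le_mono2) simp
        then show False using k ij by linarith
      qed
      ultimately show ?thesis by simp
    qed
    then have j: "j = i + n" "i < n" using k ij by auto
    show ?thesis unfolding j(1) addn swap using split_images_meet[OF sp j(2)] .
  next
    case False
    have "C i \<inter> C j = {}" using C_disj_mod False by blast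
    then show ?thesis using fiC[of i] fiC[of j] by blast
  qed
  have cover: "(\<Union>i<2 * n. (f ^^ i) ` part la p) = B"
  proof
    have "(f ^^ i) ` part la p \<subseteq> B" for i using partC fk_B by blast
    then show "(\<Union>i<2 * n. (f ^^ i) ` part la p) \<subseteq> B" by blast
    show "B \<subseteq> (\<Union>i<2 * n. (f ^^ i) ` part la p)"
    proof
      fix b assume b: "b \<in> B"
      then obtain i where i: "i < n" "b \<in> C i" using B_sub by (metis in_M_E subsetD)
      then have "b \<in> (f ^^ i) ` (B \<inter> C 0)" using fi_B b by blast
      then have "b \<in> (f ^^ i) ` part la p \<or> b \<in> (f ^^ i) ` part p lb"
        unfolding part_split[OF p, symmetric] by blast
      then have "b \<in> (f ^^ i) ` part la p \<or> b \<in> (f ^^ (i + n)) ` part la p" by (simp only: addn swap)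
      moreover have "i < 2 * n" "i + n < 2 * n" using i by auto
      ultimately show "b \<in> (\<Union>i<2 * n. (f ^^ i) ` part la p)" by blast
    qed
  qed
  have conj: "almost_conjugates 1 \<phi> {lo 0..s} (f ^^ (2 * n)) (part la p) {la..\<phi> s} (g ^^ (2 * n))"
  proof (rule interval_almost_conjugate[OF s(1)])
    show "{lo 0..s} \<subseteq> C 0" using JC by (simp add: J_def)
    show "part la p \<subseteq> B \<inter> {lo 0..s}"
    proof -
      have "closure (interior J \<inter> B) \<subseteq> J" unfolding J_def
        by (intro closure_minimal) (use interior_subset in blast)+
      then show ?thesis using B' partC by (simp add: J_def)
    qed
    show "\<phi> ` part la p = {la..\<phi> s}" using part_image[of la p] p s(3) by simp
    show "la < \<phi> s" using p s(3) by simp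
  qed (use s(4) inv part_closed in auto)
  have gg: "(g ^^ n) ^^ 2 = g ^^ (2 * n)" by (simp add: funpow_mult mult.commute)
  have "decomposition J (2 * n) (part la p)"
    unfolding decomposition_def
  proof (intro conjI allI impI)
    show "\<exists>c d. c < d \<and> J = {c..d}" using s(1) by (auto simp: J_def)
    show "J \<subseteq> I" using JC C0 by simp
    show "\<exists>K' g \<phi>. almost_conjugates 1 \<phi> J (f ^^ (2 * n)) (part la p) K' g \<and> mixing_on K' g"
      using conj mix unfolding gg J_def s(3) by blast
    show "(f ^^ (2 * n)) ` J = J" using s(4) by (simp add: J_def)
    show "J = I" if "2 * n = n" using that n1 by simp
  qed (rule refl | fact B' inv meet cover disjI2[OF refl])+
  then show ?thesis by blast
qed

lemma decomposition_exists: "\<exists>J k B'. decomposition J k B'"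
  using itrans_mixing_or_splits(2)[OF g_itrans] decomposition_if_mixing decomposition_if_splits by blast

end

section \<open>Entropy\<close>

definition leg :: "real \<Rightarrow> real \<Rightarrow> real \<Rightarrow> bool \<Rightarrow> real set" where
  "leg u c d \<beta> = (if \<beta> then closed_segment c d else closed_segment u c)"

lemma horseshoe_legs:
  assumes "horseshoe F u c d"
  shows "leg u c d \<beta> \<subseteq> closed_segment u d" "leg u c d True \<inter> leg u c d False \<subseteq> {c}"
    "u \<notin> leg u c d True"
  using assms unfolding horseshoe_def leg_def by (auto simp: closed_segment_eq_real_ivl)

lemma horseshoe_covers:
  assumes h: "horseshoe F u c d" and cont: "continuous_on (closed_segment u d) F" and y: "y \<in> closed_segment u d"
  shows "\<exists>x\<in>leg u c d \<beta>. F x = y"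
proof -
  have "continuous_on (leg u c d \<beta>) F" using continuous_on_subset[OF cont horseshoe_legs(1)[OF h]] .
  then show ?thesis
    using h y ivt_segment[of c d F y] ivt_segment[of u c F y] unfolding leg_def horseshoe_def
    by (auto simp: closed_segment_eq_real_ivl split: if_splits)
qed

text \<open>Built backwards: each leg covers the whole segment, so a point realizing the rest of the
  word has a preimage in the leg of the first letter. Prescribing the final point \<open>y\<close>
  allows words to be concatenated.\<close>

lemma horseshoe_word:
  assumes h: "horseshoe F u c d" and cont: "continuous_on (closed_segment u d) F" and y: "y \<in> closed_segment u d"
  shows "\<exists>x\<in>closed_segment u d. (\<forall>i<length w. (F ^^ i) x \<in> leg u c d (w ! i)) \<and> (F ^^ length w) x = y"
proof (induction w)
  case Nil
  show ?case using y by (intro bexI[of _ y]) auto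
next
  case (Cons \<beta> w)
  then obtain x where x: "x \<in> closed_segment u d" "\<And>i. i < length w \<Longrightarrow> (F ^^ i) x \<in> leg u c d (w ! i)"
    "(F ^^ length w) x = y" by blast
  obtain x' where x': "x' \<in> leg u c d \<beta>" "F x' = x" using horseshoe_covers[OF h cont x(1)] by blast
  have "(F ^^ i) x' \<in> leg u c d ((\<beta> # w) ! i)" if "i < length (\<beta> # w)" for i
    using that x' x(2) by (cases i) (auto simp: funpow_swap1)
  moreover have "(F ^^ length (\<beta> # w)) x' = y" using x' x(3) by (simp add: funpow_swap1)
  moreover have "x' \<in> closed_segment u d" using x'(1) horseshoe_legs(1)[OF h] by blast
  ultimately show ?case by blast
qed

text \<open>The two legs share the point \<open>c\<close>; words ending in \<open>True, True\<close> avoid its orbit, so their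
  cylinders are disjoint and not merely non-overlapping.\<close>

lemma horseshoe_words_disjoint:
  assumes h: "horseshoe F u c d" and len: "length v = m" "length v' = m" and ne: "v \<noteq> v'"
    and x: "\<And>i. i < m + 2 \<Longrightarrow> (F ^^ i) x \<in> leg u c d ((v @ [True, True]) ! i)"
      "\<And>i. i < m + 2 \<Longrightarrow> (F ^^ i) x \<in> leg u c d ((v' @ [True, True]) ! i)"
  shows False
proof -
  obtain i where i: "i < m" "v ! i \<noteq> v' ! i" using ne len list_eq_iff_nth_eq[of v v'] by auto
  have "(F ^^ i) x \<in> leg u c d (v ! i)" "(F ^^ i) x \<in> leg u c d (v' ! i)"
    using x[of i] i len by (auto simp: nth_append)
  then have "(F ^^ i) x \<in> leg u c d True \<inter> leg u c d False" using i(2) by (cases "v ! i") auto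
  then have ci: "(F ^^ i) x = c" using horseshoe_legs(2)[OF h] by blast
  have "(F ^^ Suc i) x \<in> closed_segment u d" using x(1)[of "Suc i"] i horseshoe_legs(1)[OF h] by auto
  then have "F c = d" using ci h unfolding horseshoe_def by (auto simp: closed_segment_eq_real_ivl split: if_splits)
  then have FFc: "F (F c) = u" and Fu: "F u = u" using h unfolding horseshoe_def by auto
  \<comment> \<open>After \<open>c\<close> come \<open>d\<close> and then \<open>u\<close> forever.
    As \<open>i < m\<close>, this includes time \<open>Suc m\<close>, the position of the last
    \<open>True\<close>, whose leg omits \<open>u\<close>.\<close>
  have "(F ^^ (i + 2 + k)) x = u" for k
    using ci FFc Fu by (induction k) auto
  from this[of "m - Suc i"] have "(F ^^ Suc m) x = u" using i by simp
  moreover have "(v @ [True, True]) ! Suc m = True" using len by (simp add: nth_append)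
  ultimately show False using x(1)[of "Suc m"] horseshoe_legs(3)[OF h] by simp
qed

lemma finite_compact_separated:
  fixes P :: "'b \<Rightarrow> 'a::heine_borel set"
  assumes "finite V" "\<And>v. v \<in> V \<Longrightarrow> compact (P v)"
    "\<And>v w. v \<in> V \<Longrightarrow> w \<in> V \<Longrightarrow> v \<noteq> w \<Longrightarrow> P v \<inter> P w = {}"
  obtains \<epsilon> where "\<epsilon> > 0"
    "\<And>v w x y. v \<in> V \<Longrightarrow> w \<in> V \<Longrightarrow> v \<noteq> w \<Longrightarrow> x \<in> P v \<Longrightarrow> y \<in> P w \<Longrightarrow> \<epsilon> < dist x y"
proof -
  define Q where "Q = {(v, w). v \<in> V \<and> w \<in> V \<and> v \<noteq> w}"
  have "finite Q" by (rule finite_subset[of _ "V \<times> V"]) (auto simp: Q_def assms(1))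
  have "\<exists>\<delta>>0. \<forall>x\<in>P (fst p). \<forall>y\<in>P (snd p). \<delta> \<le> dist x y" if "p \<in> Q" for p
  proof -
    have "fst p \<in> V" "snd p \<in> V" "fst p \<noteq> snd p" using that by (auto simp: Q_def)
    then show ?thesis using separate_compact_closed[of "P (fst p)" "P (snd p)"] assms compact_imp_closed by blast
  qed
  then obtain \<delta> where \<delta>: "\<And>p. p \<in> Q \<Longrightarrow> \<delta> p > 0 \<and> (\<forall>x\<in>P (fst p). \<forall>y\<in>P (snd p). \<delta> p \<le> dist x y)"
    by metis
  \<comment> \<open>Halving makes the bound strict, and the inserted 1 covers the case without
    pairs.\<close>
  define \<epsilon> where "\<epsilon> = Min (insert 1 (\<delta> ` Q)) / 2"
  have "Min (insert 1 (\<delta> ` Q)) > 0" using \<open>finite Q\<close> \<delta> by (subst Min_gr_iff) auto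
  moreover have "\<epsilon> < dist x y" if "v \<in> V" "w \<in> V" "v \<noteq> w" "x \<in> P v" "y \<in> P w" for v w x y
  proof -
    have p: "(v, w) \<in> Q" using that by (simp add: Q_def)
    then have "Min (insert 1 (\<delta> ` Q)) \<le> \<delta> (v, w)" using \<open>finite Q\<close> by (intro Min_le) auto
    moreover have "\<delta> (v, w) \<le> dist x y" using \<delta>[OF p] that by auto
    ultimately show ?thesis using \<open>Min (insert 1 (\<delta> ` Q)) > 0\<close> unfolding \<epsilon>_def by linarith
  qed
  ultimately show ?thesis using that[of \<epsilon>] by (simp add: \<epsilon>_def)
qed

context basic_cycle
begin

text \<open>A block consists of \<open>m\<close> free letters followed by \<open>True, True\<close>,
  so \<open>F = g ^^ (2 * n)\<close> realizes \<open>2 ^ m\<close> blocks in \<open>m + 2\<close>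
  steps. Their cylinders, lifted to \<open>C 0\<close>, are compact and disjoint. Hence one
  \<open>\<epsilon>\<close> separates them, and it serves for concatenations of any number
  \<open>q\<close> of blocks.\<close>

lemma entropy_blocks:
  "top_entropy B f \<ge> ereal (real m * ln 2 / real (2 * n * (m + 2)))"
proof -
  define F where "F = (g ^^ n) ^^ 2"
  define L where "L = m + 2"
  note T = itransD[OF g_itrans]
  have Fi: "F ^^ i = g ^^ (2 * n * i)" for i by (simp add: F_def funpow_mult ac_simps)
  have F_maps: "F ` {la..lb} \<subseteq> {la..lb}" and F_cont: "continuous_on {la..lb} F"
    unfolding F_def using funpow_image_subset[OF T(4)] T(5)[of 2] by auto
  obtain u c d where ucd: "u \<in> {la..lb}" "c \<in> {la..lb}" "d \<in> {la..lb}" and h: "horseshoe F u c d"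
    using itrans_mixing_or_splits(1)[OF g_itrans] unfolding has_horseshoe_def F_def by blast
  have seg: "closed_segment u d \<subseteq> {la..lb}" using ucd by (auto simp: closed_segment_eq_real_ivl)
  have cont: "continuous_on (closed_segment u d) F" using continuous_on_subset[OF F_cont seg] .
  define V where "V = {v :: bool list. set v \<subseteq> UNIV \<and> length v = m}"
  have V: "finite V" "card V = 2 ^ m" unfolding V_def
    using finite_lists_length_eq[of "UNIV :: bool set" m] card_lists_length_eq[of "UNIV :: bool set" m] by auto
  define A where "A v = {x \<in> {la..lb}. \<forall>i<L. (F ^^ i) x \<in> leg u c d ((v @ [True, True]) ! i)}" for v
  have "closed (A v)" for v
  proof -
    have "A v = {la..lb} \<inter> (\<Inter>i<L. {la..lb} \<inter> (F ^^ i) -` leg u c d ((v @ [True, True]) ! i))"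
      unfolding A_def by auto
    moreover have "closed ({la..lb} \<inter> (F ^^ i) -` leg u c d \<beta>)" for i \<beta>
      by (rule continuous_closed_preimage[OF continuous_on_funpow[OF F_cont F_maps]]) (auto simp: leg_def)
    ultimately show ?thesis by (simp only:) (rule closed_Int[OF closed_atLeastAtMost closed_INT], blast)
  qed
  define P where "P v = C 0 \<inter> \<phi> -` A v" for v
  have P_comp: "compact (P v)" for v unfolding P_def
    using C_compact_connected closed_vimage[OF \<open>closed (A v)\<close> phi_cont] by (intro compact_Int_closed)
  have P_disj: "P v \<inter> P w = {}" if "v \<in> V" "w \<in> V" "v \<noteq> w" for v w
    using horseshoe_words_disjoint[OF h, of v m w] that unfolding P_def A_def V_def L_def by auto
  obtain \<epsilon> where \<epsilon>: "\<epsilon> > 0"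
    "\<And>v w x y. v \<in> V \<Longrightarrow> w \<in> V \<Longrightarrow> v \<noteq> w \<Longrightarrow> x \<in> P v \<Longrightarrow> y \<in> P w \<Longrightarrow> \<epsilon> < dist x y"
    using finite_compact_separated[of V P, OF V(1) P_comp P_disj] by metis
  have itinerary: "\<exists>x\<in>closed_segment u d. \<forall>k<length vs. (F ^^ (L * k)) x \<in> A (vs ! k)" if "set vs \<subseteq> V" for vs
    using that
  proof (induction vs)
    case Nil
    show ?case by auto
  next
    case (Cons v vs)
    then obtain x where x: "x \<in> closed_segment u d" "\<And>k. k < length vs \<Longrightarrow> (F ^^ (L * k)) x \<in> A (vs ! k)" by auto
    have lenv: "length (v @ [True, True]) = L" using Cons.prems by (simp add: V_def L_def)
    obtain y where y: "y \<in> closed_segment u d" "\<And>i. i < L \<Longrightarrow> (F ^^ i) y \<in> leg u c d ((v @ [True, True]) ! i)" "(F ^^ L) y = x"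
      using horseshoe_word[OF h cont x(1), of "v @ [True, True]"] unfolding lenv by blast
    have "(F ^^ (L * k)) y \<in> A ((v # vs) ! k)" if "k < length (v # vs)" for k
    proof (cases k)
      case 0
      then show ?thesis using y seg by (auto simp: A_def)
    next
      case (Suc j)
      have "(F ^^ (L * k)) y = (F ^^ (L * j + L)) y" by (simp add: Suc add.commute)
      also have "\<dots> = (F ^^ (L * j)) x" by (simp only: funpow_add o_apply y(3))
      finally show ?thesis using x(2)[of j] that Suc by simp
    qed
    then show ?case using y(1) by blast
  qed
  have sep: "ereal (real q * real m * ln 2) \<le> (SUP E\<in>separated_subsets B f (2 * n * L * q) \<epsilon>. ereal (ln (real (card E))))"
    for q
  proof -
    define Vs where "Vs = {vs. set vs \<subseteq> V \<and> length vs = q}"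
    have Vs: "finite Vs" "card Vs = (2 ^ m) ^ q" unfolding Vs_def
      using finite_lists_length_eq[OF V(1)] card_lists_length_eq[OF V(1)] V(2) by auto
    have "\<exists>b. b \<in> B \<and> (\<forall>k<q. (f ^^ (2 * n * (L * k))) b \<in> P (vs ! k))" if vs: "vs \<in> Vs" for vs
    proof -
      obtain x where x: "x \<in> closed_segment u d" "\<And>k. k < q \<Longrightarrow> (F ^^ (L * k)) x \<in> A (vs ! k)"
        using itinerary[of vs] vs unfolding Vs_def by blast
      have "x \<in> {la..lb}" using x(1) seg by blast
      then obtain x' where "x' \<in> C 0" "\<phi> x' = x" by (rule phi_surj_C0)
      then obtain b where b: "b \<in> B" "b \<in> C 0" "\<phi> b = x" using B_meets_fibre by metis
      have "(f ^^ (2 * n * (L * k))) b \<in> P (vs ! k)" if k: "k < q" for k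
      proof -
        have "(f ^^ (2 * n * (L * k))) b \<in> C (2 * n * (L * k) + 0)" using C_funpow[of _ 0] b(2) by blast
        moreover have "C (2 * n * (L * k) + 0) = C 0" using C_mod[of "2 * n * (L * k)"] by simp
        moreover have "\<phi> ((f ^^ (2 * n * (L * k))) b) = (F ^^ (L * k)) x"
          using gk_phi[of b] b B_sub unfolding Fi by (metis subsetD)
        ultimately show ?thesis using x(2)[OF k] by (simp add: P_def)
      qed
      then show ?thesis using b(1) by blast
    qed
    then obtain \<beta> where \<beta>: "\<And>vs. vs \<in> Vs \<Longrightarrow> \<beta> vs \<in> B"
      "\<And>vs k. vs \<in> Vs \<Longrightarrow> k < q \<Longrightarrow> (f ^^ (2 * n * (L * k))) (\<beta> vs) \<in> P (vs ! k)" by metis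
    have far: "\<exists>i<2 * n * L * q. dist ((f ^^ i) (\<beta> vs)) ((f ^^ i) (\<beta> ws)) > \<epsilon>"
      if vw: "vs \<in> Vs" "ws \<in> Vs" "vs \<noteq> ws" for vs ws
    proof -
      obtain k where k: "k < q" "vs ! k \<noteq> ws ! k"
        using vw list_eq_iff_nth_eq[of vs ws] unfolding Vs_def by auto
      have "vs ! k \<in> V" "ws ! k \<in> V" using vw k unfolding Vs_def by (auto simp: subset_iff)
      then have "dist ((f ^^ (2 * n * (L * k))) (\<beta> vs)) ((f ^^ (2 * n * (L * k))) (\<beta> ws)) > \<epsilon>"
        using \<epsilon>(2) k(2) \<beta>(2)[OF vw(1) k(1)] \<beta>(2)[OF vw(2) k(1)] by blast
      moreover have "2 * n * L * k < 2 * n * L * q" using n1 k(1) by (intro mult_less_mono2) (simp_all add: L_def)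
      then have "2 * n * (L * k) < 2 * n * L * q" by (simp only: mult.assoc)
      ultimately show ?thesis by blast
    qed
    have "inj_on \<beta> Vs"
    proof (rule inj_onI, rule ccontr)
      fix vs ws assume "vs \<in> Vs" "ws \<in> Vs" "\<beta> vs = \<beta> ws" "vs \<noteq> ws"
      then show False using far[of vs ws] \<epsilon>(1) by auto
    qed
    then have card: "card (\<beta> ` Vs) = (2 ^ m) ^ q" using Vs(2) by (simp add: card_image)
    have "card (\<beta> ` Vs) \<noteq> 0" unfolding card by simp
    then have "\<beta> ` Vs \<noteq> {}" by force
    then have "\<beta> ` Vs \<in> separated_subsets B f (2 * n * L * q) \<epsilon>"
      unfolding separated_subsets_def using \<beta>(1) Vs(1) far by auto
    moreover have "ln (real (card (\<beta> ` Vs))) = real q * real m * ln 2"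
      unfolding card by (simp add: ln_realpow)
    ultimately show ?thesis by (intro SUP_upper2[of "\<beta> ` Vs"]) auto
  qed
  define X where "X N = (SUP E\<in>separated_subsets B f N \<epsilon>. ereal (ln (real (card E)))) / ereal (real N)" for N
  \<comment> \<open>\<open>Suc q\<close> keeps the times positive. A bound along this subsequence
    suffices because the growth rate is a limsup.\<close>
  define r where "r q = 2 * n * L * Suc q" for q
  have nL: "0 < 2 * n * L" using n1 by (simp add: L_def)
  then have "strict_mono r" unfolding r_def strict_mono_def by (simp add: mult_less_mono2)
  have "ereal (real m * ln 2 / real (2 * n * L)) \<le> X (r q)" for q
  proof -
    have "real (r q) = real (Suc q) * real (2 * n * L)" unfolding r_def by (simp only: of_nat_mult mult.commute)
    then have "real m * ln 2 / real (2 * n * L) = real (Suc q) * real m * ln 2 / real (r q)"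
      by (simp only: mult.assoc mult_divide_mult_cancel_left_if of_nat_eq_0_iff nat.distinct if_False)
    moreover have "0 < r q" unfolding r_def using nL by (intro mult_pos_pos) simp_all
    ultimately have "ereal (real m * ln 2 / real (2 * n * L)) = ereal (real (Suc q) * real m * ln 2) / ereal (real (r q))"
      by simp
    also have "\<dots> \<le> X (r q)" unfolding X_def
      by (rule ereal_divide_right_mono[OF sep[of "Suc q", folded r_def]]) (use \<open>0 < r q\<close> in simp)
    finally show ?thesis .
  qed
  then have "ereal (real m * ln 2 / real (2 * n * L)) \<le> limsup (X \<circ> r)"
    by (intro le_Limsup) auto
  also have "\<dots> \<le> limsup X" using limsup_subseq_mono[OF \<open>strict_mono r\<close>] .
  also have "\<dots> \<le> top_entropy B f" unfolding top_entropy_def X_def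
    by (rule SUP_upper2[of \<epsilon>]) (use \<epsilon> in auto)
  finally show ?thesis by (simp add: L_def)
qed

text \<open>The two fixed letters of a block cost a factor \<open>m / (m + 2)\<close>, which tends
  to 1 as the blocks grow.\<close>

lemma entropy_bound: "top_entropy B f \<ge> ereal (ln 2 * inverse (2 * real n))"
proof -
  have "(\<lambda>m. 1 - 2 * inverse (real (m + 2))) \<longlonglongrightarrow> 1 - 2 * 0"
    by (intro tendsto_intros LIMSEQ_ignore_initial_segment[OF lim_inverse_n])
  moreover have "1 - 2 * inverse (real (m + 2)) = real m / (real m + 2)" for m
    by (simp add: field_simps)
  ultimately have "(\<lambda>m. real m / (real m + 2)) \<longlonglongrightarrow> 1" by simp
  then have "(\<lambda>m. ln 2 * inverse (2 * real n) * (real m / (real m + 2))) \<longlonglongrightarrow> ln 2 * inverse (2 * real n) * 1"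
    by (intro tendsto_intros)
  then have lim: "(\<lambda>m. ereal (ln 2 * inverse (2 * real n) * (real m / (real m + 2)))) \<longlonglongrightarrow> ereal (ln 2 * inverse (2 * real n))"
    by simp
  have "ereal (ln 2 * inverse (2 * real n) * (real m / (real m + 2))) \<le> top_entropy B f" for m
    using entropy_blocks[of m] by (simp add: field_simps)
  then show ?thesis by (intro LIMSEQ_le_const2[OF lim]) blast
qed

end

theorem theorem4p1:
  fixes f :: "real \<Rightarrow> real" and n :: nat and I M B :: "real set"
  assumes "continuous_on {0..1} f" and "f ` {0..1} \<subseteq> {0..1}"
    and "periodic_interval f n I"
    and "M = cycle f n I"
    and "basic_set f M B"
  shows "(\<exists>M' g \<phi>. almost_conjugates n \<phi> M f B M' g \<and> transitive_on M' g) \<and>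
    perfect_set B \<and>
    transitive_on B f \<and>
    (\<forall>z\<in>{0..1}. B \<subseteq> omega_limit f z \<longrightarrow> omega_limit f z = B) \<and>
    top_entropy B f \<ge> ereal (ln 2 * inverse (2 * real n)) \<and>
    B \<subseteq> closure (Per f) \<and>
    (\<exists>J k B'. (\<exists>c d. c < d \<and> J = {c..d}) \<and> J \<subseteq> I \<and> (k = n \<or> k = 2 * n) \<and>
       B' = closure (interior J \<inter> B) \<and>
       (f ^^ k) ` J = J \<and>
       (f ^^ k) ` B' = B' \<and>
       (\<forall>i j. i < j \<and> j < k \<longrightarrow> (\<exists>p. (f ^^ i) ` B' \<inter> (f ^^ j) ` B' \<subseteq> {p})) \<and>
       (\<Union>i<k. (f ^^ i) ` B') = B \<and>
       (\<exists>K' g \<phi>. almost_conjugates 1 \<phi> J (f ^^ k) B' K' g \<and> mixing_on K' g) \<and>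
       (k = n \<longrightarrow> J = I))"
proof -
  interpret basic_cycle f n I M B
    by standard (fact assms)+
  have conjugate: "\<exists>M' g \<phi>. almost_conjugates n \<phi> M f B M' g \<and> transitive_on M' g"
    using B_almost_conjugate g_transitive by blast
  show ?thesis
    by (intro conjI ballI impI conjugate B_perfect B_transitive omega_limit_maximal entropy_bound
        B_periodic decomposition_exists[unfolded decomposition_def])
qed

end
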